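(* Let $v$ be a valuation of a number field $E$, and suppose that the characteristic $p$ of $k_v$ is odd. Let $m$ be an odd integer with $7\le m<p$. Let $x$ and $y$ be elements of $\mathrm{PSL}_2(\mathfrak{o}_v)$ such that the group $\Gamma:=\langle x,y\rangle$ is non-solvable. Suppose that $\overline h_v(x)$ has order $m$ in $\mathrm{PSL}_2(k_v)$. Set $$\Theta_1=\langle x^m,y\rangle\le\Gamma$$ and $$\Theta_2=\langle x,\,yxy^{-1}xyx^{-1}y^{-1}\rangle\le\Gamma,$$ and set $\theta_i=|\Gamma:\Theta_i|$ for $i=1,2$. Then $$\max(\theta_1,\theta_2)\ge p.$$
   Context: For a (non-archimedean, discrete) valuation $v$ of a field $E$, $\mathfrak{o}_v$ is its valuation ring, $\mathfrak{m}_v$ the maximal ideal of $\mathfrak{o}_v$, and $k_v=\mathfrak{o}_v/\mathfrak{m}_v$ the residue field. For a commutative ring $R$, $\mathrm{PSL}_2(R)$ is the quotient of $\mathrm{SL}_2(R)$ by its subgroup of scalar matrices. The homomorphism $\overline h_v:\mathrm{PSL}_2(\mathfrak{o}_v)\to\mathrm{PSL}_2(k_v)$ is induced by reducing matrix entries modulo $\mathfrak{m}_v$. $|\Gamma:\Theta|$ denotes the index (possibly infinite) of a subgroup. *)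

theory Defs
  imports "HOL-Algebra.Algebra" "HOL-Algebra.Algebraic_Closure_Type" "HOL-Library.Extended_Nat"
begin

definition number_field :: "('a, 'b) ring_scheme \<Rightarrow> bool" where
  "number_field E \<longleftrightarrow> field E \<and>
     (\<exists>h \<in> ring_hom (ring_of_type_algebra :: rat ring) E.
        ring.finite_dimension E (range h) (carrier E))"

text \<open>
  The value \<open>v \<zero> = \<infinity>\<close> is encoded by treating zero separately, so \<open>v\<close> is only constrained on
  nonzero elements.  The value group is any nonzero subgroup of the integers;
  normalized valuations are those for which it is everything.
\<close>
definition discrete_valuation :: "('a, 'b) ring_scheme \<Rightarrow> ('a \<Rightarrow> int) \<Rightarrow> bool" where
  "discrete_valuation E v \<longleftrightarrow>
     v \<in> hom (mult_of E) integer_group \<and>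
     (\<forall>x \<in> carrier (mult_of E). \<forall>y \<in> carrier (mult_of E).
        x \<oplus>\<^bsub>E\<^esub> y \<noteq> \<zero>\<^bsub>E\<^esub> \<longrightarrow> min (v x) (v y) \<le> v (x \<oplus>\<^bsub>E\<^esub> y)) \<and>
     (\<exists>x \<in> carrier (mult_of E). v x \<noteq> 0)"

definition valuation_ring :: "('a, 'b) ring_scheme \<Rightarrow> ('a \<Rightarrow> int) \<Rightarrow> ('a, 'b) ring_scheme" where
  "valuation_ring E v = E\<lparr>carrier := {x \<in> carrier E. x = \<zero>\<^bsub>E\<^esub> \<or> 0 \<le> v x}\<rparr>"

definition valuation_ideal :: "('a, 'b) ring_scheme \<Rightarrow> ('a \<Rightarrow> int) \<Rightarrow> 'a set" where
  "valuation_ideal E v = {x \<in> carrier E. x = \<zero>\<^bsub>E\<^esub> \<or> 0 < v x}"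

definition residue_field :: "('a, 'b) ring_scheme \<Rightarrow> ('a \<Rightarrow> int) \<Rightarrow> 'a set ring" where
  "residue_field E v = valuation_ring E v Quot valuation_ideal E v"

text \<open>The additive order of \<open>\<one>\<close>; \<^const>\<open>group.ord\<close> is \<open>0\<close> for elements of infinite order.\<close>
definition ring_characteristic :: "('a, 'b) ring_scheme \<Rightarrow> nat" where
  "ring_characteristic R = group.ord (add_monoid R) \<one>\<^bsub>R\<^esub>"

text \<open>The tuple \<open>(a, b, c, d)\<close> stands for the matrix with rows \<open>(a, b)\<close> and \<open>(c, d)\<close>.\<close>
type_synonym 'a mat2 = "'a \<times> 'a \<times> 'a \<times> 'a"

definition SL2 :: "('a, 'b) ring_scheme \<Rightarrow> 'a mat2 monoid" where
  "SL2 R = \<lparr>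
     carrier = {(a, b, c, d). a \<in> carrier R \<and> b \<in> carrier R \<and> c \<in> carrier R \<and> d \<in> carrier R \<and>
                  (a \<otimes>\<^bsub>R\<^esub> d) \<ominus>\<^bsub>R\<^esub> (b \<otimes>\<^bsub>R\<^esub> c) = \<one>\<^bsub>R\<^esub>},
     monoid.mult = (\<lambda>(a, b, c, d) (a', b', c', d').
       ((a \<otimes>\<^bsub>R\<^esub> a') \<oplus>\<^bsub>R\<^esub> (b \<otimes>\<^bsub>R\<^esub> c'), (a \<otimes>\<^bsub>R\<^esub> b') \<oplus>\<^bsub>R\<^esub> (b \<otimes>\<^bsub>R\<^esub> d'),
        (c \<otimes>\<^bsub>R\<^esub> a') \<oplus>\<^bsub>R\<^esub> (d \<otimes>\<^bsub>R\<^esub> c'), (c \<otimes>\<^bsub>R\<^esub> b') \<oplus>\<^bsub>R\<^esub> (d \<otimes>\<^bsub>R\<^esub> d'))),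
     one = (\<one>\<^bsub>R\<^esub>, \<zero>\<^bsub>R\<^esub>, \<zero>\<^bsub>R\<^esub>, \<one>\<^bsub>R\<^esub>)\<rparr>"

definition SL2_scalars :: "('a, 'b) ring_scheme \<Rightarrow> 'a mat2 set" where
  "SL2_scalars R = {(a, \<zero>\<^bsub>R\<^esub>, \<zero>\<^bsub>R\<^esub>, a) | a. True} \<inter> carrier (SL2 R)"

definition PSL2 :: "('a, 'b) ring_scheme \<Rightarrow> 'a mat2 set monoid" where
  "PSL2 R = SL2 R Mod SL2_scalars R"

definition mat2_map :: "('a \<Rightarrow> 'c) \<Rightarrow> 'a mat2 \<Rightarrow> 'c mat2" where
  "mat2_map f = (\<lambda>(a, b, c, d). (f a, f b, f c, f d))"

text \<open>
  For a ring homomorphism \<open>f\<close> into \<open>S\<close>, the class of a matrix \<open>A\<close> is sent to the class of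
  \<open>mat2_map f A\<close>; \<^const>\<open>the_elem\<close> extracts the common value over all representatives.
\<close>
definition PSL2_map :: "('c, 'd) ring_scheme \<Rightarrow> ('a \<Rightarrow> 'c) \<Rightarrow> 'a mat2 set \<Rightarrow> 'c mat2 set" where
  "PSL2_map S f C = the_elem ((\<lambda>A. SL2_scalars S #>\<^bsub>SL2 S\<^esub> mat2_map f A) ` C)"

definition PSL2_reduction ::
    "('a, 'b) ring_scheme \<Rightarrow> ('a \<Rightarrow> int) \<Rightarrow> 'a mat2 set \<Rightarrow> 'a set mat2 set" where
  "PSL2_reduction E v =
     PSL2_map (residue_field E v) (\<lambda>a. valuation_ideal E v +>\<^bsub>valuation_ring E v\<^esub> a)"

definition subgroup_index :: "('a, 'b) monoid_scheme \<Rightarrow> 'a set \<Rightarrow> enat" where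
  "subgroup_index G H =
     (if finite (rcosets\<^bsub>G\<^esub> H) then enat (card (rcosets\<^bsub>G\<^esub> H)) else \<infinity>)"

end

theory Submission
  imports Defs
begin

text \<open>
  If \<open>\<Gamma>\<close> is covered by fewer than \<open>p\<close> cosets of \<open>\<Theta>\<^sub>1 = \<langle>x\<^sup>m, y\<rangle>\<close>,
  then \<open>\<Gamma>\<close> is metabelian; so \<open>\<theta>\<^sub>1 \<ge> p\<close> when \<open>\<Gamma>\<close> is not solvable.

  Lift \<open>x\<close>, \<open>y\<close> to matrices \<open>U\<close>, \<open>V\<close> over the valuation ring \<open>R\<close>, with residue field \<open>K\<close>, and add
  \<open>-1\<close> to the generators.  The main tool that exploits the index is
  \<open>few_cosets_prime_power_mem\<close>: if a group is covered by fewer than \<open>p\<close> cosets of \<open>B\<close>, then by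
  the pigeonhole principle some \<open>z\<^sup>j\<close> with \<open>0 < j < p\<close> lies in \<open>B\<close>, and as \<open>j\<close> is prime to
  \<open>p\<close>, from \<open>z\<^sup>p \<in> B\<close> follows \<open>z \<in> B\<close>.  In short, \<open>B\<close> contains every element that is
  of order \<open>p\<close> in an appropriate sense.  It is applied to groups \<open>B\<close> that contain \<open>U\<^sup>m\<close>, \<open>V\<close>
  and \<open>-1\<close>.  Since \<open>U\<^sup>m\<close> reduces to a scalar, there are many such groups, while \<open>U\<close> itself
  is far from being a scalar.

  Coordinates are taken in a cyclic algebra.  Residually \<open>U\<close> has distinct eigenvalues, for otherwise
  \<open>U\<^sup>2\<close> would have order dividing \<open>p\<close>, contrary to \<open>m < p\<close>; so \<open>disc U = (tr U)\<^sup>2 - 4\<close>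
  is a unit.  The trace form is therefore nondegenerate on \<open>S = R[U]\<close>, and \<open>V = a + W\<close> with \<open>a \<in> S\<close>
  and \<open>W\<close> orthogonal to \<open>S\<close> (\<open>frame_exists\<close>).  Then \<open>s W = W s\<^sup>*\<close> for \<open>s \<in> S\<close>, where
  \<open>s\<^sup>*\<close> is the adjugate, and \<open>W\<^sup>2\<close> is a scalar \<open>q\<close>.  Everything takes place in \<open>S + S W\<close>, whose
  multiplication is \<open>elt_mult\<close>.  The value of \<open>q\<close> distinguishes the cases.

  If \<open>q = 0\<close>, the group is triangular and hence metabelian (\<open>solvable_triangular\<close>).

  If \<open>q\<close> is nonzero but not a unit, the residual group is triangular, and the commutator of \<open>U\<close> and
  \<open>V\<close> is residually unipotent.  So it belongs to every \<open>B\<close> as above.  Choosing \<open>B\<close> to consist of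
  the elements that are residually unipotent up to sign, respectively of those that
  residually commute with \<open>V\<close>, leads to a contradiction (\<open>reducible_contradiction\<close>).

  If \<open>q\<close> is a unit, the residual group is shown to be dihedral (\<open>residual_dihedral\<close>): a power \<open>V\<^sup>j\<close>
  with \<open>0 < j < p\<close> is scalar, since otherwise \<open>V\<close> would commute residually with
  \<open>U V U\<^sup>-\<^sup>1\<close>, which forces \<open>q = 0\<close> residually.  So the residual group is finite, and the tool
  shows that it has no elements of order \<open>p\<close>.  In such a group the centralizers of noncentral elements
  partition the noncentral elements, and a count of conjugates shows that a centralizer with at
  least 14 elements is normal (\<open>large_centralizer_normal\<close>); the exceptional groups \<open>A\<^sub>4\<close>,
  \<open>S\<^sub>4\<close>, \<open>A\<^sub>5\<close> have smaller ones.  This is where \<open>7 \<le> m\<close> enters.  Hence \<open>V\<close>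
  inverts \<open>U\<close> residually, so that \<open>a\<close> reduces to zero.  If \<open>a = 0\<close>, the group is monomial and
  again metabelian (\<open>solvable_monomial\<close>).  Otherwise \<open>a = c a'\<close> with a nonunit \<open>c\<close> and with \<open>a'\<close>
  residually nonzero, because of any two elements of a valuation ring one divides the other.  After
  division by \<open>c\<close> the element \<open>V U V\<^sup>-\<^sup>1 U\<close> behaves like an element of order \<open>p\<close>, and a
  suitable \<open>B\<close> yields a contradiction (\<open>dihedral_contradiction\<close>).
\<close>

section \<open>Two by two matrices\<close>

text \<open>
  The ambient ring of the special linear group: sums of matrices, traces and scalar matrices are
  needed below, and with the same multiplication and unit \<^term>\<open>SL2 R\<close> is its subset of
  matrices of determinant one.
\<close>
definition mat2_ring :: "('a, 'b) ring_scheme \<Rightarrow> 'a mat2 ring" where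
  "mat2_ring R = \<lparr>
     carrier = carrier R \<times> carrier R \<times> carrier R \<times> carrier R,
     monoid.mult = (\<lambda>(a, b, c, d) (a', b', c', d').
       ((a \<otimes>\<^bsub>R\<^esub> a') \<oplus>\<^bsub>R\<^esub> (b \<otimes>\<^bsub>R\<^esub> c'), (a \<otimes>\<^bsub>R\<^esub> b') \<oplus>\<^bsub>R\<^esub> (b \<otimes>\<^bsub>R\<^esub> d'),
        (c \<otimes>\<^bsub>R\<^esub> a') \<oplus>\<^bsub>R\<^esub> (d \<otimes>\<^bsub>R\<^esub> c'), (c \<otimes>\<^bsub>R\<^esub> b') \<oplus>\<^bsub>R\<^esub> (d \<otimes>\<^bsub>R\<^esub> d'))),
     one = (\<one>\<^bsub>R\<^esub>, \<zero>\<^bsub>R\<^esub>, \<zero>\<^bsub>R\<^esub>, \<one>\<^bsub>R\<^esub>),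
     ring.zero = (\<zero>\<^bsub>R\<^esub>, \<zero>\<^bsub>R\<^esub>, \<zero>\<^bsub>R\<^esub>, \<zero>\<^bsub>R\<^esub>),
     ring.add = (\<lambda>(a, b, c, d) (a', b', c', d').
       (a \<oplus>\<^bsub>R\<^esub> a', b \<oplus>\<^bsub>R\<^esub> b', c \<oplus>\<^bsub>R\<^esub> c', d \<oplus>\<^bsub>R\<^esub> d'))\<rparr>"

definition mat_trace :: "('a, 'b) ring_scheme \<Rightarrow> 'a mat2 \<Rightarrow> 'a" where
  "mat_trace R = (\<lambda>(a, b, c, d). a \<oplus>\<^bsub>R\<^esub> d)"

definition mat_det :: "('a, 'b) ring_scheme \<Rightarrow> 'a mat2 \<Rightarrow> 'a" where
  "mat_det R = (\<lambda>(a, b, c, d). (a \<otimes>\<^bsub>R\<^esub> d) \<ominus>\<^bsub>R\<^esub> (b \<otimes>\<^bsub>R\<^esub> c))"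

definition mat_adj :: "('a, 'b) ring_scheme \<Rightarrow> 'a mat2 \<Rightarrow> 'a mat2" where
  "mat_adj R = (\<lambda>(a, b, c, d). (d, \<ominus>\<^bsub>R\<^esub> b, \<ominus>\<^bsub>R\<^esub> c, a))"

definition mat_scal :: "('a, 'b) ring_scheme \<Rightarrow> 'a \<Rightarrow> 'a mat2" where
  "mat_scal R r = (r, \<zero>\<^bsub>R\<^esub>, \<zero>\<^bsub>R\<^esub>, r)"

lemma mat2_sel [simp]:
  "carrier (mat2_ring R) = carrier R \<times> carrier R \<times> carrier R \<times> carrier R"
  "(a, b, c, d) \<otimes>\<^bsub>mat2_ring R\<^esub> (a', b', c', d') =
     ((a \<otimes>\<^bsub>R\<^esub> a') \<oplus>\<^bsub>R\<^esub> (b \<otimes>\<^bsub>R\<^esub> c'), (a \<otimes>\<^bsub>R\<^esub> b') \<oplus>\<^bsub>R\<^esub> (b \<otimes>\<^bsub>R\<^esub> d'),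
      (c \<otimes>\<^bsub>R\<^esub> a') \<oplus>\<^bsub>R\<^esub> (d \<otimes>\<^bsub>R\<^esub> c'), (c \<otimes>\<^bsub>R\<^esub> b') \<oplus>\<^bsub>R\<^esub> (d \<otimes>\<^bsub>R\<^esub> d'))"
  "\<one>\<^bsub>mat2_ring R\<^esub> = (\<one>\<^bsub>R\<^esub>, \<zero>\<^bsub>R\<^esub>, \<zero>\<^bsub>R\<^esub>, \<one>\<^bsub>R\<^esub>)"
  "\<zero>\<^bsub>mat2_ring R\<^esub> = (\<zero>\<^bsub>R\<^esub>, \<zero>\<^bsub>R\<^esub>, \<zero>\<^bsub>R\<^esub>, \<zero>\<^bsub>R\<^esub>)"
  "(a, b, c, d) \<oplus>\<^bsub>mat2_ring R\<^esub> (a', b', c', d') =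
     (a \<oplus>\<^bsub>R\<^esub> a', b \<oplus>\<^bsub>R\<^esub> b', c \<oplus>\<^bsub>R\<^esub> c', d \<oplus>\<^bsub>R\<^esub> d')"
  by (simp_all add: mat2_ring_def)

lemma mat_fun_sel [simp]:
  "mat_trace R (a, b, c, d) = a \<oplus>\<^bsub>R\<^esub> d"
  "mat_det R (a, b, c, d) = (a \<otimes>\<^bsub>R\<^esub> d) \<ominus>\<^bsub>R\<^esub> (b \<otimes>\<^bsub>R\<^esub> c)"
  "mat_adj R (a, b, c, d) = (d, \<ominus>\<^bsub>R\<^esub> b, \<ominus>\<^bsub>R\<^esub> c, a)"
  by (simp_all add: mat_trace_def mat_det_def mat_adj_def)

context cring
begin

abbreviation M where "M \<equiv> mat2_ring R"
abbreviation tr where "tr \<equiv> mat_trace R"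
abbreviation dt where "dt \<equiv> mat_det R"
abbreviation adj where "adj \<equiv> mat_adj R"
abbreviation sc where "sc \<equiv> mat_scal R"

lemma mat2_ring_is_ring: "ring M"
proof (rule ringI)
  show "abelian_group M"
  proof (rule abelian_groupI)
    fix A assume "A \<in> carrier M"
    then obtain a b c d where A: "A = (a, b, c, d)"
      "a \<in> carrier R" "b \<in> carrier R" "c \<in> carrier R" "d \<in> carrier R" by auto
    show "\<exists>B\<in>carrier M. B \<oplus>\<^bsub>M\<^esub> A = \<zero>\<^bsub>M\<^esub>"
      using A by (intro bexI[of _ "(\<ominus> a, \<ominus> b, \<ominus> c, \<ominus> d)"]) (auto simp: l_neg)
  qed (auto simp: a_ac)
  show "monoid M"
    by (rule monoidI) (clarsimp; intro conjI; algebra)+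
qed (clarsimp; intro conjI; algebra)+

lemma mat_closed [simp]:
  "A \<in> carrier M \<Longrightarrow> tr A \<in> carrier R"
  "A \<in> carrier M \<Longrightarrow> dt A \<in> carrier R"
  "A \<in> carrier M \<Longrightarrow> adj A \<in> carrier M"
  "r \<in> carrier R \<Longrightarrow> sc r \<in> carrier M"
  by (auto simp: mat_scal_def)

end

sublocale cring \<subseteq> M: ring "mat2_ring R"
  by (rule mat2_ring_is_ring)

context cring
begin

lemma adj_adj [simp]: "A \<in> carrier M \<Longrightarrow> adj (adj A) = A"
  by auto

lemma adj_mult: "A \<in> carrier M \<Longrightarrow> B \<in> carrier M \<Longrightarrow> adj (A \<otimes>\<^bsub>M\<^esub> B) = adj B \<otimes>\<^bsub>M\<^esub> adj A"
  by (clarsimp; intro conjI; algebra)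

lemma adj_add: "A \<in> carrier M \<Longrightarrow> B \<in> carrier M \<Longrightarrow> adj (A \<oplus>\<^bsub>M\<^esub> B) = adj A \<oplus>\<^bsub>M\<^esub> adj B"
  by (clarsimp; intro conjI; algebra)

lemma adj_one [simp]: "adj \<one>\<^bsub>M\<^esub> = \<one>\<^bsub>M\<^esub>"
  by simp

lemma adj_zero [simp]: "adj \<zero>\<^bsub>M\<^esub> = \<zero>\<^bsub>M\<^esub>"
  by simp

lemma adj_sc [simp]: "adj (sc r) = sc r"
  by (simp add: mat_scal_def)

lemma mult_adj: "A \<in> carrier M \<Longrightarrow> A \<otimes>\<^bsub>M\<^esub> adj A = sc (dt A)"
  by (clarsimp simp: mat_scal_def; intro conjI; algebra)

lemma adj_times: "A \<in> carrier M \<Longrightarrow> adj A \<otimes>\<^bsub>M\<^esub> A = sc (dt A)"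
  by (clarsimp simp: mat_scal_def; intro conjI; algebra)

lemma add_adj: "A \<in> carrier M \<Longrightarrow> A \<oplus>\<^bsub>M\<^esub> adj A = sc (tr A)"
  by (clarsimp simp: mat_scal_def; intro conjI; algebra)

lemma dt_mult: "A \<in> carrier M \<Longrightarrow> B \<in> carrier M \<Longrightarrow> dt (A \<otimes>\<^bsub>M\<^esub> B) = dt A \<otimes> dt B"
  by (clarsimp; algebra)

lemma dt_adj [simp]: "A \<in> carrier M \<Longrightarrow> dt (adj A) = dt A"
  by (clarsimp; algebra)

lemma dt_one [simp]: "dt \<one>\<^bsub>M\<^esub> = \<one>"
  by (simp; algebra)

lemma tr_add: "A \<in> carrier M \<Longrightarrow> B \<in> carrier M \<Longrightarrow> tr (A \<oplus>\<^bsub>M\<^esub> B) = tr A \<oplus> tr B"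
  by (clarsimp; algebra)

lemma tr_mult_commute: "A \<in> carrier M \<Longrightarrow> B \<in> carrier M \<Longrightarrow> tr (A \<otimes>\<^bsub>M\<^esub> B) = tr (B \<otimes>\<^bsub>M\<^esub> A)"
  by (clarsimp; algebra)

lemma tr_sc_mult: "r \<in> carrier R \<Longrightarrow> A \<in> carrier M \<Longrightarrow> tr (sc r \<otimes>\<^bsub>M\<^esub> A) = r \<otimes> tr A"
  by (clarsimp simp: mat_scal_def; algebra)

lemma tr_sc: "r \<in> carrier R \<Longrightarrow> tr (sc r) = r \<oplus> r"
  by (simp add: mat_scal_def)

lemma tr_adj [simp]: "A \<in> carrier M \<Longrightarrow> tr (adj A) = tr A"
  by (clarsimp; algebra)

lemma sc_mult: "r \<in> carrier R \<Longrightarrow> s \<in> carrier R \<Longrightarrow> sc (r \<otimes> s) = sc r \<otimes>\<^bsub>M\<^esub> sc s"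
  by (simp add: mat_scal_def)

lemma sc_add: "r \<in> carrier R \<Longrightarrow> s \<in> carrier R \<Longrightarrow> sc (r \<oplus> s) = sc r \<oplus>\<^bsub>M\<^esub> sc s"
  by (simp add: mat_scal_def)

lemma sc_one: "sc \<one> = \<one>\<^bsub>M\<^esub>"
  by (simp add: mat_scal_def)

lemma sc_zero: "sc \<zero> = \<zero>\<^bsub>M\<^esub>"
  by (simp add: mat_scal_def)

lemma sc_commute: "r \<in> carrier R \<Longrightarrow> A \<in> carrier M \<Longrightarrow> sc r \<otimes>\<^bsub>M\<^esub> A = A \<otimes>\<^bsub>M\<^esub> sc r"
  by (clarsimp simp: mat_scal_def; intro conjI; algebra)

lemma mat_uminus: "a \<in> carrier R \<Longrightarrow> b \<in> carrier R \<Longrightarrow> c \<in> carrier R \<Longrightarrow> d \<in> carrier R \<Longrightarrow>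
    \<ominus>\<^bsub>M\<^esub> (a, b, c, d) = (\<ominus> a, \<ominus> b, \<ominus> c, \<ominus> d)"
  by (rule M.minus_equality) (auto simp: l_neg)

lemma adj_uminus: "A \<in> carrier M \<Longrightarrow> adj (\<ominus>\<^bsub>M\<^esub> A) = \<ominus>\<^bsub>M\<^esub> adj A"
  by (clarsimp simp: mat_uminus)

lemma sc_uminus: "r \<in> carrier R \<Longrightarrow> sc (\<ominus> r) = \<ominus>\<^bsub>M\<^esub> sc r"
  by (simp add: mat_scal_def mat_uminus)

lemma tr_uminus: "A \<in> carrier M \<Longrightarrow> tr (\<ominus>\<^bsub>M\<^esub> A) = \<ominus> tr A"
  by (clarsimp simp: mat_uminus; algebra)

lemma dt_uminus: "A \<in> carrier M \<Longrightarrow> dt (\<ominus>\<^bsub>M\<^esub> A) = dt A"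
  by (clarsimp simp: mat_uminus; algebra)

lemma sc_eq_iff [simp]: "sc r = sc s \<longleftrightarrow> r = s"
  by (simp add: mat_scal_def)

lemma SL2_sel:
  "carrier (SL2 R) = {A \<in> carrier M. dt A = \<one>}" "A \<otimes>\<^bsub>SL2 R\<^esub> B = A \<otimes>\<^bsub>M\<^esub> B" "\<one>\<^bsub>SL2 R\<^esub> = \<one>\<^bsub>M\<^esub>"
  by (auto simp: SL2_def mat2_ring_def)

lemma SL2_group: "group (SL2 R)"
proof (rule groupI)
  fix A assume A: "A \<in> carrier (SL2 R)"
  then show "\<exists>B\<in>carrier (SL2 R). B \<otimes>\<^bsub>SL2 R\<^esub> A = \<one>\<^bsub>SL2 R\<^esub>"
    by (intro bexI[of _ "adj A"]) (simp_all add: SL2_sel adj_times sc_one del: mat2_sel)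
qed (simp_all add: SL2_sel M.m_assoc dt_mult del: mat2_sel)

lemma SL2_inv: "A \<in> carrier (SL2 R) \<Longrightarrow> inv\<^bsub>SL2 R\<^esub> A = adj A"
  by (rule monoid.inv_unique'[OF group.is_monoid[OF SL2_group], symmetric])
    (simp_all add: SL2_sel adj_times mult_adj sc_one del: mat2_sel)

end

declare mat2_sel [simp del] mat_fun_sel [simp del]

section \<open>Finite groups partitioned by centralizers\<close>

context group
begin

definition centr :: "'a \<Rightarrow> 'a set" where
  "centr a = {g \<in> carrier G. g \<otimes> a = a \<otimes> g}"

lemma inv_cancel [simp]:
  "g \<in> carrier G \<Longrightarrow> y \<in> carrier G \<Longrightarrow> inv g \<otimes> (g \<otimes> y) = y"
  "g \<in> carrier G \<Longrightarrow> y \<in> carrier G \<Longrightarrow> g \<otimes> (inv g \<otimes> y) = y"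
  by (simp_all add: m_assoc[symmetric])

lemma conj_eq_iff:
  assumes "g \<in> carrier G" "a \<in> carrier G" "b \<in> carrier G"
  shows "g \<otimes> a \<otimes> inv g = b \<longleftrightarrow> g \<otimes> a = b \<otimes> g"
  using assms by (metis inv_solve_right m_closed)

lemma conj_centr_iff:
  assumes "g \<in> carrier G" "a \<in> carrier G" "b \<in> carrier G"
  shows "g \<otimes> b \<otimes> inv g \<in> centr (g \<otimes> a \<otimes> inv g) \<longleftrightarrow> b \<in> centr a"
proof -
  have "(g \<otimes> b \<otimes> inv g) \<otimes> (g \<otimes> a \<otimes> inv g) = g \<otimes> (b \<otimes> a) \<otimes> inv g"
       "(g \<otimes> a \<otimes> inv g) \<otimes> (g \<otimes> b \<otimes> inv g) = g \<otimes> (a \<otimes> b) \<otimes> inv g"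
    using assms by (simp_all add: m_assoc)
  then show ?thesis using assms by (simp add: centr_def)
qed

lemma centr_subgroup: "a \<in> carrier G \<Longrightarrow> subgroup (centr a) G"
proof (rule subgroupI)
  fix g assume a: "a \<in> carrier G" and g: "g \<in> centr a"
  then have gc: "g \<in> carrier G" "g \<otimes> a = a \<otimes> g" by (auto simp: centr_def)
  then have "inv g \<otimes> (g \<otimes> a) \<otimes> inv g = inv g \<otimes> (a \<otimes> g) \<otimes> inv g" by simp
  then show "inv g \<in> centr a" using a gc(1) by (simp add: centr_def m_assoc)
next
  fix g h assume "a \<in> carrier G" "g \<in> centr a" "h \<in> centr a"
  then show "g \<otimes> h \<in> centr a" unfolding centr_def by (simp add: m_assoc) (metis m_assoc)
qed (auto simp: centr_def)

end

text \<open>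
  This is the structure of a finite group of matrices of determinant one that has only semisimple
  elements: \<open>Z\<close> consists of the two scalars, a nonscalar \<open>a\<close> lies in a unique maximal torus, which is
  abelian and is the centralizer of \<open>a\<close>, and the normalizer of the torus acts on it by the identity
  and by inversion, since only \<open>a\<close> and its inverse have the eigenvalues of \<open>a\<close>.
\<close>
locale centralizer_partition = group G for G (structure) +
  fixes Z :: "'a set"
  assumes fin: "finite (carrier G)"
    and Z_sub: "subgroup Z G" and Z_card: "card Z = 2"
    and Z_central: "\<And>z g. z \<in> Z \<Longrightarrow> g \<in> carrier G \<Longrightarrow> z \<otimes> g = g \<otimes> z"
    and centr_comm: "\<And>a b c. a \<in> carrier G - Z \<Longrightarrow> b \<in> centr a \<Longrightarrow> c \<in> centr a \<Longrightarrow> b \<otimes> c = c \<otimes> b"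
    and conj_cases: "\<And>a g. a \<in> carrier G - Z \<Longrightarrow> g \<in> carrier G \<Longrightarrow> g \<otimes> a \<otimes> inv g \<in> centr a \<Longrightarrow>
       g \<otimes> a \<otimes> inv g = a \<or> g \<otimes> a \<otimes> inv g = inv a"
begin

text \<open>
  By \<open>conj_mem_centr_iff\<close> below, this is the normalizer of the centralizer of \<open>a\<close>.
\<close>
definition nrm :: "'a \<Rightarrow> 'a set" where
  "nrm a = {n \<in> carrier G. n \<otimes> a \<otimes> inv n \<in> centr a}"

text \<open>The noncentral elements fall into these sets, which are pairwise equal or disjoint.\<close>
definition cls :: "'a \<Rightarrow> 'a set" where
  "cls a = (\<lambda>(g, b). g \<otimes> b \<otimes> inv g) ` (carrier G \<times> (centr a - Z))"

lemma Z_carrier: "z \<in> Z \<Longrightarrow> z \<in> carrier G"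
  using subgroup.subset[OF Z_sub] by blast

lemma centr_carrier: "b \<in> centr a \<Longrightarrow> b \<in> carrier G"
  by (simp add: centr_def)

lemma centr_self: "a \<in> carrier G \<Longrightarrow> a \<in> centr a"
  by (simp add: centr_def)

lemma centr_sym: "a \<in> carrier G \<Longrightarrow> b \<in> centr a \<Longrightarrow> a \<in> centr b"
  by (simp add: centr_def)

text \<open>
  Commuting is transitive on noncentral elements, so each centralizer is determined by any of its
  noncentral elements.
\<close>
lemma centr_eq:
  assumes a: "a \<in> carrier G - Z" and b: "b \<in> centr a - Z"
  shows "centr b = centr a"
proof (intro equalityI subsetI)
  fix c assume c: "c \<in> centr b"
  show "c \<in> centr a"
  proof -
    have "b \<in> carrier G - Z" "a \<in> centr b" using a b centr_carrier[of b a] centr_sym[of a b] by blast+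
    from centr_comm[OF this c] have "c \<otimes> a = a \<otimes> c" by (rule sym)
    then show ?thesis using centr_carrier[OF c] by (simp only: centr_def mem_Collect_eq simp_thms)
  qed
next
  fix c assume c: "c \<in> centr a"
  show "c \<in> centr b"
  proof -
    have "b \<in> centr a" using b by blast
    from centr_comm[OF a this c] have "c \<otimes> b = b \<otimes> c" by (rule sym)
    then show ?thesis using centr_carrier[OF c] by (simp only: centr_def mem_Collect_eq simp_thms)
  qed
qed

lemma conj_notin_Z:
  assumes "g \<in> carrier G" "a \<in> carrier G - Z"
  shows "g \<otimes> a \<otimes> inv g \<in> carrier G - Z"
proof -
  have "a = z" if "g \<otimes> a \<otimes> inv g = z" "z \<in> Z" for z
  proof -
    have "g \<otimes> a = z \<otimes> g" using that(1) assms Z_carrier[OF that(2)] conj_eq_iff[of g a z] by blast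
    then have "g \<otimes> a = g \<otimes> z" using Z_central[OF that(2) assms(1)] by (rule trans)
    then show ?thesis using assms Z_carrier[OF that(2)] l_cancel by blast
  qed
  with assms show ?thesis by auto
qed

text \<open>
  Conjugating one noncentral element of a centralizer into it already conjugates the whole centralizer
  into itself, because each noncentral element determines the centralizer.
\<close>
lemma conj_mem_centr_iff:
  assumes a: "a \<in> carrier G - Z" and b: "b \<in> centr a - Z" and n: "n \<in> carrier G"
  shows "n \<otimes> b \<otimes> inv n \<in> centr a \<longleftrightarrow> n \<in> nrm a"
proof
  assume h: "n \<otimes> b \<otimes> inv n \<in> centr a"
  have bc: "b \<in> carrier G - Z" using b centr_carrier by auto
  have "centr (n \<otimes> b \<otimes> inv n) = centr a"
    using centr_eq[OF a] h conj_notin_Z[OF n bc] by auto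
  moreover have "n \<otimes> a \<otimes> inv n \<in> centr (n \<otimes> b \<otimes> inv n)"
    using conj_centr_iff[of n b a] n a b bc centr_sym[of a b] by blast
  ultimately show "n \<in> nrm a" using n by (simp add: nrm_def)
next
  assume "n \<in> nrm a"
  then have h: "n \<otimes> a \<otimes> inv n \<in> centr a" by (simp add: nrm_def)
  have "centr (n \<otimes> a \<otimes> inv n) = centr a"
    using centr_eq[OF a] h conj_notin_Z[OF n a] by auto
  moreover have "n \<otimes> b \<otimes> inv n \<in> centr (n \<otimes> a \<otimes> inv n)"
    using conj_centr_iff[of n a b] n a b centr_carrier by blast
  ultimately show "n \<otimes> b \<otimes> inv n \<in> centr a" by simp
qed

text \<open>
  Distinct conjugates of a centralizer meet only in \<open>Z\<close>, and the number of conjugates is the index of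
  the normalizer.  The proof counts the fibres of \<open>(g, b) \<mapsto> g b g\<^sup>-\<^sup>1\<close>, all of which
  are in bijection with the normalizer; this avoids forming quotients.
\<close>
lemma card_cls:
  assumes a: "a \<in> carrier G - Z"
  shows "card (cls a) * card (nrm a) = card (carrier G) * (card (centr a) - 2)"
proof -
  let ?D = "carrier G \<times> (centr a - Z)" and ?f = "\<lambda>(g, b). g \<otimes> b \<otimes> inv g"
  have finC: "finite (centr a)" using fin finite_subset[of "centr a" "carrier G"] by (auto simp: centr_def)
  have fibre: "card {q \<in> ?D. ?f q = e} = card (nrm a)" if eD: "e \<in> ?f ` ?D" for e
  proof -
    obtain g0 b0 where g0: "g0 \<in> carrier G" and b0: "b0 \<in> centr a - Z" and e: "e = g0 \<otimes> b0 \<otimes> inv g0"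
      using eD by auto
    have b0c: "b0 \<in> carrier G" using b0 centr_carrier by blast
    have "bij_betw (\<lambda>n. (g0 \<otimes> inv n, n \<otimes> b0 \<otimes> inv n)) (nrm a) {q \<in> ?D. ?f q = e}"
    proof (rule bij_betw_byWitness[where f' = "\<lambda>(g, b). inv g \<otimes> g0"])
      show "\<forall>n\<in>nrm a. (\<lambda>(g, b). inv g \<otimes> g0) (g0 \<otimes> inv n, n \<otimes> b0 \<otimes> inv n) = n"
        using g0 by (auto simp: nrm_def inv_mult_group m_assoc)
      show "\<forall>q\<in>{q \<in> ?D. ?f q = e}.
          (\<lambda>n. (g0 \<otimes> inv n, n \<otimes> b0 \<otimes> inv n)) ((\<lambda>(g, b). inv g \<otimes> g0) q) = q"
      proof (rule ballI)
        fix q assume "q \<in> {q \<in> ?D. ?f q = e}"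
        then obtain g b where q: "q = (g, b)" "g \<in> carrier G" "b \<in> centr a" "g \<otimes> b \<otimes> inv g = e"
          by auto
        moreover have bc: "b \<in> carrier G" using calculation(3) centr_carrier by blast
        ultimately have "inv g \<otimes> e \<otimes> g = b"
          using g0 by (auto simp: m_assoc)
        then have "inv g \<otimes> g0 \<otimes> b0 \<otimes> inv (inv g \<otimes> g0) = b"
          using e g0 b0c \<open>g \<in> carrier G\<close> by (simp add: inv_mult_group m_assoc)
        moreover have "g0 \<otimes> inv (inv g \<otimes> g0) = g"
          using g0 \<open>g \<in> carrier G\<close> by (simp add: inv_mult_group m_assoc)
        ultimately show "(\<lambda>n. (g0 \<otimes> inv n, n \<otimes> b0 \<otimes> inv n)) ((\<lambda>(g, b). inv g \<otimes> g0) q) = q"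
          using q(1) by simp
      qed
      show "(\<lambda>n. (g0 \<otimes> inv n, n \<otimes> b0 \<otimes> inv n)) ` nrm a \<subseteq> {q \<in> ?D. ?f q = e}"
      proof (rule image_subsetI)
        fix n assume n: "n \<in> nrm a"
        then have nc: "n \<in> carrier G" by (simp add: nrm_def)
        have "n \<otimes> b0 \<otimes> inv n \<in> centr a - Z"
          using conj_mem_centr_iff[OF a b0 nc] n conj_notin_Z[OF nc, of b0] b0 b0c by auto
        then show "(g0 \<otimes> inv n, n \<otimes> b0 \<otimes> inv n) \<in> {q \<in> ?D. ?f q = e}"
          using nc g0 b0c e by (simp add: inv_mult_group m_assoc)
      qed
      show "(\<lambda>(g, b). inv g \<otimes> g0) ` {q \<in> ?D. ?f q = e} \<subseteq> nrm a"
      proof (rule image_subsetI)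
        fix q assume "q \<in> {q \<in> ?D. ?f q = e}"
        then obtain g b where q: "q = (g, b)" and g: "g \<in> carrier G" and b: "b \<in> centr a"
          and eq: "g \<otimes> b \<otimes> inv g = e"
          by auto
        have bc: "b \<in> carrier G" using b centr_carrier by blast
        have "inv g \<otimes> e \<otimes> g = b"
          using g bc by (auto simp: m_assoc eq[symmetric])
        then have "inv g \<otimes> g0 \<otimes> b0 \<otimes> inv (inv g \<otimes> g0) = b"
          using e g0 b0c g by (simp add: inv_mult_group m_assoc)
        then show "(\<lambda>(g, b). inv g \<otimes> g0) q \<in> nrm a"
          using conj_mem_centr_iff[OF a b0, of "inv g \<otimes> g0"] g g0 b q by simp
      qed
    qed
    then show ?thesis by (rule bij_betw_same_card[symmetric])
  qed
  have finD: "finite ?D" using fin finC by auto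
  have "card ?D = (\<Sum>e\<in>?f ` ?D. card {q \<in> ?D. ?f q = e})"
    using sum.image_gen[OF finD, of "\<lambda>_. 1::nat" ?f] by simp
  also have "\<dots> = card (cls a) * card (nrm a)"
    using fibre by (simp add: cls_def)
  finally have "card (cls a) * card (nrm a) = card (carrier G) * card (centr a - Z)"
    by (simp add: card_cartesian_product)
  moreover have "card (centr a - Z) = card (centr a) - 2"
  proof -
    have "Z \<subseteq> centr a" using Z_central Z_carrier a by (auto simp: centr_def)
    then show ?thesis using card_Diff_subset[OF finite_subset[OF _ finC], of Z] Z_card by simp
  qed
  ultimately show ?thesis by simp
qed

text \<open>
  The normalizer acts on \<open>a\<close> by the identity or by inversion; the first kind forms the centralizer
  and the second kind, if there is any, one coset of it.
\<close>
lemma card_nrm: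
  assumes a: "a \<in> carrier G - Z"
  shows "card (nrm a) = card (centr a) \<or> card (nrm a) = 2 * card (centr a)"
proof (cases "nrm a = centr a")
  case False
  have ac: "a \<in> carrier G" using a by simp
  have centr_conj: "n \<in> centr a \<longleftrightarrow> n \<in> carrier G \<and> n \<otimes> a \<otimes> inv n = a" for n
    using ac conj_eq_iff[of n a a] by (auto simp: centr_def)
  have sub: "centr a \<subseteq> nrm a"
    unfolding nrm_def using centr_self[OF ac] centr_conj by (intro subsetI CollectI) metis
  with False obtain n0 where n0: "n0 \<in> nrm a" "n0 \<notin> centr a" by blast
  have n0c: "n0 \<in> carrier G" using n0 by (simp add: nrm_def)
  have n0a: "n0 \<otimes> a \<otimes> inv n0 = inv a"
    using conj_cases[OF a n0c] n0 centr_conj[of n0] n0c unfolding nrm_def by blast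
  have "nrm a - centr a = (\<otimes>) n0 ` centr a"
  proof (intro equalityI subsetI)
    fix n assume n: "n \<in> nrm a - centr a"
    then have nc: "n \<in> carrier G" by (simp add: nrm_def)
    have "n \<otimes> a \<otimes> inv n = inv a"
      using conj_cases[OF a nc] n nc centr_conj[of n] unfolding nrm_def by blast
    then have "inv n0 \<otimes> (n \<otimes> a \<otimes> inv n) \<otimes> n0 = inv n0 \<otimes> (n0 \<otimes> a \<otimes> inv n0) \<otimes> n0" using n0a by simp
    then have "(inv n0 \<otimes> n) \<otimes> a \<otimes> inv (inv n0 \<otimes> n) = a"
      using n0c nc ac by (simp add: m_assoc inv_mult_group)
    then have "inv n0 \<otimes> n \<in> centr a" using centr_conj[of "inv n0 \<otimes> n"] n0c nc by blast
    then show "n \<in> (\<otimes>) n0 ` centr a" using n0c nc by (intro image_eqI[of _ _ "inv n0 \<otimes> n"]) simp_all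
  next
    fix n assume "n \<in> (\<otimes>) n0 ` centr a"
    then obtain c where c: "c \<in> centr a" "n = n0 \<otimes> c" by blast
    have cc: "c \<in> carrier G" "c \<otimes> a \<otimes> inv c = a" using c centr_conj[of c] by blast+
    have "n \<otimes> a \<otimes> inv n = n0 \<otimes> (c \<otimes> a \<otimes> inv c) \<otimes> inv n0"
      using c n0c cc(1) ac by (simp add: m_assoc inv_mult_group)
    then have e: "n \<otimes> a \<otimes> inv n = inv a" unfolding cc(2) n0a .
    have "inv a \<noteq> a" using n0a n0(2) centr_conj[of n0] n0c by metis
    then have "n \<notin> centr a" using centr_conj[of n] e by metis
    moreover have "n \<in> nrm a"
      using e c n0c cc ac subgroup.m_inv_closed[OF centr_subgroup[OF ac] centr_self[OF ac]]
      by (simp add: nrm_def)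
    ultimately show "n \<in> nrm a - centr a" by simp
  qed
  moreover have "inj_on ((\<otimes>) n0) (centr a)"
    using n0c by (auto simp: inj_on_def centr_def)
  ultimately have "card (nrm a - centr a) = card (centr a)" by (simp add: card_image)
  moreover have "finite (nrm a)" using fin finite_subset[of "nrm a" "carrier G"] by (auto simp: nrm_def)
  ultimately have "card (nrm a) = 2 * card (centr a)"
    using sub card_Diff_subset[OF finite_subset[OF sub]] card_mono[OF _ sub] by simp
  then show ?thesis by simp
qed simp

lemma card_centr:
  assumes a: "a \<in> carrier G - Z"
  shows "even (card (centr a))" "4 \<le> card (centr a)"
proof -
  have ac: "a \<in> carrier G" using a by simp
  have Zsub: "Z \<subseteq> centr a" using Z_central Z_carrier a by (auto simp: centr_def)
  let ?C = "G\<lparr>carrier := centr a\<rparr>"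
  have grp: "group ?C" using subgroup_imp_group[OF centr_subgroup[OF ac]] .
  have "subgroup Z ?C" using Zsub Z_sub subgroup_incl[OF Z_sub centr_subgroup[OF ac]] by simp
  then have "card Z dvd Coset.order ?C" using group.lagrange[OF grp] by (metis dvd_triv_right)
  then show ev: "even (card (centr a))" by (simp add: Z_card Coset.order_def)
  have finC: "finite (centr a)" using fin finite_subset[of "centr a" "carrier G"] by (auto simp: centr_def)
  have "card Z < card (centr a)"
    using Zsub a centr_self[OF ac] by (intro psubset_card_mono[OF finC]) auto
  then show "4 \<le> card (centr a)" using ev Z_card by presburger
qed

lemma cls_subset: "a \<in> carrier G - Z \<Longrightarrow> cls a \<subseteq> carrier G - Z"
  using conj_notin_Z centr_carrier unfolding cls_def by fastforce

lemma cls_disjoint: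
  assumes a: "a \<in> carrier G - Z" and e: "e \<in> carrier G - Z" "e \<notin> cls a"
  shows "cls a \<inter> cls e = {}"
proof (rule ccontr)
  assume "cls a \<inter> cls e \<noteq> {}"
  then obtain g b h c where g: "g \<in> carrier G" and b: "b \<in> centr a - Z"
    and h: "h \<in> carrier G" and c: "c \<in> centr e - Z" and eq: "g \<otimes> b \<otimes> inv g = h \<otimes> c \<otimes> inv h"
    unfolding cls_def by auto
  define k where "k = inv h \<otimes> g"
  have kc: "k \<in> carrier G" using g h by (simp add: k_def)
  have bc: "b \<in> carrier G" and cc: "c \<in> carrier G" using b c centr_carrier by auto
  have "inv h \<otimes> (g \<otimes> b \<otimes> inv g) \<otimes> h = c" using eq h cc by (simp add: m_assoc)
  then have kb: "k \<otimes> b \<otimes> inv k = c" using g h bc by (simp add: k_def m_assoc inv_mult_group)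
  have ec: "e \<in> carrier G" using e by simp
  have "e = k \<otimes> (inv k \<otimes> e \<otimes> k) \<otimes> inv k" using kc ec by (simp add: m_assoc)
  moreover have "e \<in> centr c" using centr_sym[of e c] c ec by auto
  ultimately have "inv k \<otimes> e \<otimes> k \<in> centr b"
    using conj_centr_iff[of k b "inv k \<otimes> e \<otimes> k"] kb kc ec bc by simp
  then have 1: "inv k \<otimes> e \<otimes> k \<in> centr a" using centr_eq[OF a b] by simp
  have "inv k \<otimes> e \<otimes> k \<notin> Z" using conj_notin_Z[of "inv k" e] kc e by simp
  with 1 have "e \<in> cls a" unfolding cls_def
    using kc ec by (intro image_eqI[of _ _ "(k, inv k \<otimes> e \<otimes> k)"]) (auto simp: m_assoc)
  with e show False by simp
qed

text \<open>
  With \<open>c\<close> the order of the centralizer and \<open>n\<close> that of the group, the class has \<open>n - 2n/c\<close> or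
  \<open>n/2 - n/c\<close> elements, depending on whether the centralizer has index one or two in its normalizer;
  and \<open>c\<close> is even and at least four.
\<close>
lemma card_cls_cases:
  assumes e: "e \<in> carrier G - Z"
  defines "n \<equiv> real (card (carrier G))" and "K \<equiv> real (card (cls e))"
  shows "K = n / 4 \<or> n / 3 \<le> K \<and> K < n / 2 \<or> K = n / 2 \<or> 2 * n / 3 \<le> K"
proof -
  define c where "c = real (card (centr e))"
  have n0: "n > 0" using fin e by (auto simp: n_def card_gt_0_iff)
  have c4: "card (centr e) = 4 \<or> card (centr e) \<ge> 6"
    using card_centr[OF e] by presburger
  then have c: "c = 4 \<or> c \<ge> 6" unfolding c_def by linarith
  have "real (card (cls e) * card (nrm e)) = real (card (carrier G) * (card (centr e) - 2))"
    using card_cls[OF e] by simp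
  then have eq: "K * real (card (nrm e)) = n * (c - 2)"
    using card_centr(2)[OF e] by (simp add: K_def n_def c_def of_nat_diff)
  consider "real (card (nrm e)) = c" | "real (card (nrm e)) = 2 * c"
    using card_nrm[OF e] by (auto simp: c_def)
  then show ?thesis
  proof cases
    case 1
    then have K: "K = n - 2 * n / c" using eq c by (auto simp: field_simps)
    have "2 * n / c \<le> n / 3" if "c \<ge> 6" using that n0 by (simp add: field_simps)
    then show ?thesis using c K n0 by fastforce
  next
    case 2
    then have K: "K = n / 2 - n / c" using eq c by (auto simp: field_simps)
    have "n / c \<le> n / 6" "n / c > 0" if "c \<ge> 6" using that n0 by (simp_all add: field_simps)
    then show ?thesis using c K n0 by fastforce
  qed
qed

text \<open>
  Distinct classes are disjoint, and together the classes have \<open>n - 2\<close> elements.  If the centralizer of \<open>x\<close> has order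
  \<open>c \<ge> 14\<close> and is not normal, then the class of \<open>x\<close> leaves a remainder of \<open>2n/c - 2\<close> or
  \<open>n/2 + n/c - 2\<close> elements.  Both are positive, and the inequalities \<open>n/c \<le> n/14\<close> and, in the second case, \<open>n/c > 2\<close>
  prevent the possible class sizes from adding up to the remainder.  A bound on
  the centralizer is necessary, as the binary polyhedral groups show.
\<close>
theorem large_centralizer_normal:
  assumes x: "x \<in> carrier G - Z" and big: "14 \<le> card (centr x)" and g: "g \<in> carrier G"
  shows "g \<otimes> x \<otimes> inv g \<in> centr x"
proof (rule ccontr)
  assume "g \<otimes> x \<otimes> inv g \<notin> centr x"
  then have "nrm x \<subset> carrier G" using g by (auto simp: nrm_def)
  then have lt: "card (nrm x) < card (carrier G)" using fin psubset_card_mono by blast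
  define n where "n = real (card (carrier G))"
  define K where "K = (\<lambda>a. real (card (cls a)))"
  define c where "c = real (card (centr x))"
  define s where "s = n / c"
  have c14: "c \<ge> 14" using big by (simp add: c_def)
  have n0: "n > 0" using lt by (simp add: n_def)
  have s: "s \<le> n / 14" using c14 n0 by (simp add: s_def field_simps)
  have "real (card (cls x) * card (nrm x)) = real (card (carrier G) * (card (centr x) - 2))"
    using card_cls[OF x] by simp
  then have eq: "K x * real (card (nrm x)) = n * (c - 2)"
    using big by (simp add: K_def n_def c_def of_nat_diff)
  have finc: "finite (cls a)" if "a \<in> carrier G - Z" for a
    using cls_subset[OF that] fin finite_subset by blast
  have size: "real (card A) + 2 \<le> n" "real (card A) + 2 = n \<longleftrightarrow> A = carrier G - Z" if "A \<subseteq> carrier G - Z" for A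
  proof -
    have "card (carrier G - Z) = card (carrier G) - 2"
      using card_Diff_subset[of Z "carrier G"] Z_card Z_carrier fin by (metis finite_subset subsetI)
    moreover have "2 \<le> card (carrier G)"
      using card_mono[OF fin, of Z] Z_card Z_carrier by auto
    moreover have "card A \<le> card (carrier G - Z)" "card A = card (carrier G - Z) \<longleftrightarrow> A = carrier G - Z"
      using that fin card_mono[of "carrier G - Z" A] card_subset_eq[of "carrier G - Z" A] by auto
    ultimately show "real (card A) + 2 \<le> n" "real (card A) + 2 = n \<longleftrightarrow> A = carrier G - Z"
      unfolding n_def by linarith+
  qed
  have b: "K e = n / 4 \<or> n / 3 \<le> K e \<and> K e < n / 2 \<or> K e = n / 2 \<or> 2 * n / 3 \<le> K e"
    if "e \<in> carrier G - Z" for e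
    using card_cls_cases[OF that] by (simp add: n_def K_def)
  have e0: "cls x \<subseteq> carrier G - Z" using cls_subset[OF x] .
  consider (1) "real (card (nrm x)) = c" | (2) "real (card (nrm x)) = 2 * c"
    using card_nrm[OF x] by (auto simp: c_def)
  then show False
  proof cases
    case 1
    \<comment> \<open>The normalizer is the centralizer: the remainder is smaller than the smallest class.\<close>
    have Kx: "K x = n - 2 * s" using eq c14 1 by (auto simp: field_simps s_def)
    have "c < n" using lt 1 by (simp add: n_def)
    then have "s > 1" using c14 by (simp add: s_def)
    then have "cls x \<noteq> carrier G - Z" using size(2)[OF e0] Kx by (auto simp: K_def)
    then obtain e where e: "e \<in> carrier G - Z" "e \<notin> cls x" using e0 by blast
    have "card (cls x \<union> cls e) = card (cls x) + card (cls e)"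
      using cls_disjoint[OF x e] finc x e by (simp add: card_Un_disjoint)
    then have "K x + K e + 2 \<le> n"
      using size(1)[of "cls x \<union> cls e"] e0 cls_subset[OF e(1)] by (simp add: K_def)
    then show False using b[OF e(1)] Kx s n0 by linarith
  next
    case 2
    \<comment> \<open>The remainder lies strictly between \<open>n/2\<close> and \<open>n/2 + n/14\<close>.  One further class
      cannot fill it, two have sizes that add up to exactly \<open>n/2\<close> or to at least
      \<open>n/4 + n/3\<close>, and three are too large.\<close>
    have Kx: "K x = n / 2 - s" using eq c14 2 by (auto simp: field_simps s_def)
    have "2 * c < n" using lt 2 by (simp add: n_def)
    then have s2: "s > 2" using c14 by (simp add: s_def field_simps)
    then have "cls x \<noteq> carrier G - Z" using size(2)[OF e0] Kx s by (auto simp: K_def)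
    then obtain e where e: "e \<in> carrier G - Z" "e \<notin> cls x" using e0 by blast
    have c1: "card (cls x \<union> cls e) = card (cls x) + card (cls e)"
      using cls_disjoint[OF x e] finc x e by (simp add: card_Un_disjoint)
    have e1: "cls x \<union> cls e \<subseteq> carrier G - Z" using e0 cls_subset[OF e(1)] by blast
    have s1: "K x + K e + 2 \<le> n" "K x + K e + 2 = n \<longleftrightarrow> cls x \<union> cls e = carrier G - Z"
      using size[OF e1] c1 by (simp_all add: K_def)
    then have "cls x \<union> cls e \<noteq> carrier G - Z" using b[OF e(1)] Kx s n0 s2 by linarith
    then obtain f where f: "f \<in> carrier G - Z" "f \<notin> cls x" "f \<notin> cls e" using e1 by blast
    have d: "(cls x \<union> cls e) \<inter> cls f = {}"
      using cls_disjoint[OF x f(1,2)] cls_disjoint[OF e(1) f(1,3)] by blast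
    have c2: "card (cls x \<union> cls e \<union> cls f) = card (cls x) + card (cls e) + card (cls f)"
      using d finc x e f c1 by (simp add: card_Un_disjoint)
    have e2: "cls x \<union> cls e \<union> cls f \<subseteq> carrier G - Z" using e1 cls_subset[OF f(1)] by blast
    have s3: "K x + K e + K f + 2 \<le> n" "K x + K e + K f + 2 = n \<longleftrightarrow> cls x \<union> cls e \<union> cls f = carrier G - Z"
      using size[OF e2] c2 by (simp_all add: K_def)
    then have "cls x \<union> cls e \<union> cls f \<noteq> carrier G - Z"
      using b[OF e(1)] b[OF f(1)] Kx s n0 s2 by linarith
    then obtain h where h: "h \<in> carrier G - Z" "h \<notin> cls x" "h \<notin> cls e" "h \<notin> cls f" using e2 by blast
    have d': "(cls x \<union> cls e \<union> cls f) \<inter> cls h = {}"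
      using cls_disjoint[OF x h(1,2)] cls_disjoint[OF e(1) h(1,3)] cls_disjoint[OF f(1) h(1,4)] by blast
    have "card (cls x \<union> cls e \<union> cls f \<union> cls h) = card (cls x) + card (cls e) + card (cls f) + card (cls h)"
      using d' finc x e f h c2 by (simp add: card_Un_disjoint)
    then have "K x + K e + K f + K h + 2 \<le> n"
      using size(1)[of "cls x \<union> cls e \<union> cls f \<union> cls h"] e2 cls_subset[OF h(1)] by (simp add: K_def)
    then show False using b[OF e(1)] b[OF f(1)] b[OF h(1)] Kx s n0 s2 by linarith
  qed
qed

end

section \<open>Subgroups of small index\<close>

text \<open>
  An upper bound for the index that does not presuppose \<open>B \<subseteq> \<Gamma>\<close>.  This makes it
  monotone in \<open>B\<close> and compatible with images and preimages.
\<close>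
definition few_cosets :: "('a, 'b) monoid_scheme \<Rightarrow> 'a set \<Rightarrow> 'a set \<Rightarrow> nat \<Rightarrow> bool" where
  "few_cosets G \<Gamma> B n \<longleftrightarrow> (\<exists>F. finite F \<and> card F < n \<and> F \<subseteq> carrier G \<and>
     (\<forall>z\<in>\<Gamma>. \<exists>f\<in>F. z \<otimes>\<^bsub>G\<^esub> inv\<^bsub>G\<^esub> f \<in> B))"

context group
begin

lemma subgroup_pow_closed:
  assumes "subgroup B G" "z \<in> B" shows "z [^] (n::nat) \<in> B"
  by (induction n) (use assms in \<open>auto intro: subgroup.one_closed subgroup.m_closed\<close>)

text \<open>
  Among the \<open>n\<close> powers \<open>1, z, \<dots>, z\<^sup>n\<^sup>-\<^sup>1\<close> two lie in the same coset of \<open>B\<close>.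
\<close>
lemma few_cosets_power:
  assumes fc: "few_cosets G \<Gamma> B n" and \<Gamma>: "subgroup \<Gamma> G" and B: "subgroup B G" and z: "z \<in> \<Gamma>"
  obtains j where "0 < j" "j < n" "z [^] (j::nat) \<in> B"
proof -
  obtain F where F: "finite F" "card F < n" "F \<subseteq> carrier G"
      "\<And>z. z \<in> \<Gamma> \<Longrightarrow> \<exists>f\<in>F. z \<otimes> inv f \<in> B"
    using fc by (auto simp: few_cosets_def)
  have zc: "z \<in> carrier G" using \<Gamma> z subgroup.mem_carrier by metis
  have "\<forall>i::nat. \<exists>f. f \<in> F \<and> z [^] i \<otimes> inv f \<in> B"
    using F(4) subgroup_pow_closed[OF \<Gamma> z] by blast
  then obtain c where c: "\<And>i::nat. c i \<in> F" "\<And>i. z [^] i \<otimes> inv (c i) \<in> B" by metis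
  have "\<not> inj_on c {0..<n}"
    using F(1,2) c(1) card_inj_on_le[of c "{0..<n}" F] by auto
  then obtain i l where il: "i < l" "l < n" "c i = c l"
    unfolding inj_on_def by (metis atLeastLessThan_iff linorder_neqE_nat)
  have fc: "c l \<in> carrier G" using c(1) F(3) by blast
  have "(z [^] l \<otimes> inv (c l)) \<otimes> inv (z [^] i \<otimes> inv (c i)) \<in> B"
    using c(2) B subgroup.m_closed subgroup.m_inv_closed by metis
  moreover have "(z [^] l \<otimes> inv (c l)) \<otimes> inv (z [^] i \<otimes> inv (c i)) = z [^] l \<otimes> inv (z [^] i)"
    using zc fc il(3) by (simp add: inv_mult_group m_assoc)
  moreover have "z [^] l = z [^] (l - i) \<otimes> z [^] i"
    using il(1) zc by (simp add: nat_pow_mult)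
  ultimately have "z [^] (l - i) \<in> B"
    using zc by (simp add: m_assoc)
  then show thesis using that[of "l - i"] il by simp
qed

lemma coprime_powers_mem:
  assumes B: "subgroup B G" and z: "z \<in> carrier G" and i: "z [^] (i::nat) \<in> B" and j: "z [^] (j::nat) \<in> B"
    and cop: "coprime i j" and i0: "i \<noteq> 0"
  shows "z \<in> B"
proof -
  obtain a b where ab: "i * a = j * b + 1"
    using bezout_nat[OF i0, of j] cop by (auto simp: coprime_iff_gcd_eq_1)
  have "z [^] (i * a) \<in> B" "z [^] (j * b) \<in> B"
    using subgroup_pow_closed[OF B i, of a] subgroup_pow_closed[OF B j, of b] z by (simp_all add: nat_pow_pow)
  moreover have "z [^] (i * a) = z [^] (j * b) \<otimes> z" using ab z by simp
  ultimately have "inv (z [^] (j * b)) \<otimes> (z [^] (j * b) \<otimes> z) \<in> B"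
    using B subgroup.m_closed subgroup.m_inv_closed by metis
  then show ?thesis using z by simp
qed

text \<open>
  A bound on the index by a prime \<open>p\<close> forces every element that is \<open>p\<close>-torsion relative to \<open>B\<close> into
  \<open>B\<close>: the exponent \<open>j < p\<close> found by the pigeonhole principle is prime to \<open>p\<close>.
\<close>
lemma few_cosets_prime_power_mem:
  assumes "few_cosets G \<Gamma> B p" "subgroup \<Gamma> G" "subgroup B G" "z \<in> \<Gamma>" "Factorial_Ring.prime p" "z [^] p \<in> B"
  shows "z \<in> B"
proof -
  obtain j where j: "0 < j" "j < p" "z [^] j \<in> B" using few_cosets_power[OF assms(1-4)] .
  have "\<not> p dvd j" using j nat_dvd_not_less by blast
  then have "coprime p j" using assms(5) prime_imp_coprime[of p j] by blast
  then have "coprime j p" by (simp add: coprime_commute)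
  then show ?thesis
    using coprime_powers_mem[OF assms(3) _ j(3) assms(6)] j(1) subgroup.mem_carrier[OF assms(2,4)] by simp
qed

text \<open>
  The second derived subgroup is generated by commutators of elements of the abelian group \<open>K\<close>.
\<close>
lemma solvable_seq_metabelian:
  assumes H: "subgroup H G" and K: "subgroup K G"
    and comm: "\<And>g h. g \<in> H \<Longrightarrow> h \<in> H \<Longrightarrow> g \<otimes> h \<otimes> inv g \<otimes> inv h \<in> K"
    and ab: "\<And>g h. g \<in> K \<Longrightarrow> h \<in> K \<Longrightarrow> g \<otimes> h = h \<otimes> g"
  shows "solvable_seq G H"
proof -
  have HK: "derived G H \<subseteq> K"
    unfolding derived_def using comm by (intro generate_subgroup_incl[OF _ K]) blast
  have dc: "derived G H \<subseteq> carrier G" using HK subgroup.subset[OF K] by blast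
  have "derived G (derived G H) \<subseteq> {\<one>}"
    unfolding derived_def[of G "derived G H"]
  proof (intro generate_subgroup_incl[OF _ triv_subgroup] UN_least subsetI)
    fix g h x assume g: "g \<in> derived G H" and h: "h \<in> derived G H"
      and x: "x \<in> {g \<otimes> h \<otimes> inv g \<otimes> inv h}"
    have gh: "g \<in> carrier G" "h \<in> carrier G" "g \<otimes> h = h \<otimes> g" using g h dc HK ab by blast+
    then have "g \<otimes> h \<otimes> inv g \<otimes> inv h = h \<otimes> (g \<otimes> inv g) \<otimes> inv h" by (simp add: m_assoc)
    then show "x \<in> {\<one>}" using x gh by simp
  qed
  moreover have "\<one> \<in> derived G (derived G H)"
    using derived_is_subgroup[OF dc] subgroup.one_closed by blast
  ultimately have "((derived G) ^^ 2) H = {\<one>}" by (auto simp: numeral_2_eq_2)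
  then show ?thesis by (rule trivial_derived_seq_imp_solvable[OF H])
qed

end

section \<open>The algebra generated by a matrix and its orthogonal complement\<close>

context cring
begin

text \<open>
  The subalgebra generated by \<open>U\<close>: higher powers are absent because of the equation of
  Cayley and Hamilton.
\<close>
definition gen_alg :: "'a mat2 \<Rightarrow> 'a mat2 set" where
  "gen_alg U = {sc r \<oplus>\<^bsub>M\<^esub> sc s \<otimes>\<^bsub>M\<^esub> U | r s. r \<in> carrier R \<and> s \<in> carrier R}"

lemma gen_alg_subset: "U \<in> carrier M \<Longrightarrow> gen_alg U \<subseteq> carrier M"
  by (auto simp: gen_alg_def)

lemma gen_algI: "r \<in> carrier R \<Longrightarrow> s \<in> carrier R \<Longrightarrow> A = sc r \<oplus>\<^bsub>M\<^esub> sc s \<otimes>\<^bsub>M\<^esub> U \<Longrightarrow> A \<in> gen_alg U"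
  by (auto simp: gen_alg_def)

lemma gen_alg_sc: "U \<in> carrier M \<Longrightarrow> r \<in> carrier R \<Longrightarrow> sc r \<in> gen_alg U"
  by (rule gen_algI[of r \<zero>]) (simp_all add: sc_zero)

lemma gen_alg_self: "U \<in> carrier M \<Longrightarrow> U \<in> gen_alg U"
  by (rule gen_algI[of \<zero> \<one>]) (simp_all add: sc_zero sc_one)

lemma gen_alg_one: "U \<in> carrier M \<Longrightarrow> \<one>\<^bsub>M\<^esub> \<in> gen_alg U"
  using gen_alg_sc[of U \<one>] by (simp add: sc_one)

lemma gen_alg_zero: "U \<in> carrier M \<Longrightarrow> \<zero>\<^bsub>M\<^esub> \<in> gen_alg U"
  using gen_alg_sc[of U \<zero>] by (simp add: sc_zero)

lemma gen_alg_mult_eq: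
  assumes "U \<in> carrier M" "r \<in> carrier R" "s \<in> carrier R" "r' \<in> carrier R" "s' \<in> carrier R"
  shows "(sc r \<oplus>\<^bsub>M\<^esub> sc s \<otimes>\<^bsub>M\<^esub> U) \<otimes>\<^bsub>M\<^esub> (sc r' \<oplus>\<^bsub>M\<^esub> sc s' \<otimes>\<^bsub>M\<^esub> U) =
    sc (r \<otimes> r' \<ominus> s \<otimes> s' \<otimes> dt U) \<oplus>\<^bsub>M\<^esub> sc (r \<otimes> s' \<oplus> s \<otimes> r' \<oplus> s \<otimes> s' \<otimes> tr U) \<otimes>\<^bsub>M\<^esub> U"
  using assms by (clarsimp simp: mat2_sel mat_fun_sel mat_scal_def; intro conjI; algebra)

lemma gen_alg_mult: "U \<in> carrier M \<Longrightarrow> A \<in> gen_alg U \<Longrightarrow> B \<in> gen_alg U \<Longrightarrow> A \<otimes>\<^bsub>M\<^esub> B \<in> gen_alg U"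
  by (clarsimp simp: gen_alg_def[of U] gen_alg_mult_eq)
    (metis (no_types, lifting) mat_closed(1,2) add.m_closed m_closed minus_closed)

lemma gen_alg_commute:
  assumes U: "U \<in> carrier M" and A: "A \<in> gen_alg U" and B: "B \<in> gen_alg U"
  shows "A \<otimes>\<^bsub>M\<^esub> B = B \<otimes>\<^bsub>M\<^esub> A"
proof -
  obtain r s r' s' where *: "r \<in> carrier R" "s \<in> carrier R" "r' \<in> carrier R" "s' \<in> carrier R"
    "A = sc r \<oplus>\<^bsub>M\<^esub> sc s \<otimes>\<^bsub>M\<^esub> U" "B = sc r' \<oplus>\<^bsub>M\<^esub> sc s' \<otimes>\<^bsub>M\<^esub> U"
    using A B by (auto simp: gen_alg_def)
  have "r \<otimes> r' \<ominus> s \<otimes> s' \<otimes> dt U = r' \<otimes> r \<ominus> s' \<otimes> s \<otimes> dt U"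
    "r \<otimes> s' \<oplus> s \<otimes> r' \<oplus> s \<otimes> s' \<otimes> tr U = r' \<otimes> s \<oplus> s' \<otimes> r \<oplus> s' \<otimes> s \<otimes> tr U"
    using * U by (simp_all add: m_comm a_comm)
  then show ?thesis using * U by (simp add: gen_alg_mult_eq)
qed

lemma gen_alg_add:
  assumes U: "U \<in> carrier M" and A: "A \<in> gen_alg U" and B: "B \<in> gen_alg U"
  shows "A \<oplus>\<^bsub>M\<^esub> B \<in> gen_alg U"
proof -
  obtain r s r' s' where *: "r \<in> carrier R" "s \<in> carrier R" "r' \<in> carrier R" "s' \<in> carrier R"
    "A = sc r \<oplus>\<^bsub>M\<^esub> sc s \<otimes>\<^bsub>M\<^esub> U" "B = sc r' \<oplus>\<^bsub>M\<^esub> sc s' \<otimes>\<^bsub>M\<^esub> U"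
    using A B by (auto simp: gen_alg_def)
  show ?thesis
    using * U by (intro gen_algI[of "r \<oplus> r'" "s \<oplus> s'"]) (simp_all add: sc_add M.l_distr M.a_ac)
qed

lemma gen_alg_uminus:
  assumes U: "U \<in> carrier M" and A: "A \<in> gen_alg U"
  shows "\<ominus>\<^bsub>M\<^esub> A \<in> gen_alg U"
proof -
  obtain r s where *: "r \<in> carrier R" "s \<in> carrier R" "A = sc r \<oplus>\<^bsub>M\<^esub> sc s \<otimes>\<^bsub>M\<^esub> U"
    using A by (auto simp: gen_alg_def)
  show ?thesis
    using * U by (intro gen_algI[of "\<ominus> r" "\<ominus> s"]) (simp_all add: sc_uminus M.minus_add M.l_minus)
qed

lemma gen_alg_adj:
  assumes U: "U \<in> carrier M" and A: "A \<in> gen_alg U"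
  shows "adj A \<in> gen_alg U"
proof -
  obtain r s where *: "r \<in> carrier R" "s \<in> carrier R" "A = sc r \<oplus>\<^bsub>M\<^esub> sc s \<otimes>\<^bsub>M\<^esub> U"
    using A by (auto simp: gen_alg_def)
  show ?thesis
    using * U by (intro gen_algI[of "r \<oplus> s \<otimes> tr U" "\<ominus> s"])
      (simp_all, (clarsimp simp: mat2_sel mat_fun_sel mat_scal_def; intro conjI; algebra))
qed

lemma gen_alg_pow:
  "U \<in> carrier M \<Longrightarrow> A \<in> gen_alg U \<Longrightarrow> A [^]\<^bsub>M\<^esub> (n::nat) \<in> gen_alg U"
  by (induction n) (simp_all add: gen_alg_one gen_alg_mult)

end

text \<open>
  The two trace conditions say that \<open>W\<close> is orthogonal to the algebra \<open>S\<close> generated by \<open>U\<close> with respect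
  to the trace form.  They imply that \<open>W\<close> anticommutes with \<open>S\<close> up to the adjugate and that its
  square is a scalar \<open>q\<close>, so that \<open>S + S W\<close> is the cyclic algebra with parameters \<open>S\<close> and \<open>q\<close>.
\<close>
locale cyclic_frame = cring +
  fixes U W :: "'a mat2"
  assumes U: "U \<in> carrier M" and W: "W \<in> carrier M"
    and trW: "tr W = \<zero>" and trUW: "tr (U \<otimes>\<^bsub>M\<^esub> W) = \<zero>"
begin

abbreviation S where "S \<equiv> gen_alg U"
definition q where "q = \<ominus> dt W"
definition elt :: "'a mat2 \<Rightarrow> 'a mat2 \<Rightarrow> 'a mat2" where
  "elt s t = s \<oplus>\<^bsub>M\<^esub> t \<otimes>\<^bsub>M\<^esub> W"

lemma q_closed [simp]: "q \<in> carrier R" using W by (simp add: q_def)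

lemma S_carrier [simp]: "s \<in> S \<Longrightarrow> s \<in> carrier M"
  using gen_alg_subset[OF U] by blast

lemmas S_closed [simp] = gen_alg_mult[OF U] gen_alg_add[OF U] gen_alg_uminus[OF U] gen_alg_adj[OF U]
  gen_alg_one[OF U] gen_alg_zero[OF U] gen_alg_sc[OF U] gen_alg_self[OF U] gen_alg_pow[OF U]

lemma elt_closed [simp]: "s \<in> S \<Longrightarrow> t \<in> S \<Longrightarrow> elt s t \<in> carrier M"
  by (simp add: elt_def W)

lemma adj_W: "adj W = \<ominus>\<^bsub>M\<^esub> W"
proof -
  have "adj W \<oplus>\<^bsub>M\<^esub> W = \<zero>\<^bsub>M\<^esub>" using add_adj[OF W] W by (simp add: trW sc_zero M.a_comm)
  then show ?thesis using W by (simp add: M.minus_equality)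
qed

lemma W_square: "W \<otimes>\<^bsub>M\<^esub> W = sc q"
proof -
  have "W \<otimes>\<^bsub>M\<^esub> adj W = sc (dt W)" using mult_adj[OF W] .
  then have "\<ominus>\<^bsub>M\<^esub> (W \<otimes>\<^bsub>M\<^esub> W) = sc (dt W)" using W by (simp add: adj_W M.r_minus)
  then have "W \<otimes>\<^bsub>M\<^esub> W = \<ominus>\<^bsub>M\<^esub> sc (dt W)" using W by (metis M.m_closed M.minus_minus)
  then show ?thesis using W by (simp add: q_def sc_uminus)
qed

text \<open>
  The matrix \<open>U W\<close> has trace zero, hence its adjugate \<open>W\<^sup>* U\<^sup>* = - W U\<^sup>*\<close> is \<open>- U W\<close>.
\<close>
lemma U_W: "U \<otimes>\<^bsub>M\<^esub> W = W \<otimes>\<^bsub>M\<^esub> adj U"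
proof -
  have "U \<otimes>\<^bsub>M\<^esub> W \<oplus>\<^bsub>M\<^esub> adj (U \<otimes>\<^bsub>M\<^esub> W) = \<zero>\<^bsub>M\<^esub>"
    using add_adj[of "U \<otimes>\<^bsub>M\<^esub> W"] U W by (simp add: trUW sc_zero)
  then have "U \<otimes>\<^bsub>M\<^esub> W \<oplus>\<^bsub>M\<^esub> \<ominus>\<^bsub>M\<^esub> (W \<otimes>\<^bsub>M\<^esub> adj U) = \<zero>\<^bsub>M\<^esub>"
    using U W by (simp add: adj_mult adj_W M.l_minus)
  then have "\<ominus>\<^bsub>M\<^esub> (\<ominus>\<^bsub>M\<^esub> (W \<otimes>\<^bsub>M\<^esub> adj U)) = U \<otimes>\<^bsub>M\<^esub> W"
    using U W by (intro M.minus_equality) simp_all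
  then show ?thesis using U W by simp
qed

lemma S_W: assumes "s \<in> S" shows "s \<otimes>\<^bsub>M\<^esub> W = W \<otimes>\<^bsub>M\<^esub> adj s"
proof -
  obtain r c where *: "r \<in> carrier R" "c \<in> carrier R" "s = sc r \<oplus>\<^bsub>M\<^esub> sc c \<otimes>\<^bsub>M\<^esub> U"
    using assms by (auto simp: gen_alg_def)
  have "sc c \<otimes>\<^bsub>M\<^esub> U \<otimes>\<^bsub>M\<^esub> W = sc c \<otimes>\<^bsub>M\<^esub> (W \<otimes>\<^bsub>M\<^esub> adj U)"
    using * U W by (simp add: M.m_assoc U_W)
  also have "\<dots> = W \<otimes>\<^bsub>M\<^esub> (sc c \<otimes>\<^bsub>M\<^esub> adj U)"
    using * U W by (simp add: M.m_assoc[symmetric] sc_commute[of c W])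
  also have "\<dots> = W \<otimes>\<^bsub>M\<^esub> adj (sc c \<otimes>\<^bsub>M\<^esub> U)"
    using * U by (simp add: adj_mult sc_commute)
  finally show ?thesis
    using * U W by (simp add: M.l_distr M.r_distr adj_add sc_commute)
qed

lemma W_S: assumes "s \<in> S" shows "W \<otimes>\<^bsub>M\<^esub> s = adj s \<otimes>\<^bsub>M\<^esub> W"
  using S_W[of "adj s"] assms by simp

lemma S_commute: "s \<in> S \<Longrightarrow> t \<in> S \<Longrightarrow> s \<otimes>\<^bsub>M\<^esub> t = t \<otimes>\<^bsub>M\<^esub> s"
  by (rule gen_alg_commute[OF U])

text \<open>
  Moving \<open>W\<close> across an element of \<open>S\<close> applies the involution \<open>adj\<close>, and \<open>W\<^sup>2 = q\<close>.
\<close>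
lemma elt_mult:
  assumes "s \<in> S" "t \<in> S" "s' \<in> S" "t' \<in> S"
  shows "elt s t \<otimes>\<^bsub>M\<^esub> elt s' t' =
    elt (s \<otimes>\<^bsub>M\<^esub> s' \<oplus>\<^bsub>M\<^esub> sc q \<otimes>\<^bsub>M\<^esub> (t \<otimes>\<^bsub>M\<^esub> adj t')) (s \<otimes>\<^bsub>M\<^esub> t' \<oplus>\<^bsub>M\<^esub> t \<otimes>\<^bsub>M\<^esub> adj s')"
proof -
  have 1: "t \<otimes>\<^bsub>M\<^esub> W \<otimes>\<^bsub>M\<^esub> s' = t \<otimes>\<^bsub>M\<^esub> adj s' \<otimes>\<^bsub>M\<^esub> W"
    using assms W by (simp add: M.m_assoc W_S)
  have "t \<otimes>\<^bsub>M\<^esub> W \<otimes>\<^bsub>M\<^esub> (t' \<otimes>\<^bsub>M\<^esub> W) = t \<otimes>\<^bsub>M\<^esub> (W \<otimes>\<^bsub>M\<^esub> t') \<otimes>\<^bsub>M\<^esub> W"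
    using assms W by (simp add: M.m_assoc)
  also have "\<dots> = t \<otimes>\<^bsub>M\<^esub> adj t' \<otimes>\<^bsub>M\<^esub> (W \<otimes>\<^bsub>M\<^esub> W)"
    using assms W by (simp add: M.m_assoc W_S)
  also have "\<dots> = sc q \<otimes>\<^bsub>M\<^esub> (t \<otimes>\<^bsub>M\<^esub> adj t')"
    using assms by (simp add: W_square sc_commute)
  finally have 2: "t \<otimes>\<^bsub>M\<^esub> W \<otimes>\<^bsub>M\<^esub> (t' \<otimes>\<^bsub>M\<^esub> W) = sc q \<otimes>\<^bsub>M\<^esub> (t \<otimes>\<^bsub>M\<^esub> adj t')" .
  show ?thesis
    using assms W
    by (simp add: elt_def M.l_distr M.r_distr 1 2 M.a_ac)
      (simp add: M.m_assoc)
qed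

lemma adj_elt: "s \<in> S \<Longrightarrow> t \<in> S \<Longrightarrow> adj (elt s t) = elt (adj s) (\<ominus>\<^bsub>M\<^esub> t)"
  using W S_W[of t] by (simp add: elt_def adj_add adj_mult adj_W M.l_minus M.r_minus)

lemma elt_zero: "s \<in> S \<Longrightarrow> elt s \<zero>\<^bsub>M\<^esub> = s"
  by (simp add: elt_def W)

lemma tr_S_W: assumes "s \<in> S" shows "tr (s \<otimes>\<^bsub>M\<^esub> W) = \<zero>"
proof -
  obtain r c where *: "r \<in> carrier R" "c \<in> carrier R" "s = sc r \<oplus>\<^bsub>M\<^esub> sc c \<otimes>\<^bsub>M\<^esub> U"
    using assms by (auto simp: gen_alg_def)
  then show ?thesis
    using U W by (simp add: M.l_distr tr_add tr_sc_mult trW M.m_assoc trUW)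
qed

lemma elt_adj_mult:
  assumes "s \<in> S" "t \<in> S"
  shows "sc (dt (elt s t)) = s \<otimes>\<^bsub>M\<^esub> adj s \<ominus>\<^bsub>M\<^esub> sc q \<otimes>\<^bsub>M\<^esub> (t \<otimes>\<^bsub>M\<^esub> adj t)"
proof -
  have "sc (dt (elt s t)) = elt s t \<otimes>\<^bsub>M\<^esub> elt (adj s) (\<ominus>\<^bsub>M\<^esub> t)"
    using mult_adj[of "elt s t"] assms by (simp add: adj_elt)
  also have "\<dots> = elt (s \<otimes>\<^bsub>M\<^esub> adj s \<ominus>\<^bsub>M\<^esub> sc q \<otimes>\<^bsub>M\<^esub> (t \<otimes>\<^bsub>M\<^esub> adj t)) \<zero>\<^bsub>M\<^esub>"
    using assms by (simp add: elt_mult adj_uminus M.r_minus M.minus_eq S_commute[of t s] M.l_neg)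
  finally show ?thesis using assms by (simp add: elt_zero M.minus_eq)
qed

end

section \<open>Existence and uniqueness of coordinates\<close>

context cring
begin

text \<open>
  For determinant one this is the discriminant of the characteristic polynomial, the square of the
  difference of the eigenvalues.
\<close>
definition disc :: "'a mat2 \<Rightarrow> 'a" where
  "disc A = tr A \<otimes> tr A \<ominus> (\<one> \<oplus> \<one> \<oplus> \<one> \<oplus> \<one>)"

lemma disc_closed [simp]: "A \<in> carrier M \<Longrightarrow> disc A \<in> carrier R"
  by (simp add: disc_def)

lemma tr_square:
  assumes "A \<in> carrier M" "dt A = \<one>"
  shows "tr (A \<otimes>\<^bsub>M\<^esub> A) = tr A \<otimes> tr A \<ominus> (\<one> \<oplus> \<one>)"
proof -
  have "tr (A \<otimes>\<^bsub>M\<^esub> A) = tr A \<otimes> tr A \<ominus> (dt A \<oplus> dt A)"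
    using assms(1) by (clarsimp simp: mat2_sel mat_fun_sel; algebra)
  then show ?thesis using assms by simp
qed

text \<open>
  The projection of \<open>V\<close> to the algebra generated by \<open>U\<close> is found by prescribing its traces against \<open>1\<close>
  and \<open>U\<close>.  This is a linear system in \<open>a0\<close> and \<open>a1\<close> of determinant \<^term>\<open>disc U\<close>, which
  Cramer's rule solves.  The explicit solution shows later that \<open>a0\<close> and \<open>a1\<close> reduce to zero as soon as
  certain traces satisfy two relations.
\<close>
lemma frame_exists:
  assumes U: "U \<in> carrier M" "dt U = \<one>" and V: "V \<in> carrier M"
    and e: "e \<in> carrier R" "disc U \<otimes> e = \<one>"
  obtains a0 a1 W where "a0 \<in> carrier R" "a1 \<in> carrier R" "cyclic_frame R U W"
    "V = (sc a0 \<oplus>\<^bsub>M\<^esub> sc a1 \<otimes>\<^bsub>M\<^esub> U) \<oplus>\<^bsub>M\<^esub> W"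
    "a0 = (tr V \<otimes> (tr U \<otimes> tr U \<ominus> (\<one> \<oplus> \<one>)) \<ominus> tr U \<otimes> tr (U \<otimes>\<^bsub>M\<^esub> V)) \<otimes> e"
    "a1 = (tr (U \<otimes>\<^bsub>M\<^esub> V) \<oplus> tr (U \<otimes>\<^bsub>M\<^esub> V) \<ominus> tr U \<otimes> tr V) \<otimes> e"
proof -
  define t u w where "t = tr U" and "u = tr V" and "w = tr (U \<otimes>\<^bsub>M\<^esub> V)"
  define a0 where "a0 = (u \<otimes> (t \<otimes> t \<ominus> (\<one> \<oplus> \<one>)) \<ominus> t \<otimes> w) \<otimes> e"
  define a1 where "a1 = (w \<oplus> w \<ominus> t \<otimes> u) \<otimes> e"
  define a where "a = sc a0 \<oplus>\<^bsub>M\<^esub> sc a1 \<otimes>\<^bsub>M\<^esub> U"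
  define W where "W = V \<ominus>\<^bsub>M\<^esub> a"
  have tuw: "t \<in> carrier R" "u \<in> carrier R" "w \<in> carrier R" using U V by (simp_all add: t_def u_def w_def)
  have ac: "a0 \<in> carrier R" "a1 \<in> carrier R" using tuw e by (simp_all add: a0_def a1_def)
  have aM: "a \<in> carrier M" using ac U by (simp add: a_def)
  have WM: "W \<in> carrier M" using aM V by (simp add: W_def)
  have d: "(t \<otimes> t \<ominus> (\<one> \<oplus> \<one> \<oplus> \<one> \<oplus> \<one>)) \<otimes> e = \<one>" using e by (simp add: disc_def t_def)
  have "a0 \<oplus> a0 \<oplus> a1 \<otimes> t = u \<otimes> ((t \<otimes> t \<ominus> (\<one> \<oplus> \<one> \<oplus> \<one> \<oplus> \<one>)) \<otimes> e)"
    unfolding a0_def a1_def using tuw e(1) by algebra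
  then have "a0 \<oplus> a0 \<oplus> a1 \<otimes> t = u" using tuw by (simp only: d r_one)
  then have tra: "tr a = u" using ac U tuw by (simp add: a_def tr_add tr_sc tr_sc_mult t_def)
  have num: "(u \<otimes> (t \<otimes> t \<ominus> (\<one> \<oplus> \<one>)) \<ominus> t \<otimes> w) \<otimes> t \<oplus> (w \<oplus> w \<ominus> t \<otimes> u) \<otimes> (t \<otimes> t \<ominus> (\<one> \<oplus> \<one>)) =
      w \<otimes> (t \<otimes> t \<ominus> (\<one> \<oplus> \<one> \<oplus> \<one> \<oplus> \<one>))"
    using tuw by algebra
  have "n \<in> carrier R \<Longrightarrow> n' \<in> carrier R \<Longrightarrow> z \<in> carrier R \<Longrightarrow>
      (n \<otimes> e) \<otimes> t \<oplus> (n' \<otimes> e) \<otimes> z = (n \<otimes> t \<oplus> n' \<otimes> z) \<otimes> e" for n n' z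
    using tuw e(1) by algebra
  then have "a0 \<otimes> t \<oplus> a1 \<otimes> (t \<otimes> t \<ominus> (\<one> \<oplus> \<one>)) = (w \<otimes> (t \<otimes> t \<ominus> (\<one> \<oplus> \<one> \<oplus> \<one> \<oplus> \<one>))) \<otimes> e"
    unfolding a0_def a1_def num[symmetric] using tuw by simp
  then have "a0 \<otimes> t \<oplus> a1 \<otimes> (t \<otimes> t \<ominus> (\<one> \<oplus> \<one>)) = w \<otimes> ((t \<otimes> t \<ominus> (\<one> \<oplus> \<one> \<oplus> \<one> \<oplus> \<one>)) \<otimes> e)"
    using tuw e(1) by (simp add: m_assoc)
  then have "a0 \<otimes> t \<oplus> a1 \<otimes> (t \<otimes> t \<ominus> (\<one> \<oplus> \<one>)) = w" using tuw by (simp only: d r_one)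
  moreover have "tr (U \<otimes>\<^bsub>M\<^esub> a) = a0 \<otimes> t \<oplus> a1 \<otimes> (t \<otimes> t \<ominus> (\<one> \<oplus> \<one>))"
  proof -
    have "U \<otimes>\<^bsub>M\<^esub> a = sc a0 \<otimes>\<^bsub>M\<^esub> U \<oplus>\<^bsub>M\<^esub> sc a1 \<otimes>\<^bsub>M\<^esub> (U \<otimes>\<^bsub>M\<^esub> U)"
      using ac U by (simp add: a_def M.r_distr sc_commute M.m_assoc[symmetric])
        (simp add: M.m_assoc sc_commute)
    then show ?thesis using ac U by (simp add: tr_add tr_sc_mult tr_square t_def)
  qed
  ultimately have tra': "tr (U \<otimes>\<^bsub>M\<^esub> a) = w" by simp
  have "cyclic_frame R U W"
  proof (unfold_locales)
    show "tr W = \<zero>" using aM V tra tuw by (simp add: W_def M.minus_eq tr_add tr_uminus u_def r_neg)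
    show "tr (U \<otimes>\<^bsub>M\<^esub> W) = \<zero>"
      using aM V U tra' tuw by (simp add: W_def M.minus_eq M.r_distr M.r_minus tr_add tr_uminus w_def r_neg)
  qed (use U WM in auto)
  moreover have "V = a \<oplus>\<^bsub>M\<^esub> W"
    using aM V unfolding W_def by algebra
  ultimately show thesis
    using that[of a0 a1 W] ac unfolding a0_def a1_def a_def t_def u_def w_def by blast
qed

end

context cyclic_frame
begin

lemma det_first: "a \<in> S \<Longrightarrow> dt (elt a \<one>\<^bsub>M\<^esub>) = \<one> \<Longrightarrow> a \<otimes>\<^bsub>M\<^esub> adj a = \<one>\<^bsub>M\<^esub> \<oplus>\<^bsub>M\<^esub> sc q"
proof -
  assume a: "a \<in> S" "dt (elt a \<one>\<^bsub>M\<^esub>) = \<one>"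
  then have "\<one>\<^bsub>M\<^esub> = a \<otimes>\<^bsub>M\<^esub> adj a \<ominus>\<^bsub>M\<^esub> sc q"
    using elt_adj_mult[of a "\<one>\<^bsub>M\<^esub>"] by (simp add: sc_one)
  then have "\<one>\<^bsub>M\<^esub> \<oplus>\<^bsub>M\<^esub> sc q = (a \<otimes>\<^bsub>M\<^esub> adj a \<ominus>\<^bsub>M\<^esub> sc q) \<oplus>\<^bsub>M\<^esub> sc q" by simp
  also have "\<dots> = a \<otimes>\<^bsub>M\<^esub> adj a"
  proof -
    have "A \<in> carrier M \<Longrightarrow> B \<in> carrier M \<Longrightarrow> (A \<ominus>\<^bsub>M\<^esub> B) \<oplus>\<^bsub>M\<^esub> B = A" for A B by algebra
    then show ?thesis using a by simp
  qed
  finally show ?thesis by simp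
qed

text \<open>
  With \<open>V = a + W\<close> the commutator is computed in coordinates, where conjugation by \<open>U\<close> fixes \<open>S\<close> and
  multiplies \<open>W\<close> by \<open>U\<^sup>2\<close>.
\<close>
lemma commutator_elt:
  assumes a: "a \<in> S" and U1: "dt U = \<one>"
  shows "U \<otimes>\<^bsub>M\<^esub> elt a \<one>\<^bsub>M\<^esub> \<otimes>\<^bsub>M\<^esub> adj U \<otimes>\<^bsub>M\<^esub> adj (elt a \<one>\<^bsub>M\<^esub>) =
    elt (a \<otimes>\<^bsub>M\<^esub> adj a \<ominus>\<^bsub>M\<^esub> sc q \<otimes>\<^bsub>M\<^esub> (U \<otimes>\<^bsub>M\<^esub> U)) ((U \<otimes>\<^bsub>M\<^esub> U \<ominus>\<^bsub>M\<^esub> \<one>\<^bsub>M\<^esub>) \<otimes>\<^bsub>M\<^esub> a)"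
proof -
  have UU: "U \<otimes>\<^bsub>M\<^esub> adj U = \<one>\<^bsub>M\<^esub>" using mult_adj[OF U] U1 by (simp add: sc_one)
  have "U \<otimes>\<^bsub>M\<^esub> elt a \<one>\<^bsub>M\<^esub> = elt (U \<otimes>\<^bsub>M\<^esub> a) U"
    using elt_mult[of U "\<zero>\<^bsub>M\<^esub>" a "\<one>\<^bsub>M\<^esub>"] a U by (simp add: elt_zero)
  moreover have "elt (U \<otimes>\<^bsub>M\<^esub> a) U \<otimes>\<^bsub>M\<^esub> adj U = elt a (U \<otimes>\<^bsub>M\<^esub> U)"
  proof -
    have "U \<otimes>\<^bsub>M\<^esub> a \<otimes>\<^bsub>M\<^esub> adj U = a"
      using S_commute[of U a] a U UU by (simp add: M.m_assoc)
    then show ?thesis using elt_mult[of "U \<otimes>\<^bsub>M\<^esub> a" U "adj U" "\<zero>\<^bsub>M\<^esub>"] a U by (simp add: elt_zero)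
  qed
  moreover have "elt a (U \<otimes>\<^bsub>M\<^esub> U) \<otimes>\<^bsub>M\<^esub> adj (elt a \<one>\<^bsub>M\<^esub>) =
     elt (a \<otimes>\<^bsub>M\<^esub> adj a \<ominus>\<^bsub>M\<^esub> sc q \<otimes>\<^bsub>M\<^esub> (U \<otimes>\<^bsub>M\<^esub> U)) ((U \<otimes>\<^bsub>M\<^esub> U \<ominus>\<^bsub>M\<^esub> \<one>\<^bsub>M\<^esub>) \<otimes>\<^bsub>M\<^esub> a)"
  proof -
    have "a \<otimes>\<^bsub>M\<^esub> \<ominus>\<^bsub>M\<^esub> \<one>\<^bsub>M\<^esub> \<oplus>\<^bsub>M\<^esub> U \<otimes>\<^bsub>M\<^esub> U \<otimes>\<^bsub>M\<^esub> a = (U \<otimes>\<^bsub>M\<^esub> U \<ominus>\<^bsub>M\<^esub> \<one>\<^bsub>M\<^esub>) \<otimes>\<^bsub>M\<^esub> a"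
      using a U by (simp add: M.minus_eq M.l_distr M.l_minus M.r_minus M.a_comm)
    then show ?thesis
      using a U elt_mult[of a "U \<otimes>\<^bsub>M\<^esub> U" "adj a" "\<ominus>\<^bsub>M\<^esub> \<one>\<^bsub>M\<^esub>"]
      by (simp add: adj_elt adj_uminus M.r_minus M.minus_eq)
  qed
  ultimately show ?thesis by simp
qed

text \<open>
  So \<open>q\<close> measures how far the pair is from having a common eigenvector, which is detected by
  the trace of the commutator being \<open>2\<close>.
\<close>
lemma tr_commutator:
  assumes a: "a \<in> S" and U1: "dt U = \<one>" and V1: "dt (elt a \<one>\<^bsub>M\<^esub>) = \<one>"
  shows "tr (U \<otimes>\<^bsub>M\<^esub> elt a \<one>\<^bsub>M\<^esub> \<otimes>\<^bsub>M\<^esub> adj U \<otimes>\<^bsub>M\<^esub> adj (elt a \<one>\<^bsub>M\<^esub>)) = \<one> \<oplus> \<one> \<ominus> q \<otimes> disc U"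
proof -
  have "tr (U \<otimes>\<^bsub>M\<^esub> elt a \<one>\<^bsub>M\<^esub> \<otimes>\<^bsub>M\<^esub> adj U \<otimes>\<^bsub>M\<^esub> adj (elt a \<one>\<^bsub>M\<^esub>)) =
      \<one> \<oplus> \<one> \<oplus> (q \<oplus> q) \<ominus> q \<otimes> (tr U \<otimes> tr U \<ominus> (\<one> \<oplus> \<one>))"
    using a U W U1 V1
    by (simp add: commutator_elt det_first)
      (simp add: elt_def M.minus_eq tr_add tr_S_W tr_uminus tr_sc_mult tr_square tr_sc minus_eq sc_one[symmetric])
  also have "\<dots> = \<one> \<oplus> \<one> \<ominus> q \<otimes> disc U"
    unfolding disc_def using U q_closed mat_closed(1)[OF U] by algebra
  finally show ?thesis .
qed

end

lemma (in domain) mat_sc_mult_zero: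
  assumes "r \<in> carrier R" "r \<noteq> \<zero>" "A \<in> carrier M" "sc r \<otimes>\<^bsub>M\<^esub> A = \<zero>\<^bsub>M\<^esub>"
  shows "A = \<zero>\<^bsub>M\<^esub>"
  using assms by (cases A) (auto simp: mat2_sel mat_scal_def integral_iff)

context cyclic_frame
begin

text \<open>
  The trace form is nondegenerate on \<open>S\<close> because the discriminant is nonzero, and \<open>W\<close> is orthogonal to
  \<open>S\<close>; this determines the first coordinate.  The second one follows after multiplication by \<open>W\<close>,
  since \<open>W\<^sup>2 = q\<close> is not a zero divisor.
\<close>
lemma elt_inj:
  assumes dom: "domain R" and q0: "q \<noteq> \<zero>" and d0: "disc U \<noteq> \<zero>" and U1: "dt U = \<one>"
    and st: "s \<in> S" "t \<in> S" "s' \<in> S" "t' \<in> S" and eq: "elt s t = elt s' t'"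
  shows "s = s'" "t = t'"
proof -
  interpret domain R by fact
  have trS: "s = \<zero>\<^bsub>M\<^esub>" if "s \<in> S" "tr s = \<zero>" "tr (U \<otimes>\<^bsub>M\<^esub> s) = \<zero>" for s
  proof -
    obtain r c where *: "r \<in> carrier R" "c \<in> carrier R" "s = sc r \<oplus>\<^bsub>M\<^esub> sc c \<otimes>\<^bsub>M\<^esub> U"
      using \<open>s \<in> S\<close> by (auto simp: gen_alg_def)
    define t where "t = tr U"
    have t: "t \<in> carrier R" using U by (simp add: t_def)
    have 1: "r \<oplus> r \<oplus> c \<otimes> t = \<zero>" using that(2) * U by (simp add: tr_add tr_sc tr_sc_mult t_def)
    have "U \<otimes>\<^bsub>M\<^esub> s = sc r \<otimes>\<^bsub>M\<^esub> U \<oplus>\<^bsub>M\<^esub> sc c \<otimes>\<^bsub>M\<^esub> (U \<otimes>\<^bsub>M\<^esub> U)"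
      using * U by (simp add: M.r_distr sc_commute M.m_assoc[symmetric])
        (simp add: M.m_assoc sc_commute)
    then have 2: "r \<otimes> t \<oplus> c \<otimes> (t \<otimes> t \<ominus> (\<one> \<oplus> \<one>)) = \<zero>"
      using that(3) * U U1 by (simp add: tr_add tr_sc_mult tr_square t_def)
    have "c \<otimes> disc U = (r \<otimes> t \<oplus> c \<otimes> (t \<otimes> t \<ominus> (\<one> \<oplus> \<one>))) \<oplus> (r \<otimes> t \<oplus> c \<otimes> (t \<otimes> t \<ominus> (\<one> \<oplus> \<one>)))
       \<ominus> t \<otimes> (r \<oplus> r \<oplus> c \<otimes> t)"
      unfolding disc_def t_def[symmetric] using * t by algebra
    also have "\<dots> = \<zero>" unfolding 1 2 using t by (simp add: minus_eq)
    finally have c: "c = \<zero>" using integral[of c "disc U"] d0 * U by simp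
    have rr: "r \<oplus> r = \<zero>" and rt: "r \<otimes> t = \<zero>" using 1 2 c t * by simp_all
    have "r \<otimes> disc U = (r \<otimes> t) \<otimes> t \<ominus> ((r \<oplus> r) \<oplus> (r \<oplus> r))"
      unfolding disc_def t_def[symmetric] using * t by algebra
    also have "\<dots> = \<zero>" unfolding rr rt using t by (simp add: minus_eq)
    finally have "r = \<zero>" using integral[of r "disc U"] d0 * U by simp
    then show ?thesis using c * U by (simp add: sc_zero)
  qed
  have e: "s \<ominus>\<^bsub>M\<^esub> s' \<oplus>\<^bsub>M\<^esub> (t \<ominus>\<^bsub>M\<^esub> t') \<otimes>\<^bsub>M\<^esub> W = \<zero>\<^bsub>M\<^esub>"
  proof -
    have "s \<ominus>\<^bsub>M\<^esub> s' \<oplus>\<^bsub>M\<^esub> (t \<ominus>\<^bsub>M\<^esub> t') \<otimes>\<^bsub>M\<^esub> W = elt s t \<ominus>\<^bsub>M\<^esub> elt s' t'"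
      using S_carrier[OF st(1)] S_carrier[OF st(2)] S_carrier[OF st(3)] S_carrier[OF st(4)] W
      unfolding elt_def by algebra
    then show ?thesis using eq st by (simp add: M.minus_eq M.r_neg)
  qed
  have dS: "s \<ominus>\<^bsub>M\<^esub> s' \<in> S" "t \<ominus>\<^bsub>M\<^esub> t' \<in> S" using st by (simp_all add: M.minus_eq)
  have "tr (s \<ominus>\<^bsub>M\<^esub> s' \<oplus>\<^bsub>M\<^esub> (t \<ominus>\<^bsub>M\<^esub> t') \<otimes>\<^bsub>M\<^esub> W) = tr (s \<ominus>\<^bsub>M\<^esub> s')"
    using dS W by (simp add: tr_add tr_S_W)
  then have "tr (s \<ominus>\<^bsub>M\<^esub> s') = \<zero>" using e by (simp add: sc_zero[symmetric] tr_sc)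
  moreover have "tr (U \<otimes>\<^bsub>M\<^esub> (s \<ominus>\<^bsub>M\<^esub> s' \<oplus>\<^bsub>M\<^esub> (t \<ominus>\<^bsub>M\<^esub> t') \<otimes>\<^bsub>M\<^esub> W)) = tr (U \<otimes>\<^bsub>M\<^esub> (s \<ominus>\<^bsub>M\<^esub> s'))"
    using dS W U tr_S_W[of "U \<otimes>\<^bsub>M\<^esub> (t \<ominus>\<^bsub>M\<^esub> t')"] by (simp add: M.r_distr tr_add M.m_assoc)
  then have "tr (U \<otimes>\<^bsub>M\<^esub> (s \<ominus>\<^bsub>M\<^esub> s')) = \<zero>" using e U by (simp add: sc_zero[symmetric] tr_sc)
      (simp add: sc_zero U tr_sc[of \<zero>, simplified sc_zero])
  ultimately have s: "s \<ominus>\<^bsub>M\<^esub> s' = \<zero>\<^bsub>M\<^esub>" using trS dS by blast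
  then show "s = s'" using st M.r_right_minus_eq by simp
  have "(t \<ominus>\<^bsub>M\<^esub> t') \<otimes>\<^bsub>M\<^esub> W = \<zero>\<^bsub>M\<^esub>" using e s dS W by simp
  then have "(t \<ominus>\<^bsub>M\<^esub> t') \<otimes>\<^bsub>M\<^esub> W \<otimes>\<^bsub>M\<^esub> W = \<zero>\<^bsub>M\<^esub>" using W by simp
  then have "sc q \<otimes>\<^bsub>M\<^esub> (t \<ominus>\<^bsub>M\<^esub> t') = \<zero>\<^bsub>M\<^esub>"
    using dS W by (simp add: M.m_assoc W_square sc_commute)
  then have "t \<ominus>\<^bsub>M\<^esub> t' = \<zero>\<^bsub>M\<^esub>" using mat_sc_mult_zero[OF q_closed q0] dS by simp
  then show "t = t'" using st M.r_right_minus_eq by simp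
qed

end

section \<open>Commuting matrices over a field\<close>

context cring
begin

lemma SL2_pow: "A [^]\<^bsub>SL2 R\<^esub> (n::nat) = A [^]\<^bsub>M\<^esub> n"
  by (induction n) (simp_all add: SL2_sel)

lemma dt_affine:
  assumes "A \<in> carrier M" "r \<in> carrier R" "s \<in> carrier R"
  shows "dt (sc r \<oplus>\<^bsub>M\<^esub> sc s \<otimes>\<^bsub>M\<^esub> A) = r \<otimes> r \<oplus> r \<otimes> s \<otimes> tr A \<oplus> s \<otimes> s \<otimes> dt A"
  using assms by (clarsimp simp: mat2_sel mat_fun_sel mat_scal_def; algebra)

lemma cayley_hamilton:
  assumes "A \<in> carrier M" "dt A = \<one>"
  shows "A \<otimes>\<^bsub>M\<^esub> A = sc (tr A) \<otimes>\<^bsub>M\<^esub> A \<ominus>\<^bsub>M\<^esub> \<one>\<^bsub>M\<^esub>"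
proof -
  have "A \<otimes>\<^bsub>M\<^esub> (A \<oplus>\<^bsub>M\<^esub> adj A) = A \<otimes>\<^bsub>M\<^esub> sc (tr A)" using assms add_adj by simp
  then have e: "A \<otimes>\<^bsub>M\<^esub> A \<oplus>\<^bsub>M\<^esub> \<one>\<^bsub>M\<^esub> = sc (tr A) \<otimes>\<^bsub>M\<^esub> A"
    using assms by (simp add: M.r_distr mult_adj sc_one sc_commute)
  have "B \<in> carrier M \<Longrightarrow> B = (B \<oplus>\<^bsub>M\<^esub> \<one>\<^bsub>M\<^esub>) \<ominus>\<^bsub>M\<^esub> \<one>\<^bsub>M\<^esub>" for B by algebra
  then show ?thesis using e assms by (metis M.m_closed)
qed

lemma nat_power_unipotent:
  assumes N: "N \<in> carrier M" "N \<otimes>\<^bsub>M\<^esub> N = \<zero>\<^bsub>M\<^esub>"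
  shows "(\<one>\<^bsub>M\<^esub> \<oplus>\<^bsub>M\<^esub> N) [^]\<^bsub>M\<^esub> (n::nat) = \<one>\<^bsub>M\<^esub> \<oplus>\<^bsub>M\<^esub> sc ([n] \<cdot> \<one>) \<otimes>\<^bsub>M\<^esub> N"
proof (induction n)
  case 0
  then show ?case using N by (simp add: sc_zero)
next
  case (Suc n)
  define c where "c = sc ([n] \<cdot> \<one>)"
  have c: "c \<in> carrier M" by (simp add: c_def)
  have "(\<one>\<^bsub>M\<^esub> \<oplus>\<^bsub>M\<^esub> N) [^]\<^bsub>M\<^esub> Suc n = (\<one>\<^bsub>M\<^esub> \<oplus>\<^bsub>M\<^esub> c \<otimes>\<^bsub>M\<^esub> N) \<otimes>\<^bsub>M\<^esub> (\<one>\<^bsub>M\<^esub> \<oplus>\<^bsub>M\<^esub> N)"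
    using Suc by (simp add: c_def)
  also have "\<dots> = \<one>\<^bsub>M\<^esub> \<oplus>\<^bsub>M\<^esub> (c \<otimes>\<^bsub>M\<^esub> N \<oplus>\<^bsub>M\<^esub> N) \<oplus>\<^bsub>M\<^esub> c \<otimes>\<^bsub>M\<^esub> (N \<otimes>\<^bsub>M\<^esub> N)"
    using N(1) c by (simp add: M.l_distr M.r_distr M.a_ac M.m_assoc)
  also have "\<dots> = \<one>\<^bsub>M\<^esub> \<oplus>\<^bsub>M\<^esub> (c \<oplus>\<^bsub>M\<^esub> \<one>\<^bsub>M\<^esub>) \<otimes>\<^bsub>M\<^esub> N"
    using N c by (simp add: M.l_distr)
  also have "c \<oplus>\<^bsub>M\<^esub> \<one>\<^bsub>M\<^esub> = sc ([Suc n] \<cdot> \<one>)"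
    by (simp add: c_def sc_add sc_one)
  finally show ?case .
qed

text \<open>
  From \<open>(tr A)\<^sup>2 = 4\<close> follows that \<open>A\<^sup>2\<close> has trace \<open>2\<close>, so it is \<open>1 + N\<close> with \<open>N\<^sup>2 = 0\<close>
  and its \<open>p\<close>-th power is \<open>1 + p N\<close>.
\<close>
lemma disc_zero_pow:
  assumes A: "A \<in> carrier M" "dt A = \<one>" and d: "disc A = \<zero>" and p: "[p] \<cdot> \<one> = \<zero>"
  shows "(A \<otimes>\<^bsub>M\<^esub> A) [^]\<^bsub>M\<^esub> (p::nat) = \<one>\<^bsub>M\<^esub>"
proof -
  define B where "B = A \<otimes>\<^bsub>M\<^esub> A"
  have B: "B \<in> carrier M" "dt B = \<one>" using A by (simp_all add: B_def dt_mult)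
  have "tr B = disc A \<oplus> (\<one> \<oplus> \<one>)"
  proof -
    have "t \<in> carrier R \<Longrightarrow> t \<otimes> t \<ominus> (\<one> \<oplus> \<one>) = t \<otimes> t \<ominus> (\<one> \<oplus> \<one> \<oplus> \<one> \<oplus> \<one>) \<oplus> (\<one> \<oplus> \<one>)" for t by algebra
    then show ?thesis using A by (simp add: B_def tr_square disc_def)
  qed
  then have trB: "tr B = \<one> \<oplus> \<one>" using d by simp
  define N where "N = B \<ominus>\<^bsub>M\<^esub> \<one>\<^bsub>M\<^esub>"
  have N: "N \<in> carrier M" using B by (simp add: N_def)
  have BN: "B = \<one>\<^bsub>M\<^esub> \<oplus>\<^bsub>M\<^esub> N" unfolding N_def using B(1) by algebra
  have "N \<otimes>\<^bsub>M\<^esub> N = B \<otimes>\<^bsub>M\<^esub> B \<ominus>\<^bsub>M\<^esub> (B \<oplus>\<^bsub>M\<^esub> B) \<oplus>\<^bsub>M\<^esub> \<one>\<^bsub>M\<^esub>"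
    unfolding N_def using B(1)
    by (simp add: M.minus_eq M.l_distr M.r_distr M.l_minus M.r_minus M.minus_add M.a_ac)
  also have "B \<otimes>\<^bsub>M\<^esub> B = (B \<oplus>\<^bsub>M\<^esub> B) \<ominus>\<^bsub>M\<^esub> \<one>\<^bsub>M\<^esub>"
    using cayley_hamilton[OF B] B by (simp add: trB sc_add sc_one M.l_distr)
  also have "(B \<oplus>\<^bsub>M\<^esub> B) \<ominus>\<^bsub>M\<^esub> \<one>\<^bsub>M\<^esub> \<ominus>\<^bsub>M\<^esub> (B \<oplus>\<^bsub>M\<^esub> B) \<oplus>\<^bsub>M\<^esub> \<one>\<^bsub>M\<^esub> = \<zero>\<^bsub>M\<^esub>"
    using B(1) by algebra
  finally have "N \<otimes>\<^bsub>M\<^esub> N = \<zero>\<^bsub>M\<^esub>" .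
  then show ?thesis
    using nat_power_unipotent[OF N, of p] N by (simp add: B_def[symmetric] BN p sc_zero)
qed

end

context field
begin

text \<open>
  A nonscalar matrix of size two has a cyclic vector, so its commutant consists of polynomials in it.
  The proof compares entries and distinguishes which of the two off-diagonal entries, or else the
  difference of the diagonal ones, is invertible.
\<close>
lemma commuting_in_gen_alg:
  assumes A: "A \<in> carrier M" and ns: "A \<notin> range sc" and B: "B \<in> carrier M"
    and comm: "A \<otimes>\<^bsub>M\<^esub> B = B \<otimes>\<^bsub>M\<^esub> A"
  shows "B \<in> gen_alg A"
proof -
  obtain a b c d a' b' c' d' where AB: "A = (a, b, c, d)" "B = (a', b', c', d')" by (metis prod_cases4)
  have car [simp]: "a \<in> carrier R" "b \<in> carrier R" "c \<in> carrier R" "d \<in> carrier R"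
    "a' \<in> carrier R" "b' \<in> carrier R" "c' \<in> carrier R" "d' \<in> carrier R"
    using A B by (auto simp: AB mat2_sel)
  have e0: "a \<otimes> a' \<oplus> b \<otimes> c' = a' \<otimes> a \<oplus> b' \<otimes> c"
    and e2: "a \<otimes> b' \<oplus> b \<otimes> d' = a' \<otimes> b \<oplus> b' \<otimes> d"
    and e3: "c \<otimes> a' \<oplus> d \<otimes> c' = c' \<otimes> a \<oplus> d' \<otimes> c"
    using comm by (simp_all add: AB mat2_sel)
  have e1: "b \<otimes> c' = b' \<otimes> c" using e0 by (simp add: m_comm[of a' a])
  have mult_inv: "y = (y \<otimes> inv x) \<otimes> x" if "x \<in> carrier R" "x \<noteq> \<zero>" "y \<in> carrier R" for x y
    using that field_Units by (simp add: m_assoc)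
  have cancel: "u = v" if "x \<otimes> u = x \<otimes> v" "x \<noteq> \<zero>" "x \<in> carrier R" "u \<in> carrier R" "v \<in> carrier R" for x u v
    using that m_lcancel by blast
  have main: "B \<in> gen_alg A"
    if s: "s \<in> carrier R" and "s \<otimes> b = b'" "s \<otimes> c = c'" "s \<otimes> d \<oplus> a' = d' \<oplus> s \<otimes> a" for s
  proof (rule gen_algI[of "a' \<ominus> s \<otimes> a" s])
    have "a' \<ominus> s \<otimes> a \<oplus> s \<otimes> a = a'" using s by (simp add: minus_eq a_assoc l_neg)
    moreover have "a' \<ominus> s \<otimes> a \<oplus> s \<otimes> d = (s \<otimes> d \<oplus> a') \<ominus> s \<otimes> a"
      using s by (simp add: minus_eq a_ac)
    moreover have "\<dots> = d'" unfolding that(4) using s by (simp add: minus_eq a_assoc r_neg)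
    ultimately show "B = sc (a' \<ominus> s \<otimes> a) \<oplus>\<^bsub>M\<^esub> sc s \<otimes>\<^bsub>M\<^esub> A"
      using s that(2,3) by (simp add: AB mat2_sel mat_scal_def)
  qed (use s in simp_all)
  show ?thesis
  proof (cases "b = \<zero>")
    case False
    define s where "s = b' \<otimes> inv b"
    have s: "s \<in> carrier R" using False field_Units by (simp add: s_def)
    have sb: "s \<otimes> b = b'" using mult_inv[of b b'] False by (simp add: s_def)
    have "b \<otimes> (s \<otimes> c) = (s \<otimes> b) \<otimes> c" using s by (simp add: m_ac)
    then have "b \<otimes> (s \<otimes> c) = b \<otimes> c'" using e1 sb by simp
    then have sc: "s \<otimes> c = c'" using cancel[of b "s \<otimes> c" c'] False s by simp
    have "b \<otimes> (s \<otimes> d \<oplus> a') = (s \<otimes> b) \<otimes> d \<oplus> b \<otimes> a'" using s by (simp add: m_ac r_distr)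
    also have "\<dots> = a \<otimes> b' \<oplus> b \<otimes> d'" unfolding e2 sb by (simp add: m_ac a_ac)
    also have "\<dots> = b \<otimes> (d' \<oplus> s \<otimes> a)" unfolding sb[symmetric] using s by (simp add: m_ac r_distr a_ac)
    finally have "s \<otimes> d \<oplus> a' = d' \<oplus> s \<otimes> a" using cancel[of b] False s by simp
    then show ?thesis using main s sb sc by blast
  next
    case b0: True
    show ?thesis
    proof (cases "c = \<zero>")
      case False
      define s where "s = c' \<otimes> inv c"
      have s: "s \<in> carrier R" using False field_Units by (simp add: s_def)
      have sc: "s \<otimes> c = c'" using mult_inv[of c c'] False by (simp add: s_def)
      have "\<zero> \<otimes> c' = b' \<otimes> c" using e1 unfolding b0 .
      then have "b' = \<zero>" using integral[of b' c] False by simp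
      then have sb: "s \<otimes> b = b'" using s b0 by simp
      have "c \<otimes> (s \<otimes> d \<oplus> a') = c \<otimes> a' \<oplus> d \<otimes> (s \<otimes> c)" using s by (simp add: m_ac r_distr a_ac)
      also have "\<dots> = (s \<otimes> c) \<otimes> a \<oplus> d' \<otimes> c" using e3 sc by simp
      also have "\<dots> = c \<otimes> (d' \<oplus> s \<otimes> a)" using s by (simp add: m_ac r_distr a_ac)
      finally have "s \<otimes> d \<oplus> a' = d' \<oplus> s \<otimes> a" using cancel[of c] False s by simp
      then show ?thesis using main s sb sc by blast
    next
      case c0: True
      have ad: "a \<noteq> d" using ns b0 c0 by (auto simp: AB mat_scal_def)
      define x where "x = d \<ominus> a"
      have x: "x \<in> carrier R" "x \<noteq> \<zero>" using ad by (auto simp: x_def)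
      have "x \<otimes> b' = d \<otimes> b' \<ominus> a \<otimes> b'" unfolding x_def using car by algebra
      also have "\<dots> = \<zero>" using e2 b0 by (simp add: m_comm minus_eq r_neg)
      finally have b'0: "b' = \<zero>" using x integral[of x b'] by simp
      have "x \<otimes> c' = d \<otimes> c' \<ominus> a \<otimes> c'" unfolding x_def using car by algebra
      also have "\<dots> = \<zero>" using e3 c0 by (simp add: m_comm minus_eq r_neg)
      finally have c'0: "c' = \<zero>" using x integral[of x c'] by simp
      define s where "s = (d' \<ominus> a') \<otimes> inv x"
      have s: "s \<in> carrier R" using x field_Units by (simp add: s_def)
      have sx: "s \<otimes> x = d' \<ominus> a'" using mult_inv[of x "d' \<ominus> a'"] x by (simp add: s_def)
      have "s \<otimes> d \<oplus> a' = s \<otimes> x \<oplus> s \<otimes> a \<oplus> a'" unfolding x_def using s car by algebra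
      also have "\<dots> = d' \<oplus> s \<otimes> a" unfolding sx using s car by algebra
      finally show ?thesis using main[OF s] b0 c0 b'0 c'0 s by simp
    qed
  qed
qed

lemma commute_trans:
  assumes "A \<in> carrier M" "A \<notin> range sc" "B \<in> carrier M" "C \<in> carrier M"
    "A \<otimes>\<^bsub>M\<^esub> B = B \<otimes>\<^bsub>M\<^esub> A" "A \<otimes>\<^bsub>M\<^esub> C = C \<otimes>\<^bsub>M\<^esub> A"
  shows "B \<otimes>\<^bsub>M\<^esub> C = C \<otimes>\<^bsub>M\<^esub> B"
  by (rule gen_alg_commute[OF assms(1) commuting_in_gen_alg[OF assms(1,2,3,5)]
      commuting_in_gen_alg[OF assms(1,2,4,6)]])

text \<open>
  In the eigenbasis of \<open>A\<close> the matrix \<open>B\<close> is diagonal with the same eigenvalues, possibly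
  interchanged.  Without extending the field: write \<open>B = r + s A\<close>; comparing traces and determinants
  gives \<open>s\<^sup>2 disc A = disc A\<close>.
\<close>
lemma commuting_same_trace:
  assumes two: "\<one> \<oplus> \<one> \<noteq> \<zero>" and A: "A \<in> carrier M" "dt A = \<one>" and ns: "A \<notin> range sc"
    and d: "disc A \<noteq> \<zero>" and B: "B \<in> carrier M" "dt B = \<one>" "tr B = tr A"
    and comm: "A \<otimes>\<^bsub>M\<^esub> B = B \<otimes>\<^bsub>M\<^esub> A"
  shows "B = A \<or> B = adj A"
proof -
  obtain r s where rs: "r \<in> carrier R" "s \<in> carrier R" "B = sc r \<oplus>\<^bsub>M\<^esub> sc s \<otimes>\<^bsub>M\<^esub> A"
    using commuting_in_gen_alg[OF A(1) ns B(1) comm] by (auto simp: gen_alg_def)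
  define t where "t = tr A"
  have t: "t \<in> carrier R" using A by (simp add: t_def)
  have T: "r \<oplus> r \<oplus> s \<otimes> t = t" using B(3) rs A by (simp add: tr_add tr_sc tr_sc_mult t_def)
  have D: "r \<otimes> r \<oplus> r \<otimes> s \<otimes> t \<oplus> s \<otimes> s = \<one>" using B(2) rs A by (simp add: dt_affine t_def)
  let ?four = "\<lambda>x. x \<oplus> x \<oplus> x \<oplus> x"
  have "?four (r \<otimes> r \<oplus> r \<otimes> s \<otimes> t \<oplus> s \<otimes> s) =
      (r \<oplus> r \<oplus> s \<otimes> t) \<otimes> (r \<oplus> r \<oplus> s \<otimes> t) \<ominus> s \<otimes> s \<otimes> (t \<otimes> t \<ominus> ?four \<one>)"
  proof -
    define y where "y = s \<otimes> t"
    have y: "y \<in> carrier R" using rs t by (simp add: y_def)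
    have i1: "(r \<oplus> r \<oplus> y) \<otimes> (r \<oplus> r \<oplus> y) = ?four (r \<otimes> r \<oplus> r \<otimes> y) \<oplus> y \<otimes> y"
      using rs(1) y by algebra
    have i2: "s \<otimes> s \<otimes> (t \<otimes> t \<ominus> ?four \<one>) = y \<otimes> y \<ominus> ?four (s \<otimes> s)"
      unfolding y_def using rs(2) t by algebra
    have i3: "g \<in> carrier R \<Longrightarrow> h \<in> carrier R \<Longrightarrow> k \<in> carrier R \<Longrightarrow>
        ?four (g \<oplus> h) = (?four g \<oplus> k) \<ominus> (k \<ominus> ?four h)" for g h k by algebra
    have "r \<otimes> s \<otimes> t = r \<otimes> y" using rs t by (simp add: y_def m_assoc)
    then show ?thesis
      unfolding y_def[symmetric] i1 i2
      using i3[of "r \<otimes> r \<oplus> r \<otimes> y" "s \<otimes> s" "y \<otimes> y"] rs(1,2) y by simp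
  qed
  then have 4: "?four \<one> = t \<otimes> t \<ominus> s \<otimes> s \<otimes> disc A" unfolding T D disc_def t_def[symmetric] .
  have dd: "disc A = t \<otimes> t \<ominus> ?four \<one>" by (simp add: disc_def t_def)
  define x where "x = disc A"
  have x: "x \<in> carrier R" using A by (simp add: x_def)
  have "x = t \<otimes> t \<ominus> (t \<otimes> t \<ominus> s \<otimes> s \<otimes> x)" using dd 4 by (simp add: x_def)
  also have "\<dots> = s \<otimes> s \<otimes> x" using t rs(2) x by algebra
  finally have "(s \<ominus> \<one>) \<otimes> (s \<oplus> \<one>) \<otimes> x = \<zero>"
  proof -
    assume a: "x = s \<otimes> s \<otimes> x"
    have "(s \<ominus> \<one>) \<otimes> (s \<oplus> \<one>) \<otimes> x = s \<otimes> s \<otimes> x \<ominus> x" using rs(2) x by algebra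
    also have "\<dots> = \<zero>" using a x rs(2) by (metis m_closed r_right_minus_eq)
    finally show ?thesis .
  qed
  then have "(s \<ominus> \<one>) \<otimes> (s \<oplus> \<one>) = \<zero>" using integral_iff[of "(s \<ominus> \<one>) \<otimes> (s \<oplus> \<one>)" x] d[folded x_def] x rs(2) by simp
  then consider "s \<ominus> \<one> = \<zero>" | "s \<oplus> \<one> = \<zero>" using integral rs(2) by (metis add.m_closed minus_closed one_closed)
  then show ?thesis
  proof cases
    case 1
    then have s1: "s = \<one>" using rs(2) r_right_minus_eq by simp
    have "r \<oplus> r = (r \<oplus> r \<oplus> s \<otimes> t) \<ominus> t" using rs t s1 by (simp add: minus_eq a_assoc r_neg)
    then have "r \<oplus> r = \<zero>" using T t by (simp add: minus_eq r_neg)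
    then have "r \<otimes> (\<one> \<oplus> \<one>) = \<zero>" using rs by (simp add: r_distr)
    then have "r = \<zero>" using integral[of r "\<one> \<oplus> \<one>"] rs two by auto
    then show ?thesis using rs A s1 by (simp add: sc_zero sc_one)
  next
    case 2
    then have s1: "s = \<ominus> \<one>" using rs(2) minus_equality by fastforce
    have "r \<oplus> r = (r \<oplus> r \<oplus> s \<otimes> t) \<oplus> t" using rs t s1 by (simp add: l_minus a_assoc l_neg)
    then have "r \<oplus> r = t \<oplus> t" unfolding T .
    then have "(r \<ominus> t) \<otimes> (\<one> \<oplus> \<one>) = \<zero>"
    proof -
      assume a: "r \<oplus> r = t \<oplus> t"
      have "(r \<ominus> t) \<otimes> (\<one> \<oplus> \<one>) = (r \<oplus> r) \<ominus> (t \<oplus> t)" using rs(1) t by algebra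
      then show ?thesis using a t by (simp add: minus_eq r_neg)
    qed
    then have "r \<ominus> t = \<zero>" using integral[of "r \<ominus> t" "\<one> \<oplus> \<one>"] rs t two by auto
    then have "r = t" using rs t r_right_minus_eq by simp
    then have "B = sc (tr A) \<ominus>\<^bsub>M\<^esub> A" using rs A s1 t
      by (simp add: sc_uminus sc_one M.l_minus M.minus_eq t_def)
    also have "\<dots> = (A \<oplus>\<^bsub>M\<^esub> adj A) \<ominus>\<^bsub>M\<^esub> A" using A by (simp add: add_adj)
    also have "\<dots> = adj A"
    proof -
      have "C \<in> carrier M \<Longrightarrow> (A \<oplus>\<^bsub>M\<^esub> C) \<ominus>\<^bsub>M\<^esub> A = C" for C
        using A(1) by (simp add: M.minus_eq M.a_comm[of A C] M.a_assoc M.r_neg)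
      then show ?thesis using A by simp
    qed
    finally show ?thesis by simp
  qed
qed

end

lemma (in domain) scalar_det_one:
  assumes "A \<in> carrier M" "dt A = \<one>" "A \<in> range sc"
  shows "A = \<one>\<^bsub>M\<^esub> \<or> A = \<ominus>\<^bsub>M\<^esub> \<one>\<^bsub>M\<^esub>"
proof -
  obtain r where r: "A = sc r" using assms by auto
  have rc: "r \<in> carrier R" using assms r by (simp add: mat_scal_def mat2_sel)
  have "(r \<ominus> \<one>) \<otimes> (r \<oplus> \<one>) = r \<otimes> r \<ominus> \<one>" using rc by algebra
  also have "\<dots> = \<zero>" using assms(2) rc r by (simp add: mat_scal_def mat_fun_sel minus_eq r_neg)
  finally have "r \<ominus> \<one> = \<zero> \<or> r \<oplus> \<one> = \<zero>" using integral rc by (metis add.m_closed minus_closed one_closed)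
  then have "r = \<one> \<or> r = \<ominus> \<one>" using rc r_right_minus_eq minus_equality by fastforce
  then show ?thesis using r by (auto simp: sc_one sc_uminus)
qed

section \<open>Cyclic subgroups and commuting conjugates\<close>

context group
begin

lemma conj_pow:
  assumes "g \<in> carrier G" "a \<in> carrier G"
  shows "(g \<otimes> a \<otimes> inv g) [^] (n::nat) = g \<otimes> a [^] n \<otimes> inv g"
  by (induction n) (use assms in \<open>simp_all add: m_assoc\<close>)

text \<open>
  Natural exponents suffice for inverses because \<open>a\<close> has finite order.  The factor \<open>z\<close> is there to put
  the scalar \<open>-1\<close> into the group.
\<close>
lemma signed_powers_subgroup:
  assumes a: "a \<in> carrier G" and z: "z \<in> carrier G" "z \<otimes> z = \<one>" "z \<otimes> a = a \<otimes> z"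
    and n: "a [^] (n::nat) = \<one>" "0 < n"
  defines "B \<equiv> range (\<lambda>i::nat. a [^] i) \<union> range (\<lambda>i::nat. z \<otimes> a [^] i)"
  shows "subgroup B G" "finite B"
proof -
  have red: "a [^] i = a [^] (i mod n)" for i
  proof -
    have "a [^] (n * (i div n)) = \<one>" using a n nat_pow_pow[OF a, of n "i div n"] by simp
    then have "a [^] (n * (i div n) + i mod n) = a [^] (i mod n)"
      using a nat_pow_mult[OF a, of "n * (i div n)" "i mod n"] by simp
    then show ?thesis unfolding mult_div_mod_eq .
  qed
  have "B \<subseteq> (\<lambda>i. a [^] i) ` {..<n} \<union> (\<lambda>i. z \<otimes> a [^] i) ` {..<n}"
  proof
    fix x assume "x \<in> B"
    then obtain i where "x = a [^] (i mod n) \<or> x = z \<otimes> a [^] (i mod n)"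
      unfolding B_def using red by auto
    then show "x \<in> (\<lambda>i. a [^] i) ` {..<n} \<union> (\<lambda>i. z \<otimes> a [^] i) ` {..<n}" using n by auto
  qed
  then show "finite B" by (rule finite_subset) simp
  have za: "a [^] i \<otimes> z = z \<otimes> a [^] i" for i :: nat
    by (induction i) (use a z in \<open>simp_all add: m_assoc\<close>, metis m_assoc nat_pow_closed)
  show "subgroup B G"
  proof (rule subgroupI)
    show "B \<subseteq> carrier G" using a z by (auto simp: B_def)
    show "B \<noteq> {}" by (auto simp: B_def)
    fix x y assume "x \<in> B" "y \<in> B"
    then obtain i j :: nat where "x = a [^] i \<or> x = z \<otimes> a [^] i" "y = a [^] j \<or> y = z \<otimes> a [^] j"
      by (auto simp: B_def)
    moreover have "a [^] i \<otimes> (z \<otimes> a [^] j) = z \<otimes> a [^] (i + j)"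
      using a z za[of i] by (simp add: m_assoc[symmetric] nat_pow_mult[symmetric])
    moreover have "(z \<otimes> a [^] i) \<otimes> (z \<otimes> a [^] j) = a [^] (i + j)"
    proof -
      have "(z \<otimes> a [^] i) \<otimes> (z \<otimes> a [^] j) = z \<otimes> (a [^] i \<otimes> z) \<otimes> a [^] j"
        using a z by (simp add: m_assoc)
      also have "\<dots> = (z \<otimes> z) \<otimes> (a [^] i \<otimes> a [^] j)" unfolding za using a z(1) by (simp add: m_assoc)
      finally show ?thesis using a z by (simp add: nat_pow_mult)
    qed
    moreover have "(z \<otimes> a [^] i) \<otimes> a [^] j = z \<otimes> a [^] (i + j)"
      using a z by (simp add: m_assoc nat_pow_mult[symmetric])
    ultimately show "x \<otimes> y \<in> B" using a unfolding B_def by (auto simp: nat_pow_mult)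
  next
    fix x assume "x \<in> B"
    then obtain i :: nat where i: "x = a [^] (i mod n) \<or> x = z \<otimes> a [^] (i mod n)"
      unfolding B_def using red by auto
    define k where "k = n - i mod n"
    have k: "a [^] k \<otimes> a [^] (i mod n) = \<one>"
      using n mod_less_divisor[of n i] a by (simp add: k_def nat_pow_mult)
    have "inv (a [^] (i mod n)) = a [^] k" using k a by (intro inv_equality) auto
    moreover have "inv (z \<otimes> a [^] (i mod n)) = z \<otimes> a [^] k"
    proof (rule inv_equality)
      have "z \<otimes> a [^] k \<otimes> (z \<otimes> a [^] (i mod n)) = z \<otimes> (a [^] k \<otimes> z) \<otimes> a [^] (i mod n)"
        using a z by (simp add: m_assoc)
      also have "\<dots> = (z \<otimes> z) \<otimes> (a [^] k \<otimes> a [^] (i mod n))" unfolding za using a z(1) by (simp add: m_assoc)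
      finally show "z \<otimes> a [^] k \<otimes> (z \<otimes> a [^] (i mod n)) = \<one>" using z k a by simp
    qed (use a z in auto)
    ultimately show "inv x \<in> B" using i unfolding B_def by auto
  qed
qed

end

context field
begin

lemma minus_one_ne:
  assumes two: "\<one> \<oplus> \<one> \<noteq> \<zero>" shows "\<ominus>\<^bsub>M\<^esub> \<one>\<^bsub>M\<^esub> \<noteq> \<one>\<^bsub>M\<^esub>"
proof
  assume "\<ominus>\<^bsub>M\<^esub> \<one>\<^bsub>M\<^esub> = \<one>\<^bsub>M\<^esub>"
  then have "sc (\<ominus> \<one>) = sc \<one>" by (simp add: sc_uminus sc_one)
  then have "\<ominus> \<one> = \<one>" by simp
  then show False using two r_neg[of \<one>] by simp
qed

text \<open>
  Since the eigenvalues coincide, the trace is \<open>2\<close> or \<open>-2\<close> and thus invertible; the equation of Cayley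
  and Hamilton then exhibits \<open>A\<close> as a scalar.
\<close>
lemma disc_zero_square_one:
  assumes two: "\<one> \<oplus> \<one> \<noteq> \<zero>" and A: "A \<in> carrier M" "dt A = \<one>" and d: "disc A = \<zero>"
    and sq: "A \<otimes>\<^bsub>M\<^esub> A = \<one>\<^bsub>M\<^esub>"
  shows "A \<in> range sc"
proof -
  have four: "\<one> \<oplus> \<one> \<oplus> \<one> \<oplus> \<one> = (\<one> \<oplus> \<one>) \<otimes> (\<one> \<oplus> \<one>)" by algebra
  have "tr A \<noteq> \<zero>"
  proof
    assume "tr A = \<zero>"
    then have "\<one> \<oplus> \<one> \<oplus> \<one> \<oplus> \<one> = \<zero>" using d by (simp add: disc_def minus_eq)
    then show False using two integral[of "\<one> \<oplus> \<one>" "\<one> \<oplus> \<one>"] four by auto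
  qed
  then have u: "tr A \<in> Units R" using A field_Units by simp
  have "sc (tr A) \<otimes>\<^bsub>M\<^esub> A = A \<otimes>\<^bsub>M\<^esub> A \<oplus>\<^bsub>M\<^esub> \<one>\<^bsub>M\<^esub>"
    using cayley_hamilton[OF A] A by (simp add: M.minus_eq M.a_assoc M.l_neg)
  then have "sc (tr A) \<otimes>\<^bsub>M\<^esub> A = sc (\<one> \<oplus> \<one>)" using sq by (simp add: sc_add sc_one)
  then have "sc (inv (tr A)) \<otimes>\<^bsub>M\<^esub> (sc (tr A) \<otimes>\<^bsub>M\<^esub> A) = sc (inv (tr A) \<otimes> (\<one> \<oplus> \<one>))"
    using u by (simp add: sc_mult)
  moreover have "sc (inv (tr A)) \<otimes>\<^bsub>M\<^esub> (sc (tr A) \<otimes>\<^bsub>M\<^esub> A) = A"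
    using u A by (simp add: M.m_assoc[symmetric] sc_mult[symmetric] sc_one)
  ultimately show ?thesis by auto
qed

text \<open>
  Two commuting conjugates share their eigenvectors.  If \<open>V\<close> is semisimple, conjugation by \<open>U\<close> fixes or
  interchanges its two eigenlines; the interchange would make \<open>U\<^sup>2\<close> commute with \<open>V\<close>, hence, \<open>U\<^sup>2\<close>
  not being scalar, \<open>U\<close> itself.  Otherwise, up to sign, \<open>V\<close> and its
  conjugate are unipotent with the same fixed line.  In each case \<open>U V U\<^sup>-\<^sup>1 V\<^sup>-\<^sup>1\<close>
  has trace \<open>2\<close>.
\<close>
lemma tr_commutator_of_commuting_conjugate:
  assumes two: "\<one> \<oplus> \<one> \<noteq> \<zero>"
    and U: "U \<in> carrier M" "dt U = \<one>" and V: "V \<in> carrier M" "dt V = \<one>"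
    and ns: "V \<notin> range sc" and ns2: "U \<otimes>\<^bsub>M\<^esub> U \<notin> range sc"
    and comm: "V \<otimes>\<^bsub>M\<^esub> (U \<otimes>\<^bsub>M\<^esub> V \<otimes>\<^bsub>M\<^esub> adj U) = (U \<otimes>\<^bsub>M\<^esub> V \<otimes>\<^bsub>M\<^esub> adj U) \<otimes>\<^bsub>M\<^esub> V"
  shows "tr (U \<otimes>\<^bsub>M\<^esub> V \<otimes>\<^bsub>M\<^esub> adj U \<otimes>\<^bsub>M\<^esub> adj V) = \<one> \<oplus> \<one>"
proof -
  have UU: "adj U \<otimes>\<^bsub>M\<^esub> U = \<one>\<^bsub>M\<^esub>" "U \<otimes>\<^bsub>M\<^esub> adj U = \<one>\<^bsub>M\<^esub>"
    and VV: "adj V \<otimes>\<^bsub>M\<^esub> V = \<one>\<^bsub>M\<^esub>" "V \<otimes>\<^bsub>M\<^esub> adj V = \<one>\<^bsub>M\<^esub>"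
    using U V by (simp_all add: adj_times mult_adj sc_one)
  define V' where "V' = U \<otimes>\<^bsub>M\<^esub> V \<otimes>\<^bsub>M\<^esub> adj U"
  have V': "V' \<in> carrier M" "dt V' = \<one>" using U V by (simp_all add: V'_def dt_mult)
  have "tr V' = tr (adj U \<otimes>\<^bsub>M\<^esub> (U \<otimes>\<^bsub>M\<^esub> V))"
    using U V by (simp add: V'_def tr_mult_commute[of "adj U"])
  then have trV': "tr V' = tr V" using U V by (simp add: M.m_assoc[symmetric] UU)
  have commuting: "tr (V' \<otimes>\<^bsub>M\<^esub> adj V) = \<one> \<oplus> \<one>" if "U \<otimes>\<^bsub>M\<^esub> V = V \<otimes>\<^bsub>M\<^esub> U"
    using that U V by (simp add: V'_def M.m_assoc UU VV) (simp add: VV sc_one[symmetric] tr_sc)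
  have "tr (V' \<otimes>\<^bsub>M\<^esub> adj V) = \<one> \<oplus> \<one>"
  proof (cases "disc V = \<zero>")
    case False
    then consider "V' = V" | "V' = adj V"
      using commuting_same_trace[OF two V ns _ V' trV'] comm by (auto simp: V'_def)
    then show ?thesis
    proof cases
      case 1
      then show ?thesis using VV by (simp add: sc_one[symmetric] tr_sc)
    next
      case 2
      have "U \<otimes>\<^bsub>M\<^esub> V = adj V \<otimes>\<^bsub>M\<^esub> U"
      proof -
        have "U \<otimes>\<^bsub>M\<^esub> V = V' \<otimes>\<^bsub>M\<^esub> U" using U V by (simp add: V'_def M.m_assoc UU)
        then show ?thesis using 2 by simp
      qed
      moreover have "U \<otimes>\<^bsub>M\<^esub> adj V = V \<otimes>\<^bsub>M\<^esub> U"
      proof -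
        have "adj V' = V" using 2 V by simp
        then have "U \<otimes>\<^bsub>M\<^esub> adj V \<otimes>\<^bsub>M\<^esub> adj U = V" using U V by (simp add: V'_def adj_mult M.m_assoc)
        then have "U \<otimes>\<^bsub>M\<^esub> adj V \<otimes>\<^bsub>M\<^esub> adj U \<otimes>\<^bsub>M\<^esub> U = V \<otimes>\<^bsub>M\<^esub> U" by simp
        then show ?thesis using U V by (simp add: M.m_assoc UU)
      qed
      ultimately have "(U \<otimes>\<^bsub>M\<^esub> U) \<otimes>\<^bsub>M\<^esub> V = V \<otimes>\<^bsub>M\<^esub> (U \<otimes>\<^bsub>M\<^esub> U)"
        using U V by (metis M.m_assoc mat_closed(3))
      then have "U \<otimes>\<^bsub>M\<^esub> V = V \<otimes>\<^bsub>M\<^esub> U"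
        using commute_trans[OF _ ns2 U(1) V(1)] U by (simp add: M.m_assoc)
      then show ?thesis by (rule commuting)
    qed
  next
    case True
    obtain r s where rs: "r \<in> carrier R" "s \<in> carrier R" "V' = sc r \<oplus>\<^bsub>M\<^esub> sc s \<otimes>\<^bsub>M\<^esub> V"
      using commuting_in_gen_alg[OF V(1) ns V'(1)] comm by (auto simp: V'_def gen_alg_def)
    define u where "u = tr V"
    have u: "u \<in> carrier R" using V by (simp add: u_def)
    have T: "r \<oplus> r \<oplus> s \<otimes> u = u" using trV' rs V by (simp add: tr_add tr_sc tr_sc_mult u_def)
    have "V' \<otimes>\<^bsub>M\<^esub> adj V = sc r \<otimes>\<^bsub>M\<^esub> adj V \<oplus>\<^bsub>M\<^esub> sc s"
      using rs V by (simp add: M.l_distr M.m_assoc VV)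
    then have t: "tr (V' \<otimes>\<^bsub>M\<^esub> adj V) = r \<otimes> u \<oplus> (s \<oplus> s)"
      using rs V by (simp add: tr_add tr_sc tr_sc_mult u_def)
    have D: "u \<otimes> u = \<one> \<oplus> \<one> \<oplus> \<one> \<oplus> \<one>" using True V r_right_minus_eq by (simp add: disc_def u_def)
    have "(\<one> \<oplus> \<one>) \<otimes> (r \<otimes> u \<oplus> (s \<oplus> s)) = (r \<oplus> r \<oplus> s \<otimes> u) \<otimes> u \<ominus> s \<otimes> (u \<otimes> u) \<oplus> s \<otimes> (\<one> \<oplus> \<one> \<oplus> \<one> \<oplus> \<one>)"
      using rs(1,2) u by algebra
    also have "\<dots> = u \<otimes> u" unfolding T using D rs u by (simp add: minus_eq a_assoc l_neg)
    also have "\<dots> = (\<one> \<oplus> \<one>) \<otimes> (\<one> \<oplus> \<one>)" unfolding D by algebra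
    finally have "r \<otimes> u \<oplus> (s \<oplus> s) = \<one> \<oplus> \<one>"
      using m_lcancel[OF two, of "r \<otimes> u \<oplus> (s \<oplus> s)" "\<one> \<oplus> \<one>"] rs u by simp
    then show ?thesis using t by simp
  qed
  then show ?thesis by (simp add: V'_def)
qed

end

section \<open>Pairs over a field without common eigenvector\<close>

context field
begin

text \<open>
  The hypothesis on subgroups containing \<open>U\<^sup>m\<close>, \<open>V\<close> and \<open>-1\<close> is used three times: with the
  centralizer of \<open>V\<close>, it shows that \<open>V\<close> has finite order modulo scalars; with the group of powers of
  \<open>V\<close>, that \<open>\<Gamma>\<close> is finite; and with the elements of bounded order in the centralizer of \<open>V\<close>, that
  \<open>\<Gamma>\<close> has no nontrivial unipotent elements.  Now the count of conjugates applies to \<open>\<Gamma>\<close>, and the large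
  centralizer of \<open>U\<close> is normalized by \<open>V\<close>.
\<close>
theorem residual_dihedral:
  fixes U V :: "'a mat2" and m p :: nat
  defines "\<Gamma> \<equiv> generate (SL2 R) {U, V, \<ominus>\<^bsub>M\<^esub> \<one>\<^bsub>M\<^esub>}"
  assumes two: "\<one> \<oplus> \<one> \<noteq> \<zero>" and p: "Factorial_Ring.prime p" "[p] \<cdot> \<one> = \<zero>"
    and U: "U \<in> carrier (SL2 R)" and V: "V \<in> carrier (SL2 R)"
    and ord: "\<And>j::nat. U [^]\<^bsub>SL2 R\<^esub> j \<in> {\<one>\<^bsub>M\<^esub>, \<ominus>\<^bsub>M\<^esub> \<one>\<^bsub>M\<^esub>} \<longleftrightarrow> m dvd j"
    and m: "7 \<le> m" "m < p"
    and few: "\<And>B. subgroup B (SL2 R) \<Longrightarrow> U [^]\<^bsub>SL2 R\<^esub> m \<in> B \<Longrightarrow> V \<in> B \<Longrightarrow> \<ominus>\<^bsub>M\<^esub> \<one>\<^bsub>M\<^esub> \<in> B \<Longrightarrow>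
       few_cosets (SL2 R) \<Gamma> B p"
    and nc: "tr (U \<otimes>\<^bsub>M\<^esub> V \<otimes>\<^bsub>M\<^esub> adj U \<otimes>\<^bsub>M\<^esub> adj V) \<noteq> \<one> \<oplus> \<one>"
  shows "V \<otimes>\<^bsub>M\<^esub> U \<otimes>\<^bsub>M\<^esub> adj V = adj U"
proof -
  interpret G: group "SL2 R" by (rule SL2_group)
  define z where "z = \<ominus>\<^bsub>M\<^esub> \<one>\<^bsub>M\<^esub>"
  note mult = SL2_sel(2)
  have GM: "A \<in> carrier M" "dt A = \<one>" if "A \<in> carrier (SL2 R)" for A
    using that by (simp_all add: SL2_sel)
  have ginv: "inv\<^bsub>SL2 R\<^esub> A = adj A" if "A \<in> carrier (SL2 R)" for A using SL2_inv[OF that] .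
  have z: "z \<in> carrier (SL2 R)" by (simp add: z_def SL2_sel dt_uminus)
  have zz: "z \<otimes>\<^bsub>SL2 R\<^esub> z = \<one>\<^bsub>SL2 R\<^esub>" by (simp add: z_def SL2_sel M.l_minus)
  have z1: "z \<noteq> \<one>\<^bsub>SL2 R\<^esub>" using minus_one_ne[OF two] by (simp add: z_def SL2_sel)
  have zc: "z \<otimes>\<^bsub>SL2 R\<^esub> A = A \<otimes>\<^bsub>SL2 R\<^esub> z" if "A \<in> carrier (SL2 R)" for A
    using GM[OF that] by (simp add: z_def mult M.l_minus M.r_minus)
  have scalar: "A \<in> range sc \<longleftrightarrow> A \<in> {\<one>\<^bsub>SL2 R\<^esub>, z}" if "A \<in> carrier (SL2 R)" for A
    using scalar_det_one[of A] GM[OF that] by (auto simp: z_def SL2_sel sc_one[symmetric] sc_uminus[symmetric])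
  have ord': "U [^]\<^bsub>SL2 R\<^esub> j \<in> {\<one>\<^bsub>SL2 R\<^esub>, z} \<longleftrightarrow> m dvd j" for j :: nat
    using ord[of j] by (simp add: z_def SL2_sel)
  have gen: "{U, V, z} \<subseteq> carrier (SL2 R)" using U V z by simp
  have \<Gamma>_eq: "\<Gamma> = generate (SL2 R) {U, V, z}" by (simp add: \<Gamma>_def z_def)
  have \<Gamma>: "subgroup \<Gamma> (SL2 R)" unfolding \<Gamma>_eq by (rule G.generate_is_subgroup[OF gen])
  have in\<Gamma>: "U \<in> \<Gamma>" "V \<in> \<Gamma>" "z \<in> \<Gamma>" unfolding \<Gamma>_eq by (auto intro: generate.incl)
  have \<Gamma>c: "g \<in> carrier (SL2 R)" if "g \<in> \<Gamma>" for g using \<Gamma> that by (rule subgroup.mem_carrier)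
  have Um: "U [^]\<^bsub>SL2 R\<^esub> m \<in> {\<one>\<^bsub>SL2 R\<^esub>, z}" using ord'[of m] by simp
  have few': "few_cosets (SL2 R) \<Gamma> B p" if "subgroup B (SL2 R)" "V \<in> B" "z \<in> B" for B
    using few[OF that(1) _ that(2)] that Um subgroup.one_closed[OF that(1)] by (auto simp: z_def)
  have p0: "p > 2" using m by simp

  have noncomm: "U \<otimes>\<^bsub>SL2 R\<^esub> V \<noteq> V \<otimes>\<^bsub>SL2 R\<^esub> U"
  proof
    assume "U \<otimes>\<^bsub>SL2 R\<^esub> V = V \<otimes>\<^bsub>SL2 R\<^esub> U"
    then have "U \<otimes>\<^bsub>SL2 R\<^esub> V \<otimes>\<^bsub>SL2 R\<^esub> inv\<^bsub>SL2 R\<^esub> U \<otimes>\<^bsub>SL2 R\<^esub> inv\<^bsub>SL2 R\<^esub> V = \<one>\<^bsub>SL2 R\<^esub>"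
      using U V by (simp add: G.m_assoc)
    then show False using nc by (simp add: mult ginv U V SL2_sel(3)) (simp add: sc_one[symmetric] tr_sc)
  qed
  have Vns: "V \<notin> range sc" using noncomm scalar[OF V] zc[OF U] U by auto
  have U2ns: "U \<otimes>\<^bsub>M\<^esub> U \<notin> range sc"
  proof -
    have "U \<otimes>\<^bsub>SL2 R\<^esub> U = U [^]\<^bsub>SL2 R\<^esub> (2::nat)" using U by (simp add: numeral_2_eq_2)
    moreover have "\<not> m dvd 2" using m by (auto dest: dvd_imp_le)
    ultimately show ?thesis using ord'[of 2] scalar[of "U \<otimes>\<^bsub>SL2 R\<^esub> U"] U by (simp add: mult)
  qed

  \<comment> \<open>Some power of the conjugate \<open>g = U V U\<^sup>-\<^sup>1\<close> commutes with \<open>V\<close>.  If that power is not a scalar,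
    transitivity of commuting gives \<open>g V = V g\<close>, which the trace of the commutator excludes.\<close>
  obtain j where j: "0 < j" "j < p" "V [^]\<^bsub>SL2 R\<^esub> (j::nat) \<in> {\<one>\<^bsub>SL2 R\<^esub>, z}"
  proof (rule ccontr)
    assume "\<not> thesis"
    then have none: "V [^]\<^bsub>SL2 R\<^esub> j \<notin> {\<one>\<^bsub>SL2 R\<^esub>, z}" if "0 < j" "j < p" for j :: nat
      using that \<open>\<And>j. \<lbrakk>0 < j; j < p; V [^]\<^bsub>SL2 R\<^esub> j \<in> {\<one>\<^bsub>SL2 R\<^esub>, z}\<rbrakk> \<Longrightarrow> thesis\<close> by blast
    define g where "g = U \<otimes>\<^bsub>SL2 R\<^esub> V \<otimes>\<^bsub>SL2 R\<^esub> inv\<^bsub>SL2 R\<^esub> U"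
    have g: "g \<in> \<Gamma>" unfolding g_def using in\<Gamma> \<Gamma> subgroup.m_closed subgroup.m_inv_closed by metis
    have "few_cosets (SL2 R) \<Gamma> (G.centr V) p"
      using few'[OF G.centr_subgroup[OF V]] V z zc[OF V] by (simp add: G.centr_def)
    then obtain j where jj: "0 < j" "j < p" "g [^]\<^bsub>SL2 R\<^esub> (j::nat) \<in> G.centr V"
      using G.few_cosets_power[OF _ \<Gamma> G.centr_subgroup[OF V] g] by blast
    define A where "A = V [^]\<^bsub>SL2 R\<^esub> j"
    define A' where "A' = U \<otimes>\<^bsub>SL2 R\<^esub> A \<otimes>\<^bsub>SL2 R\<^esub> inv\<^bsub>SL2 R\<^esub> U"
    have A: "A \<in> carrier (SL2 R)" "A' \<in> carrier (SL2 R)" using U V by (simp_all add: A_def A'_def)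
    have AV: "A \<in> G.centr V"
      unfolding A_def by (rule G.subgroup_pow_closed[OF G.centr_subgroup[OF V]]) (simp add: G.centr_def V)
    have A'V: "A' \<in> G.centr V" using jj(3) G.conj_pow[OF U V, of j] by (simp add: g_def A'_def A_def)
    have A'g: "A' \<in> G.centr g" unfolding A'_def g_def using G.conj_centr_iff[OF U V A(1)] AV by simp
    have "A' \<notin> {\<one>\<^bsub>SL2 R\<^esub>, z}"
    proof
      assume "A' \<in> {\<one>\<^bsub>SL2 R\<^esub>, z}"
      then have "U \<otimes>\<^bsub>SL2 R\<^esub> A = U \<or> U \<otimes>\<^bsub>SL2 R\<^esub> A = U \<otimes>\<^bsub>SL2 R\<^esub> z"
        using G.conj_eq_iff[OF U A(1), of "\<one>\<^bsub>SL2 R\<^esub>"] G.conj_eq_iff[OF U A(1) z] zc[OF U] U by (auto simp: A'_def)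
      then have "A = \<one>\<^bsub>SL2 R\<^esub> \<or> A = z" using U A z by auto
      then show False using none[OF jj(1,2)] by (simp add: A_def)
    qed
    then have "A' \<notin> range sc" using scalar A by simp
    then have "V \<otimes>\<^bsub>M\<^esub> g = g \<otimes>\<^bsub>M\<^esub> V"
      using commute_trans[of A' V g] A'V A'g A(2) V \<Gamma>c[OF g] GM unfolding G.centr_def by (simp add: mult)
    then have "V \<otimes>\<^bsub>M\<^esub> (U \<otimes>\<^bsub>M\<^esub> V \<otimes>\<^bsub>M\<^esub> adj U) = (U \<otimes>\<^bsub>M\<^esub> V \<otimes>\<^bsub>M\<^esub> adj U) \<otimes>\<^bsub>M\<^esub> V"
      by (simp add: g_def mult ginv U)
    then show False
      using tr_commutator_of_commuting_conjugate[OF two GM[OF U] GM[OF V] Vns U2ns] nc by blast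
  qed
  define n where "n = 2 * j"
  have n0: "0 < n" using j by (simp add: n_def)
  have Vn: "V [^]\<^bsub>SL2 R\<^esub> n = \<one>\<^bsub>SL2 R\<^esub>"
  proof -
    have "V [^]\<^bsub>SL2 R\<^esub> n = V [^]\<^bsub>SL2 R\<^esub> j \<otimes>\<^bsub>SL2 R\<^esub> V [^]\<^bsub>SL2 R\<^esub> j"
      using V G.nat_pow_mult[OF V, of j j] by (simp add: n_def mult_2)
    then show ?thesis using j(3) zz by auto
  qed

  \<comment> \<open>The powers of \<open>V\<close> up to sign form a finite subgroup, and few of its cosets cover \<open>\<Gamma>\<close>.\<close>
  have fin: "finite \<Gamma>"
  proof -
    define B where "B = range (\<lambda>i::nat. V [^]\<^bsub>SL2 R\<^esub> i) \<union> range (\<lambda>i::nat. z \<otimes>\<^bsub>SL2 R\<^esub> V [^]\<^bsub>SL2 R\<^esub> i)"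
    note B = G.signed_powers_subgroup[OF V z zz zc[OF V] Vn n0, folded B_def]
    have "V \<in> B" unfolding B_def using V G.nat_pow_eone by (metis UnI1 rangeI)
    moreover have "z \<in> B"
    proof -
      have "z = z \<otimes>\<^bsub>SL2 R\<^esub> V [^]\<^bsub>SL2 R\<^esub> (0::nat)" using z by simp
      then show ?thesis unfolding B_def by blast
    qed
    ultimately obtain F where F: "finite F" "F \<subseteq> carrier (SL2 R)"
      "\<And>g. g \<in> \<Gamma> \<Longrightarrow> \<exists>f\<in>F. g \<otimes>\<^bsub>SL2 R\<^esub> inv\<^bsub>SL2 R\<^esub> f \<in> B"
      using few'[OF B(1)] unfolding few_cosets_def by blast
    have "\<Gamma> \<subseteq> (\<lambda>(b, f). b \<otimes>\<^bsub>SL2 R\<^esub> f) ` (B \<times> F)"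
    proof
      fix g assume g: "g \<in> \<Gamma>"
      then obtain f where f: "f \<in> F" "g \<otimes>\<^bsub>SL2 R\<^esub> inv\<^bsub>SL2 R\<^esub> f \<in> B" using F(3) by blast
      then have "g = (g \<otimes>\<^bsub>SL2 R\<^esub> inv\<^bsub>SL2 R\<^esub> f) \<otimes>\<^bsub>SL2 R\<^esub> f"
        using F(2) \<Gamma>c[OF g] by (auto simp: G.m_assoc)
      then show "g \<in> (\<lambda>(b, f). b \<otimes>\<^bsub>SL2 R\<^esub> f) ` (B \<times> F)" using f by (intro image_eqI) auto
    qed
    then show ?thesis using B(2) F(1) finite_subset by blast
  qed

  \<comment> \<open>The square of an element with coinciding eigenvalues has \<open>p\<close>-th power one, so it lies in the
    subgroup \<open>B\<close>, whose exponent \<open>n = 2j\<close> is prime to \<open>p\<close>; hence the square is one.\<close>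
  have semisimple: "disc g \<noteq> \<zero>" if g: "g \<in> \<Gamma>" and gns: "g \<notin> range sc" for g
  proof
    assume d: "disc g = \<zero>"
    define B where "B = {h \<in> G.centr V. h [^]\<^bsub>SL2 R\<^esub> n = \<one>\<^bsub>SL2 R\<^esub>}"
    have ab: "h \<otimes>\<^bsub>SL2 R\<^esub> k = k \<otimes>\<^bsub>SL2 R\<^esub> h" if "h \<in> G.centr V" "k \<in> G.centr V" for h k
      using that commute_trans[OF GM(1)[OF V] Vns, of h k] GM(1) unfolding G.centr_def by (simp add: mult)
    have B: "subgroup B (SL2 R)"
    proof (rule G.subgroupI)
      show "B \<subseteq> carrier (SL2 R)" by (auto simp: B_def G.centr_def)
      have "\<one>\<^bsub>SL2 R\<^esub> \<in> B" using subgroup.one_closed[OF G.centr_subgroup[OF V]] by (simp add: B_def)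
      then show "B \<noteq> {}" by blast
      fix h assume h: "h \<in> B"
      then have "h \<in> carrier (SL2 R)" by (auto simp: B_def G.centr_def)
      then show "inv\<^bsub>SL2 R\<^esub> h \<in> B"
        using h subgroup.m_inv_closed[OF G.centr_subgroup[OF V]] by (auto simp: B_def G.nat_pow_inv)
    next
      fix h k assume h: "h \<in> B" and k: "k \<in> B"
      then have c: "h \<in> carrier (SL2 R)" "k \<in> carrier (SL2 R)" by (auto simp: B_def G.centr_def)
      have hk: "h \<otimes>\<^bsub>SL2 R\<^esub> k = k \<otimes>\<^bsub>SL2 R\<^esub> h" using ab h k by (auto simp: B_def)
      have "(h \<otimes>\<^bsub>SL2 R\<^esub> k) [^]\<^bsub>SL2 R\<^esub> n = \<one>\<^bsub>SL2 R\<^esub>"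
        using G.pow_mult_distrib[OF hk c, of n] h k by (simp add: B_def)
      then show "h \<otimes>\<^bsub>SL2 R\<^esub> k \<in> B"
        using h k subgroup.m_closed[OF G.centr_subgroup[OF V]] by (auto simp: B_def)
    qed
    have "z [^]\<^bsub>SL2 R\<^esub> n = \<one>\<^bsub>SL2 R\<^esub>"
      using zz G.nat_pow_pow[OF z, of 2 j] z by (simp add: n_def numeral_2_eq_2)
    then have zB: "z \<in> B" using z zc[OF V] by (simp add: B_def G.centr_def)
    have VB: "V \<in> B" using V Vn by (simp add: B_def G.centr_def)
    define h where "h = g \<otimes>\<^bsub>SL2 R\<^esub> g"
    have gc: "g \<in> carrier (SL2 R)" using \<Gamma>c[OF g] .
    have h: "h \<in> \<Gamma>" unfolding h_def using subgroup.m_closed[OF \<Gamma> g g] .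
    have hp: "h [^]\<^bsub>SL2 R\<^esub> p = \<one>\<^bsub>SL2 R\<^esub>"
      using disc_zero_pow[OF GM[OF gc] d p(2)] by (simp add: h_def SL2_pow mult SL2_sel(3))
    have "h \<in> B"
      using G.few_cosets_prime_power_mem[OF few'[OF B VB zB] \<Gamma> B h p(1)] hp subgroup.one_closed[OF B] by simp
    then have hn: "h [^]\<^bsub>SL2 R\<^esub> n = \<one>\<^bsub>SL2 R\<^esub>" by (simp add: B_def)
    have "\<not> p dvd n"
    proof
      assume "p dvd n"
      then have "p dvd 2 \<or> p dvd j" using p(1) by (simp add: n_def prime_dvd_mult_iff)
      then show False using p0 j(1,2) by (auto dest: dvd_imp_le)
    qed
    then have "coprime n p" using p(1) prime_imp_coprime[of p n] by (simp add: coprime_commute)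
    then have "h \<in> {\<one>\<^bsub>SL2 R\<^esub>}"
      using G.coprime_powers_mem[OF G.triv_subgroup \<Gamma>c[OF h], of n p] hn hp n0 by simp
    then have "g \<otimes>\<^bsub>M\<^esub> g = \<one>\<^bsub>M\<^esub>" by (simp add: h_def mult SL2_sel(3))
    then show False using disc_zero_square_one[OF two GM[OF gc] d] gns by simp
  qed

  define H where "H = (SL2 R)\<lparr>carrier := \<Gamma>\<rparr>"
  interpret H: group H unfolding H_def by (rule G.subgroup_imp_group[OF \<Gamma>])
  have Hs: "carrier H = \<Gamma>" "A \<otimes>\<^bsub>H\<^esub> B = A \<otimes>\<^bsub>SL2 R\<^esub> B" "\<one>\<^bsub>H\<^esub> = \<one>\<^bsub>SL2 R\<^esub>" for A B
    by (simp_all add: H_def)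
  have Hinv: "inv\<^bsub>H\<^esub> g = adj g" if "g \<in> \<Gamma>" for g
    unfolding H_def using G.m_inv_consistent[OF \<Gamma> that] ginv[OF \<Gamma>c[OF that]] by simp
  have Hcentr: "H.centr a = {g \<in> \<Gamma>. g \<otimes>\<^bsub>M\<^esub> a = a \<otimes>\<^bsub>M\<^esub> g}" for a
    by (simp add: H.centr_def Hs mult)
  have ns: "a \<notin> range sc" if "a \<in> carrier H - {\<one>\<^bsub>SL2 R\<^esub>, z}" for a
    using that scalar[of a] \<Gamma>c by (simp add: Hs)
  interpret H: centralizer_partition H "{\<one>\<^bsub>SL2 R\<^esub>, z}"
  proof (rule centralizer_partition.intro[OF H.group_axioms], rule centralizer_partition_axioms.intro)
    show "finite (carrier H)" using fin by (simp add: Hs)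
    show "subgroup {\<one>\<^bsub>SL2 R\<^esub>, z} H"
    proof (rule H.subgroupI)
      show "{\<one>\<^bsub>SL2 R\<^esub>, z} \<subseteq> carrier H" using in\<Gamma> subgroup.one_closed[OF \<Gamma>] by (simp add: Hs)
    next
      fix a assume "a \<in> {\<one>\<^bsub>SL2 R\<^esub>, z}"
      moreover have "inv\<^bsub>H\<^esub> z = z" using zz in\<Gamma> by (intro H.inv_equality) (simp_all add: Hs)
      moreover have "inv\<^bsub>H\<^esub> \<one>\<^bsub>SL2 R\<^esub> = \<one>\<^bsub>SL2 R\<^esub>" using H.inv_one by (simp add: Hs)
      ultimately show "inv\<^bsub>H\<^esub> a \<in> {\<one>\<^bsub>SL2 R\<^esub>, z}" by auto
    next
      fix a b assume "a \<in> {\<one>\<^bsub>SL2 R\<^esub>, z}" "b \<in> {\<one>\<^bsub>SL2 R\<^esub>, z}"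
      then show "a \<otimes>\<^bsub>H\<^esub> b \<in> {\<one>\<^bsub>SL2 R\<^esub>, z}" using z zz by (auto simp: Hs)
    qed simp
    show "card {\<one>\<^bsub>SL2 R\<^esub>, z} = 2" using z1 by simp
    show "c \<otimes>\<^bsub>H\<^esub> g = g \<otimes>\<^bsub>H\<^esub> c" if "c \<in> {\<one>\<^bsub>SL2 R\<^esub>, z}" "g \<in> carrier H" for c g
      using that zc[of g] \<Gamma>c[of g] by (auto simp: Hs)
    show "b \<otimes>\<^bsub>H\<^esub> c = c \<otimes>\<^bsub>H\<^esub> b" if "a \<in> carrier H - {\<one>\<^bsub>SL2 R\<^esub>, z}" "b \<in> H.centr a" "c \<in> H.centr a" for a b c
      using that ns[OF that(1)] commute_trans[of a b c] GM(1)[of a] GM(1)[of b] GM(1)[of c]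
        \<Gamma>c[of a] \<Gamma>c[of b] \<Gamma>c[of c] unfolding Hcentr Hs mult by simp
    fix a g assume a: "a \<in> carrier H - {\<one>\<^bsub>SL2 R\<^esub>, z}" and g: "g \<in> carrier H"
      and c: "g \<otimes>\<^bsub>H\<^esub> a \<otimes>\<^bsub>H\<^esub> inv\<^bsub>H\<^esub> g \<in> H.centr a"
    have ag: "a \<in> \<Gamma>" "g \<in> \<Gamma>" using a g by (simp_all add: Hs)
    note aM = GM[OF \<Gamma>c[OF ag(1)]] and gM = GM[OF \<Gamma>c[OF ag(2)]]
    define b where "b = g \<otimes>\<^bsub>M\<^esub> a \<otimes>\<^bsub>M\<^esub> adj g"
    have b: "g \<otimes>\<^bsub>H\<^esub> a \<otimes>\<^bsub>H\<^esub> inv\<^bsub>H\<^esub> g = b" using ag by (simp add: b_def Hs mult Hinv)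
    have "tr b = tr (adj g \<otimes>\<^bsub>M\<^esub> (g \<otimes>\<^bsub>M\<^esub> a))" using aM gM by (simp add: b_def tr_mult_commute[of "adj g"])
    also have "\<dots> = tr a" using aM gM by (simp add: M.m_assoc[symmetric] adj_times sc_one)
    finally have "tr b = tr a" .
    moreover have "b \<in> carrier M" "dt b = \<one>" using aM gM by (simp_all add: b_def dt_mult)
    moreover have "a \<otimes>\<^bsub>M\<^esub> b = b \<otimes>\<^bsub>M\<^esub> a" using c unfolding b Hcentr by simp
    ultimately have "b = a \<or> b = adj a"
      using commuting_same_trace[OF two aM ns[OF a] semisimple[OF ag(1) ns[OF a]]] by simp
    then show "g \<otimes>\<^bsub>H\<^esub> a \<otimes>\<^bsub>H\<^esub> inv\<^bsub>H\<^esub> g = a \<or> g \<otimes>\<^bsub>H\<^esub> a \<otimes>\<^bsub>H\<^esub> inv\<^bsub>H\<^esub> g = inv\<^bsub>H\<^esub> a"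
      unfolding b using Hinv[OF ag(1)] by simp
  qed

  have UH: "U \<in> carrier H - {\<one>\<^bsub>SL2 R\<^esub>, z}"
  proof -
    have "\<not> m dvd 1" using m by simp
    then show ?thesis using ord'[of 1] in\<Gamma> U by (simp add: Hs)
  qed
  \<comment> \<open>The \<open>2m\<close> elements \<open>\<plusminus>U\<^sup>i\<close> with \<open>i < m\<close> are distinct because \<open>U\<close> has order \<open>m\<close> modulo
    scalars.\<close>
  have "14 \<le> card (H.centr U)"
  proof -
    let ?f = "\<lambda>(s, i). s \<otimes>\<^bsub>SL2 R\<^esub> U [^]\<^bsub>SL2 R\<^esub> (i::nat)"
    have zinv: "inv\<^bsub>SL2 R\<^esub> z = z" using zz z by (intro G.inv_equality)
    have le: "i = l" if eq: "s \<otimes>\<^bsub>SL2 R\<^esub> U [^]\<^bsub>SL2 R\<^esub> i = s' \<otimes>\<^bsub>SL2 R\<^esub> U [^]\<^bsub>SL2 R\<^esub> l"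
        and s: "s \<in> {\<one>\<^bsub>SL2 R\<^esub>, z}" "s' \<in> {\<one>\<^bsub>SL2 R\<^esub>, z}" and il: "i \<le> l" "l < m" for s s' and i l :: nat
    proof -
      have sc: "s \<in> carrier (SL2 R)" "s' \<in> carrier (SL2 R)" using s z by auto
      have "U [^]\<^bsub>SL2 R\<^esub> l = U [^]\<^bsub>SL2 R\<^esub> (l - i) \<otimes>\<^bsub>SL2 R\<^esub> U [^]\<^bsub>SL2 R\<^esub> i"
        using il U by (simp add: G.nat_pow_mult)
      then have "s = s' \<otimes>\<^bsub>SL2 R\<^esub> U [^]\<^bsub>SL2 R\<^esub> (l - i)"
        using eq sc U by (simp add: G.m_assoc[symmetric])
      then have "s' \<otimes>\<^bsub>SL2 R\<^esub> s = U [^]\<^bsub>SL2 R\<^esub> (l - i)"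
        using s sc U zz by (auto simp: G.m_assoc[symmetric])
      then have "U [^]\<^bsub>SL2 R\<^esub> (l - i) \<in> {\<one>\<^bsub>SL2 R\<^esub>, z}" using s z zz by auto
      then have "m dvd l - i" using ord' by blast
      then show ?thesis using il by (metis dvd_imp_le diff_is_0_eq le_antisym less_imp_diff_less linorder_not_le neq0_conv)
    qed
    have inj: "inj_on ?f ({\<one>\<^bsub>SL2 R\<^esub>, z} \<times> {..<m})"
    proof (rule inj_onI)
      fix u w assume u: "u \<in> {\<one>\<^bsub>SL2 R\<^esub>, z} \<times> {..<m}" and w: "w \<in> {\<one>\<^bsub>SL2 R\<^esub>, z} \<times> {..<m}" and eq: "?f u = ?f w"
      obtain s i s' l where uw: "u = (s, i)" "w = (s', l)" by (cases u, cases w)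
      have il: "i = l"
        using le[of s i s' l] le[of s' l s i] u w eq uw by (cases "i \<le> l") auto
      have "s \<in> carrier (SL2 R)" "s' \<in> carrier (SL2 R)" using u w uw z by auto
      then have "s = s'" using eq uw il U by simp
      then show "u = w" using uw il by simp
    qed
    have sub: "?f ` ({\<one>\<^bsub>SL2 R\<^esub>, z} \<times> {..<m}) \<subseteq> H.centr U"
    proof (rule image_subsetI)
      fix u assume u: "u \<in> {\<one>\<^bsub>SL2 R\<^esub>, z} \<times> {..<m}"
      obtain s i where si: "u = (s, i)" by (cases u)
      then have s: "s \<in> \<Gamma>" "s \<in> H.centr U"
        using u in\<Gamma> subgroup.one_closed[OF \<Gamma>] zc[OF U] U by (auto simp: H.centr_def Hs)
      have Ui: "U [^]\<^bsub>H\<^esub> i = U [^]\<^bsub>SL2 R\<^esub> i" by (simp add: H_def nat_pow_def)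
      have UC: "subgroup (H.centr U) H" using UH by (intro H.centr_subgroup) simp
      have "U [^]\<^bsub>H\<^esub> i \<in> H.centr U"
        by (rule H.subgroup_pow_closed[OF UC]) (use UH in \<open>simp add: H.centr_def\<close>)
      then have "s \<otimes>\<^bsub>H\<^esub> U [^]\<^bsub>H\<^esub> i \<in> H.centr U" using s subgroup.m_closed[OF UC] by blast
      then show "?f u \<in> H.centr U" by (simp add: si Ui Hs)
    qed
    have "finite (H.centr U)" using fin finite_subset[of "H.centr U" \<Gamma>] by (auto simp: Hcentr)
    then have "card ({\<one>\<^bsub>SL2 R\<^esub>, z} \<times> {..<m}) \<le> card (H.centr U)"
      by (rule card_inj_on_le[OF inj sub])
    moreover have "card ({\<one>\<^bsub>SL2 R\<^esub>, z} \<times> {..<m}) = 2 * m" using z1 by (simp add: card_cartesian_product)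
    ultimately show ?thesis using m by simp
  qed
  then have c: "V \<otimes>\<^bsub>H\<^esub> U \<otimes>\<^bsub>H\<^esub> inv\<^bsub>H\<^esub> V \<in> H.centr U"
    using H.large_centralizer_normal[OF UH] in\<Gamma> by (simp add: Hs)
  then have "V \<otimes>\<^bsub>H\<^esub> U \<otimes>\<^bsub>H\<^esub> inv\<^bsub>H\<^esub> V = U \<or> V \<otimes>\<^bsub>H\<^esub> U \<otimes>\<^bsub>H\<^esub> inv\<^bsub>H\<^esub> V = inv\<^bsub>H\<^esub> U"
    using H.conj_cases[OF UH] in\<Gamma> by (simp add: Hs)
  moreover have "V \<otimes>\<^bsub>H\<^esub> U \<otimes>\<^bsub>H\<^esub> inv\<^bsub>H\<^esub> V \<noteq> U"
    using H.conj_eq_iff[of V U U] in\<Gamma> noncomm by (simp add: Hs)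
  ultimately show ?thesis using in\<Gamma> by (simp add: Hinv Hs mult)
qed

end

section \<open>Reduction of matrices\<close>

context ring_hom_cring
begin

abbreviation f where "f \<equiv> mat2_map h"
abbreviation MR where "MR \<equiv> mat2_ring R"
abbreviation MS where "MS \<equiv> mat2_ring S"

lemma map_closed [simp]: "A \<in> carrier MR \<Longrightarrow> f A \<in> carrier MS"
  by (cases A) (auto simp: mat2_map_def mat2_sel)

lemma map_mult [simp]:
  "A \<in> carrier MR \<Longrightarrow> B \<in> carrier MR \<Longrightarrow> f (A \<otimes>\<^bsub>MR\<^esub> B) = f A \<otimes>\<^bsub>MS\<^esub> f B"
  by (cases A, cases B) (auto simp: mat2_map_def mat2_sel)

lemma map_add [simp]:
  "A \<in> carrier MR \<Longrightarrow> B \<in> carrier MR \<Longrightarrow> f (A \<oplus>\<^bsub>MR\<^esub> B) = f A \<oplus>\<^bsub>MS\<^esub> f B"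
  by (cases A, cases B) (auto simp: mat2_map_def mat2_sel)

lemma map_one [simp]: "f \<one>\<^bsub>MR\<^esub> = \<one>\<^bsub>MS\<^esub>"
  by (simp add: mat2_map_def mat2_sel)

lemma map_zero [simp]: "f \<zero>\<^bsub>MR\<^esub> = \<zero>\<^bsub>MS\<^esub>"
  by (simp add: mat2_map_def mat2_sel)

lemma map_uminus [simp]: "A \<in> carrier MR \<Longrightarrow> f (\<ominus>\<^bsub>MR\<^esub> A) = \<ominus>\<^bsub>MS\<^esub> f A"
  by (cases A) (auto simp: mat2_map_def mat2_sel R.mat_uminus S.mat_uminus)

lemma map_minus [simp]:
  "A \<in> carrier MR \<Longrightarrow> B \<in> carrier MR \<Longrightarrow> f (A \<ominus>\<^bsub>MR\<^esub> B) = f A \<ominus>\<^bsub>MS\<^esub> f B"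
  by (simp add: R.M.minus_eq S.M.minus_eq)

lemma map_sc [simp]: "r \<in> carrier R \<Longrightarrow> f (mat_scal R r) = mat_scal S (h r)"
  by (simp add: mat2_map_def mat_scal_def)

lemma map_adj [simp]: "A \<in> carrier MR \<Longrightarrow> f (mat_adj R A) = mat_adj S (f A)"
  by (cases A) (auto simp: mat2_map_def mat2_sel mat_fun_sel)

lemma map_tr: "A \<in> carrier MR \<Longrightarrow> mat_trace S (f A) = h (mat_trace R A)"
  by (cases A) (auto simp: mat2_map_def mat2_sel mat_fun_sel)

lemma map_dt: "A \<in> carrier MR \<Longrightarrow> mat_det S (f A) = h (mat_det R A)"
  by (cases A) (auto simp: mat2_map_def mat2_sel mat_fun_sel R.minus_eq S.minus_eq)

lemma map_disc: "A \<in> carrier MR \<Longrightarrow> S.disc (f A) = h (R.disc A)"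
  by (simp add: R.disc_def S.disc_def map_tr R.minus_eq S.minus_eq)

lemma map_pow [simp]: "A \<in> carrier MR \<Longrightarrow> f (A [^]\<^bsub>MR\<^esub> (n::nat)) = f A [^]\<^bsub>MS\<^esub> n"
  by (induction n) auto

lemma map_gen_alg: "U \<in> carrier MR \<Longrightarrow> A \<in> R.gen_alg U \<Longrightarrow> f A \<in> S.gen_alg (f U)"
  by (clarsimp simp: R.gen_alg_def) (rule S.gen_algI[OF hom_closed hom_closed], simp_all)

lemma map_SL2: "A \<in> carrier (SL2 R) \<Longrightarrow> f A \<in> carrier (SL2 S)"
  by (simp add: R.SL2_sel S.SL2_sel map_dt)

lemma SL2_group_hom: "group_hom (SL2 R) (SL2 S) f"
  by (intro group_hom.intro group_hom_axioms.intro R.SL2_group S.SL2_group homI)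
    (simp_all add: map_SL2, simp_all add: R.SL2_sel S.SL2_sel)

end

lemma few_cosets_image:
  assumes "group_hom G H \<phi>" and \<Gamma>: "\<Gamma> \<subseteq> carrier G"
    and few: "few_cosets G \<Gamma> {g \<in> carrier G. \<phi> g \<in> B} n"
  shows "few_cosets H (\<phi> ` \<Gamma>) B n"
proof -
  interpret group_hom G H \<phi> by fact
  obtain F where F: "finite F" "card F < n" "F \<subseteq> carrier G"
    "\<And>z. z \<in> \<Gamma> \<Longrightarrow> \<exists>f\<in>F. z \<otimes>\<^bsub>G\<^esub> inv\<^bsub>G\<^esub> f \<in> {g \<in> carrier G. \<phi> g \<in> B}"
    using few unfolding few_cosets_def by blast
  have "\<exists>w\<in>\<phi> ` F. \<phi> z \<otimes>\<^bsub>H\<^esub> inv\<^bsub>H\<^esub> w \<in> B" if z: "z \<in> \<Gamma>" for z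
  proof -
    obtain w where w: "w \<in> F" "\<phi> (z \<otimes>\<^bsub>G\<^esub> inv\<^bsub>G\<^esub> w) \<in> B" using F(4)[OF z] by blast
    moreover have "z \<in> carrier G" "w \<in> carrier G" using w z \<Gamma> F(3) by blast+
    ultimately show ?thesis by auto
  qed
  then show ?thesis unfolding few_cosets_def
    using F card_image_le[OF F(1), of \<phi>] by (intro exI[of _ "\<phi> ` F"]) auto
qed

lemma (in group_hom) preimage_subgroup:
  assumes "subgroup B H" shows "subgroup {g \<in> carrier G. h g \<in> B} G"
  by (rule G.subgroupI) (use assms subgroup.one_closed[OF assms] in
    \<open>auto intro: subgroup.m_closed subgroup.m_inv_closed exI[of _ "\<one>\<^bsub>G\<^esub>"]\<close>)

context cring
begin

text \<open>
  The matrix \<open>A - adj A\<close> has trace zero, and its square is the scalar given by the square of the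
  difference of the eigenvalues of \<open>A\<close>.
\<close>
lemma self_minus_adj_square:
  assumes "A \<in> carrier M" "dt A = \<one>"
  shows "(A \<ominus>\<^bsub>M\<^esub> adj A) \<otimes>\<^bsub>M\<^esub> (A \<ominus>\<^bsub>M\<^esub> adj A) = sc (disc A)"
proof -
  have "A \<otimes>\<^bsub>M\<^esub> A = sc (tr A) \<otimes>\<^bsub>M\<^esub> A \<ominus>\<^bsub>M\<^esub> \<one>\<^bsub>M\<^esub>" using cayley_hamilton[OF assms] .
  moreover have "adj A \<otimes>\<^bsub>M\<^esub> adj A = sc (tr A) \<otimes>\<^bsub>M\<^esub> adj A \<ominus>\<^bsub>M\<^esub> \<one>\<^bsub>M\<^esub>"
    using cayley_hamilton[of "adj A"] assms by simp
  moreover have "(A \<ominus>\<^bsub>M\<^esub> adj A) \<otimes>\<^bsub>M\<^esub> (A \<ominus>\<^bsub>M\<^esub> adj A) =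
      A \<otimes>\<^bsub>M\<^esub> A \<ominus>\<^bsub>M\<^esub> \<one>\<^bsub>M\<^esub> \<ominus>\<^bsub>M\<^esub> \<one>\<^bsub>M\<^esub> \<oplus>\<^bsub>M\<^esub> adj A \<otimes>\<^bsub>M\<^esub> adj A"
    using assms by (simp add: M.minus_eq M.l_distr M.r_distr M.l_minus M.r_minus mult_adj adj_times sc_one M.a_assoc M.minus_add)
  ultimately have "(A \<ominus>\<^bsub>M\<^esub> adj A) \<otimes>\<^bsub>M\<^esub> (A \<ominus>\<^bsub>M\<^esub> adj A) =
      (sc (tr A) \<otimes>\<^bsub>M\<^esub> A \<oplus>\<^bsub>M\<^esub> sc (tr A) \<otimes>\<^bsub>M\<^esub> adj A) \<ominus>\<^bsub>M\<^esub> (\<one>\<^bsub>M\<^esub> \<oplus>\<^bsub>M\<^esub> \<one>\<^bsub>M\<^esub> \<oplus>\<^bsub>M\<^esub> \<one>\<^bsub>M\<^esub> \<oplus>\<^bsub>M\<^esub> \<one>\<^bsub>M\<^esub>)"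
    using assms by (simp add: M.minus_eq M.minus_add M.a_ac)
  also have "sc (tr A) \<otimes>\<^bsub>M\<^esub> A \<oplus>\<^bsub>M\<^esub> sc (tr A) \<otimes>\<^bsub>M\<^esub> adj A = sc (tr A \<otimes> tr A)"
    using assms by (simp add: M.r_distr[symmetric] add_adj sc_mult)
  also have "\<one>\<^bsub>M\<^esub> \<oplus>\<^bsub>M\<^esub> \<one>\<^bsub>M\<^esub> \<oplus>\<^bsub>M\<^esub> \<one>\<^bsub>M\<^esub> \<oplus>\<^bsub>M\<^esub> \<one>\<^bsub>M\<^esub> = sc (\<one> \<oplus> \<one> \<oplus> \<one> \<oplus> \<one>)"
    by (simp add: sc_add sc_one)
  finally show ?thesis using assms by (simp add: disc_def minus_eq M.minus_eq sc_add sc_uminus)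
qed

end

lemma (in domain) self_minus_adj_cancel:
  assumes A: "A \<in> carrier M" "dt A = \<one>" "disc A \<noteq> \<zero>"
    and B: "B \<in> carrier M" "(A \<ominus>\<^bsub>M\<^esub> adj A) \<otimes>\<^bsub>M\<^esub> B = \<zero>\<^bsub>M\<^esub>"
  shows "B = \<zero>\<^bsub>M\<^esub>"
proof -
  have "(A \<ominus>\<^bsub>M\<^esub> adj A) \<otimes>\<^bsub>M\<^esub> ((A \<ominus>\<^bsub>M\<^esub> adj A) \<otimes>\<^bsub>M\<^esub> B) = \<zero>\<^bsub>M\<^esub>" using B A by simp
  then have "sc (disc A) \<otimes>\<^bsub>M\<^esub> B = \<zero>\<^bsub>M\<^esub>"
    using A B(1) by (simp add: M.m_assoc[symmetric] self_minus_adj_square)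
  then show ?thesis using mat_sc_mult_zero[OF _ A(3) B(1)] A(1) by simp
qed

section \<open>Groups defined by conditions on coordinates\<close>

context cyclic_frame
begin

text \<open>
  The coordinates are quantified existentially because they are unique only when \<open>q\<close> is
  nonzero.
\<close>
definition frame_set :: "('a mat2 \<Rightarrow> 'a mat2 \<Rightarrow> bool) \<Rightarrow> 'a mat2 set" where
  "frame_set P = {g \<in> carrier (SL2 R). \<exists>s\<in>S. \<exists>t\<in>S. g = elt s t \<and> P s t}"

text \<open>The hypotheses are the formulas for products and inverses in coordinates.\<close>
lemma frame_set_subgroup:
  assumes one: "P \<one>\<^bsub>M\<^esub> \<zero>\<^bsub>M\<^esub>"
    and mult: "\<And>s t s' t'. s \<in> S \<Longrightarrow> t \<in> S \<Longrightarrow> s' \<in> S \<Longrightarrow> t' \<in> S \<Longrightarrow> P s t \<Longrightarrow> P s' t' \<Longrightarrow>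
       P (s \<otimes>\<^bsub>M\<^esub> s' \<oplus>\<^bsub>M\<^esub> sc q \<otimes>\<^bsub>M\<^esub> (t \<otimes>\<^bsub>M\<^esub> adj t')) (s \<otimes>\<^bsub>M\<^esub> t' \<oplus>\<^bsub>M\<^esub> t \<otimes>\<^bsub>M\<^esub> adj s')"
    and inv: "\<And>s t. s \<in> S \<Longrightarrow> t \<in> S \<Longrightarrow> P s t \<Longrightarrow> P (adj s) (\<ominus>\<^bsub>M\<^esub> t)"
  shows "subgroup (frame_set P) (SL2 R)"
proof -
  interpret G: group "SL2 R" by (rule SL2_group)
  show ?thesis
  proof (rule G.subgroupI)
    show "frame_set P \<subseteq> carrier (SL2 R)" by (auto simp: frame_set_def)
    have "\<one>\<^bsub>SL2 R\<^esub> \<in> frame_set P"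
      using one G.one_closed elt_zero[of "\<one>\<^bsub>M\<^esub>"] unfolding frame_set_def
      by (intro CollectI conjI bexI[of _ "\<one>\<^bsub>M\<^esub>"] bexI[of _ "\<zero>\<^bsub>M\<^esub>"]) (simp_all add: SL2_sel(3))
    then show "frame_set P \<noteq> {}" by blast
  next
    fix g assume "g \<in> frame_set P"
    then obtain s t where *: "g \<in> carrier (SL2 R)" "s \<in> S" "t \<in> S" "g = elt s t" "P s t"
      by (auto simp: frame_set_def)
    then have "inv\<^bsub>SL2 R\<^esub> g = elt (adj s) (\<ominus>\<^bsub>M\<^esub> t)" using adj_elt by (simp add: SL2_inv)
    then show "inv\<^bsub>SL2 R\<^esub> g \<in> frame_set P"
      using * inv[of s t] G.inv_closed[of g] unfolding frame_set_def
      by (intro CollectI conjI bexI[of _ "adj s"] bexI[of _ "\<ominus>\<^bsub>M\<^esub> t"]) simp_all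
  next
    fix g g' assume "g \<in> frame_set P" "g' \<in> frame_set P"
    then obtain s t s' t' where *: "g \<in> carrier (SL2 R)" "s \<in> S" "t \<in> S" "g = elt s t" "P s t"
      "g' \<in> carrier (SL2 R)" "s' \<in> S" "t' \<in> S" "g' = elt s' t'" "P s' t'"
      by (auto simp: frame_set_def)
    have e: "g \<otimes>\<^bsub>SL2 R\<^esub> g' = elt (s \<otimes>\<^bsub>M\<^esub> s' \<oplus>\<^bsub>M\<^esub> sc q \<otimes>\<^bsub>M\<^esub> (t \<otimes>\<^bsub>M\<^esub> adj t')) (s \<otimes>\<^bsub>M\<^esub> t' \<oplus>\<^bsub>M\<^esub> t \<otimes>\<^bsub>M\<^esub> adj s')"
      using * by (simp add: SL2_sel(2) elt_mult)
    let ?s = "s \<otimes>\<^bsub>M\<^esub> s' \<oplus>\<^bsub>M\<^esub> sc q \<otimes>\<^bsub>M\<^esub> (t \<otimes>\<^bsub>M\<^esub> adj t')" and ?t = "s \<otimes>\<^bsub>M\<^esub> t' \<oplus>\<^bsub>M\<^esub> t \<otimes>\<^bsub>M\<^esub> adj s'"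
    have "?s \<in> S" "?t \<in> S" "P ?s ?t" using * mult by simp_all
    then show "g \<otimes>\<^bsub>SL2 R\<^esub> g' \<in> frame_set P"
      using e G.m_closed[of g g'] *(1,6) unfolding frame_set_def by blast
  qed
qed

lemma frame_set_S: "s \<in> S \<Longrightarrow> s \<in> carrier (SL2 R) \<Longrightarrow> P s \<zero>\<^bsub>M\<^esub> \<Longrightarrow> s \<in> frame_set P"
  unfolding frame_set_def using elt_zero[of s]
  by (intro CollectI conjI bexI[of _ s] bexI[of _ "\<zero>\<^bsub>M\<^esub>"]) simp_all

lemma frame_setI: "s \<in> S \<Longrightarrow> t \<in> S \<Longrightarrow> g = elt s t \<Longrightarrow> g \<in> carrier (SL2 R) \<Longrightarrow> P s t \<Longrightarrow> g \<in> frame_set P"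
  unfolding frame_set_def by blast

lemma frame_setE:
  assumes "g \<in> frame_set P"
  obtains s t where "s \<in> S" "t \<in> S" "g = elt s t" "P s t" "g \<in> carrier (SL2 R)"
  using assms unfolding frame_set_def by blast

lemma minus_one_SL2: "\<ominus>\<^bsub>M\<^esub> \<one>\<^bsub>M\<^esub> \<in> carrier (SL2 R)"
  by (simp add: SL2_sel dt_uminus)

text \<open>
  For \<open>q = 0\<close> the first coordinate is multiplicative with values in a commutative algebra, so
  commutators have first coordinate one, and elements of that kind commute.
\<close>
lemma solvable_triangular:
  assumes q0: "q = \<zero>" and U1: "U \<in> carrier (SL2 R)" and a: "a \<in> S" and V: "elt a \<one>\<^bsub>M\<^esub> \<in> carrier (SL2 R)"
  shows "solvable_seq (SL2 R) (generate (SL2 R) {U, elt a \<one>\<^bsub>M\<^esub>, \<ominus>\<^bsub>M\<^esub> \<one>\<^bsub>M\<^esub>})"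
proof -
  interpret G: group "SL2 R" by (rule SL2_group)
  let ?H = "frame_set (\<lambda>s t. True)" and ?K = "frame_set (\<lambda>s t. s = \<one>\<^bsub>M\<^esub>)"
  let ?gens = "{U, elt a \<one>\<^bsub>M\<^esub>, \<ominus>\<^bsub>M\<^esub> \<one>\<^bsub>M\<^esub>}"
  have H: "subgroup ?H (SL2 R)" by (rule frame_set_subgroup) auto
  have K: "subgroup ?K (SL2 R)" by (rule frame_set_subgroup) (auto simp: q0 sc_zero)
  have gens: "?gens \<subseteq> ?H"
    using frame_set_S[of U] frame_set_S[of "\<ominus>\<^bsub>M\<^esub> \<one>\<^bsub>M\<^esub>"] frame_setI[of a "\<one>\<^bsub>M\<^esub>"] U1 a V minus_one_SL2 by simp
  have sub: "generate (SL2 R) ?gens \<subseteq> ?H" by (rule G.generate_subgroup_incl[OF gens H])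
  show ?thesis
  proof (rule G.solvable_seq_metabelian[OF _ K])
    show "subgroup (generate (SL2 R) ?gens) (SL2 R)"
      using U1 V minus_one_SL2 by (intro G.generate_is_subgroup) simp
  next
    fix g h assume "g \<in> generate (SL2 R) ?gens" "h \<in> generate (SL2 R) ?gens"
    then have "g \<in> ?H" "h \<in> ?H" using sub by blast+
    then have cc: "g \<otimes>\<^bsub>SL2 R\<^esub> h \<otimes>\<^bsub>SL2 R\<^esub> inv\<^bsub>SL2 R\<^esub> g \<otimes>\<^bsub>SL2 R\<^esub> inv\<^bsub>SL2 R\<^esub> h \<in> carrier (SL2 R)"
      using subgroup.mem_carrier[OF H] by simp
    from \<open>g \<in> ?H\<close> obtain s t where *: "s \<in> S" "t \<in> S" "g = elt s t" "True" "g \<in> carrier (SL2 R)"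
      by (rule frame_setE)
    obtain s' t' where *: "s \<in> S" "t \<in> S" "g = elt s t" "g \<in> carrier (SL2 R)"
      "s' \<in> S" "t' \<in> S" "h = elt s' t'" "h \<in> carrier (SL2 R)"
      using \<open>h \<in> ?H\<close> * by (elim frame_setE)
    have N: "s \<otimes>\<^bsub>M\<^esub> adj s = \<one>\<^bsub>M\<^esub>" "s' \<otimes>\<^bsub>M\<^esub> adj s' = \<one>\<^bsub>M\<^esub>"
      using elt_adj_mult[of s t] elt_adj_mult[of s' t'] * by (simp_all add: SL2_sel q0 sc_zero sc_one M.minus_eq)
    have first: "s \<otimes>\<^bsub>M\<^esub> s' \<otimes>\<^bsub>M\<^esub> adj s \<otimes>\<^bsub>M\<^esub> adj s' = \<one>\<^bsub>M\<^esub>"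
    proof -
      have "s \<otimes>\<^bsub>M\<^esub> s' \<otimes>\<^bsub>M\<^esub> adj s \<otimes>\<^bsub>M\<^esub> adj s' = s' \<otimes>\<^bsub>M\<^esub> (s \<otimes>\<^bsub>M\<^esub> adj s) \<otimes>\<^bsub>M\<^esub> adj s'"
        using * S_commute[of s s'] by (simp add: M.m_assoc)
      then show ?thesis using * N by simp
    qed
    have "g \<otimes>\<^bsub>SL2 R\<^esub> h \<otimes>\<^bsub>SL2 R\<^esub> inv\<^bsub>SL2 R\<^esub> g \<otimes>\<^bsub>SL2 R\<^esub> inv\<^bsub>SL2 R\<^esub> h =
        elt s t \<otimes>\<^bsub>M\<^esub> elt s' t' \<otimes>\<^bsub>M\<^esub> elt (adj s) (\<ominus>\<^bsub>M\<^esub> t) \<otimes>\<^bsub>M\<^esub> elt (adj s') (\<ominus>\<^bsub>M\<^esub> t')"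
      using * adj_elt by (simp add: SL2_inv SL2_sel(2))
    moreover have "\<exists>u. u \<in> S \<and> elt s t \<otimes>\<^bsub>M\<^esub> elt s' t' \<otimes>\<^bsub>M\<^esub> elt (adj s) (\<ominus>\<^bsub>M\<^esub> t) \<otimes>\<^bsub>M\<^esub> elt (adj s') (\<ominus>\<^bsub>M\<^esub> t') = elt \<one>\<^bsub>M\<^esub> u"
      using * first
      by (simp add: elt_mult q0 sc_zero del: split_paired_Ex) (rule exI, rule conjI[rotated], rule refl, simp)
    ultimately obtain u where "u \<in> S" "g \<otimes>\<^bsub>SL2 R\<^esub> h \<otimes>\<^bsub>SL2 R\<^esub> inv\<^bsub>SL2 R\<^esub> g \<otimes>\<^bsub>SL2 R\<^esub> inv\<^bsub>SL2 R\<^esub> h = elt \<one>\<^bsub>M\<^esub> u"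
      by metis
    then show "g \<otimes>\<^bsub>SL2 R\<^esub> h \<otimes>\<^bsub>SL2 R\<^esub> inv\<^bsub>SL2 R\<^esub> g \<otimes>\<^bsub>SL2 R\<^esub> inv\<^bsub>SL2 R\<^esub> h \<in> ?K"
      using frame_setI[OF _ _ _ cc, of "\<one>\<^bsub>M\<^esub>" u "\<lambda>s t. s = \<one>\<^bsub>M\<^esub>"] by simp
  next
    fix g h assume "g \<in> ?K" "h \<in> ?K"
    then obtain t t' where "t \<in> S" "g = elt \<one>\<^bsub>M\<^esub> t" "t' \<in> S" "h = elt \<one>\<^bsub>M\<^esub> t'"
      unfolding frame_set_def by blast
    then show "g \<otimes>\<^bsub>SL2 R\<^esub> h = h \<otimes>\<^bsub>SL2 R\<^esub> g"
      by (simp add: SL2_sel(2) elt_mult q0 sc_zero M.a_comm)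
  qed
qed

text \<open>
  For \<open>a = 0\<close> the generators have one vanishing coordinate.  The parity of the coordinate that
  survives is multiplicative, and the elements in \<open>S\<close> form an abelian normal subgroup
  whose quotient is also abelian.
\<close>
lemma solvable_monomial:
  assumes U1: "U \<in> carrier (SL2 R)" and V: "elt \<zero>\<^bsub>M\<^esub> \<one>\<^bsub>M\<^esub> \<in> carrier (SL2 R)"
  shows "solvable_seq (SL2 R) (generate (SL2 R) {U, elt \<zero>\<^bsub>M\<^esub> \<one>\<^bsub>M\<^esub>, \<ominus>\<^bsub>M\<^esub> \<one>\<^bsub>M\<^esub>})"
proof -
  interpret G: group "SL2 R" by (rule SL2_group)
  let ?H = "frame_set (\<lambda>s t. s = \<zero>\<^bsub>M\<^esub> \<or> t = \<zero>\<^bsub>M\<^esub>)" and ?K = "frame_set (\<lambda>s t. t = \<zero>\<^bsub>M\<^esub>)"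
  let ?gens = "{U, elt \<zero>\<^bsub>M\<^esub> \<one>\<^bsub>M\<^esub>, \<ominus>\<^bsub>M\<^esub> \<one>\<^bsub>M\<^esub>}"
  have H: "subgroup ?H (SL2 R)" by (rule frame_set_subgroup) auto
  have K: "subgroup ?K (SL2 R)" by (rule frame_set_subgroup) auto
  have gens: "?gens \<subseteq> ?H"
    using frame_set_S[of U] frame_set_S[of "\<ominus>\<^bsub>M\<^esub> \<one>\<^bsub>M\<^esub>"] frame_setI[of "\<zero>\<^bsub>M\<^esub>" "\<one>\<^bsub>M\<^esub>"] U1 V minus_one_SL2 by simp
  have sub: "generate (SL2 R) ?gens \<subseteq> ?H" by (rule G.generate_subgroup_incl[OF gens H])
  show ?thesis
  proof (rule G.solvable_seq_metabelian[OF _ K])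
    show "subgroup (generate (SL2 R) ?gens) (SL2 R)"
      using U1 V minus_one_SL2 by (intro G.generate_is_subgroup) simp
  next
    fix g h assume "g \<in> generate (SL2 R) ?gens" "h \<in> generate (SL2 R) ?gens"
    then have "g \<in> ?H" "h \<in> ?H" using sub by blast+
    then have cc: "g \<otimes>\<^bsub>SL2 R\<^esub> h \<otimes>\<^bsub>SL2 R\<^esub> inv\<^bsub>SL2 R\<^esub> g \<otimes>\<^bsub>SL2 R\<^esub> inv\<^bsub>SL2 R\<^esub> h \<in> carrier (SL2 R)"
      using subgroup.mem_carrier[OF H] by simp
    from \<open>g \<in> ?H\<close> obtain s t where *: "s \<in> S" "t \<in> S" "g = elt s t" "s = \<zero>\<^bsub>M\<^esub> \<or> t = \<zero>\<^bsub>M\<^esub>" "g \<in> carrier (SL2 R)"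
      by (rule frame_setE)
    obtain s' t' where *: "s \<in> S" "t \<in> S" "g = elt s t" "s = \<zero>\<^bsub>M\<^esub> \<or> t = \<zero>\<^bsub>M\<^esub>" "g \<in> carrier (SL2 R)"
      "s' \<in> S" "t' \<in> S" "h = elt s' t'" "s' = \<zero>\<^bsub>M\<^esub> \<or> t' = \<zero>\<^bsub>M\<^esub>" "h \<in> carrier (SL2 R)"
      using \<open>h \<in> ?H\<close> * by (elim frame_setE)
    have "g \<otimes>\<^bsub>SL2 R\<^esub> h \<otimes>\<^bsub>SL2 R\<^esub> inv\<^bsub>SL2 R\<^esub> g \<otimes>\<^bsub>SL2 R\<^esub> inv\<^bsub>SL2 R\<^esub> h =
        elt s t \<otimes>\<^bsub>M\<^esub> elt s' t' \<otimes>\<^bsub>M\<^esub> elt (adj s) (\<ominus>\<^bsub>M\<^esub> t) \<otimes>\<^bsub>M\<^esub> elt (adj s') (\<ominus>\<^bsub>M\<^esub> t')"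
      using * adj_elt by (simp add: SL2_inv SL2_sel(2))
    moreover have "\<exists>u. u \<in> S \<and> elt s t \<otimes>\<^bsub>M\<^esub> elt s' t' \<otimes>\<^bsub>M\<^esub> elt (adj s) (\<ominus>\<^bsub>M\<^esub> t) \<otimes>\<^bsub>M\<^esub> elt (adj s') (\<ominus>\<^bsub>M\<^esub> t') = elt u \<zero>\<^bsub>M\<^esub>"
      using *(4,9)
    proof (elim disjE)
    qed (use *(1,2,6,7) in \<open>simp add: elt_mult del: split_paired_Ex\<close>,
      rule exI, rule conjI[rotated], rule refl, simp)+
    ultimately obtain u where "u \<in> S" "g \<otimes>\<^bsub>SL2 R\<^esub> h \<otimes>\<^bsub>SL2 R\<^esub> inv\<^bsub>SL2 R\<^esub> g \<otimes>\<^bsub>SL2 R\<^esub> inv\<^bsub>SL2 R\<^esub> h = elt u \<zero>\<^bsub>M\<^esub>"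
      by metis
    then show "g \<otimes>\<^bsub>SL2 R\<^esub> h \<otimes>\<^bsub>SL2 R\<^esub> inv\<^bsub>SL2 R\<^esub> g \<otimes>\<^bsub>SL2 R\<^esub> inv\<^bsub>SL2 R\<^esub> h \<in> ?K"
      using frame_setI[OF _ _ _ cc, of u "\<zero>\<^bsub>M\<^esub>" "\<lambda>s t. t = \<zero>\<^bsub>M\<^esub>"] by simp
  next
    fix g h assume "g \<in> ?K" "h \<in> ?K"
    then obtain s s' where "s \<in> S" "g = elt s \<zero>\<^bsub>M\<^esub>" "s' \<in> S" "h = elt s' \<zero>\<^bsub>M\<^esub>"
      unfolding frame_set_def by blast
    then show "g \<otimes>\<^bsub>SL2 R\<^esub> h = h \<otimes>\<^bsub>SL2 R\<^esub> g"
      using S_commute[of s s'] by (simp add: SL2_sel(2) elt_mult)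
  qed
qed

end

section \<open>Pairs with coordinates over a domain and their reduction\<close>

text \<open>
  The pair \<open>U\<close>, \<open>V = a + W\<close> over \<open>R\<close> with \<open>q\<close> nonzero, its reduction along \<open>h\<close>, and the consequences of
  a small index.  The map \<open>\<phi>\<close> reduces matrices and sends \<open>S\<close> into the algebra \<open>T\<close> generated by the
  reduction of \<open>U\<close>, where the nonzero discriminant makes the difference of \<open>\<phi> U\<close> and its adjugate
  cancellable.
\<close>
locale residue_frame = cyclic_frame R U W + D: domain R + K: field K + H: ring_hom_cring R K h
  for R (structure) and U W and K (structure) and h +
  fixes a :: "'a mat2" and p m :: nat
  assumes q0: "q \<noteq> \<zero>"
    and U1: "U \<in> carrier (SL2 R)"
    and a: "a \<in> S"
    and V1: "elt a \<one>\<^bsub>M\<^esub> \<in> carrier (SL2 R)"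
    and disc_res: "K.disc (mat2_map h U) \<noteq> \<zero>\<^bsub>K\<^esub>"
    and two: "\<one>\<^bsub>K\<^esub> \<oplus>\<^bsub>K\<^esub> \<one>\<^bsub>K\<^esub> \<noteq> \<zero>\<^bsub>K\<^esub>"
    and p: "Factorial_Ring.prime p" "[p] \<cdot>\<^bsub>K\<^esub> \<one>\<^bsub>K\<^esub> = \<zero>\<^bsub>K\<^esub>"
    and m: "7 \<le> m"
    and ord: "\<And>j::nat. mat2_map h U [^]\<^bsub>SL2 K\<^esub> j \<in> {\<one>\<^bsub>mat2_ring K\<^esub>, \<ominus>\<^bsub>mat2_ring K\<^esub> \<one>\<^bsub>mat2_ring K\<^esub>} \<longleftrightarrow> m dvd j"
    and few: "\<And>B. subgroup B (SL2 R) \<Longrightarrow> U [^]\<^bsub>SL2 R\<^esub> m \<in> B \<Longrightarrow> elt a \<one>\<^bsub>M\<^esub> \<in> B \<Longrightarrow> \<ominus>\<^bsub>M\<^esub> \<one>\<^bsub>M\<^esub> \<in> B \<Longrightarrow>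
       few_cosets (SL2 R) (generate (SL2 R) {U, elt a \<one>\<^bsub>M\<^esub>, \<ominus>\<^bsub>M\<^esub> \<one>\<^bsub>M\<^esub>}) B p"
begin

abbreviation V where "V \<equiv> elt a \<one>\<^bsub>M\<^esub>"
abbreviation \<Gamma> where "\<Gamma> \<equiv> generate (SL2 R) {U, V, \<ominus>\<^bsub>M\<^esub> \<one>\<^bsub>M\<^esub>}"
abbreviation \<phi> where "\<phi> \<equiv> mat2_map h"
abbreviation N where "N \<equiv> mat2_ring K"
abbreviation ksc where "ksc \<equiv> mat_scal K"
abbreviation kadj where "kadj \<equiv> mat_adj K"
abbreviation T where "T \<equiv> K.gen_alg (\<phi> U)"

sublocale G: group "SL2 R" by (rule SL2_group)

lemma U_det: "dt U = \<one>" using U1 by (simp add: SL2_sel)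

lemma U_adj: "U \<otimes>\<^bsub>M\<^esub> adj U = \<one>\<^bsub>M\<^esub>" "adj U \<otimes>\<^bsub>M\<^esub> U = \<one>\<^bsub>M\<^esub>"
  using mult_adj[OF U] adj_times[OF U] U_det by (simp_all add: sc_one)

lemma \<phi>U: "\<phi> U \<in> carrier N" "mat_det K (\<phi> U) = \<one>\<^bsub>K\<^esub>"
  using U U_det by (simp_all add: H.map_dt)

lemma disc_U: "disc U \<noteq> \<zero>"
  using disc_res U by (auto simp: H.map_disc)

lemma \<phi>_S [simp]: "s \<in> S \<Longrightarrow> \<phi> s \<in> T"
  by (rule H.map_gen_alg[OF U])

lemma T_carrier [simp]: "s \<in> T \<Longrightarrow> s \<in> carrier N"
  using K.gen_alg_subset[OF \<phi>U(1)] by blast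

lemmas T_closed [simp] = K.gen_alg_mult[OF \<phi>U(1)] K.gen_alg_add[OF \<phi>U(1)] K.gen_alg_uminus[OF \<phi>U(1)]
  K.gen_alg_adj[OF \<phi>U(1)] K.gen_alg_one[OF \<phi>U(1)] K.gen_alg_zero[OF \<phi>U(1)] K.gen_alg_sc[OF \<phi>U(1)]
  K.gen_alg_self[OF \<phi>U(1)]

lemma T_commute: "s \<in> T \<Longrightarrow> t \<in> T \<Longrightarrow> s \<otimes>\<^bsub>N\<^esub> t = t \<otimes>\<^bsub>N\<^esub> s"
  by (rule K.gen_alg_commute[OF \<phi>U(1)])

lemma gens_carrier: "{U, V, \<ominus>\<^bsub>M\<^esub> \<one>\<^bsub>M\<^esub>} \<subseteq> carrier (SL2 R)"
  using U1 V1 minus_one_SL2 by simp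

lemma \<Gamma>_subgroup: "subgroup \<Gamma> (SL2 R)"
  by (rule G.generate_is_subgroup[OF gens_carrier])

lemma gens_\<Gamma>: "U \<in> \<Gamma>" "V \<in> \<Gamma>"
  by (auto intro: generate.incl)

lemma U_pow_m: "U [^]\<^bsub>SL2 R\<^esub> m \<in> S" "U [^]\<^bsub>SL2 R\<^esub> m \<in> carrier (SL2 R)" "\<exists>r\<in>carrier K. \<phi> (U [^]\<^bsub>SL2 R\<^esub> m) = ksc r"
proof -
  have "\<phi> U [^]\<^bsub>SL2 K\<^esub> m \<in> {\<one>\<^bsub>N\<^esub>, \<ominus>\<^bsub>N\<^esub> \<one>\<^bsub>N\<^esub>}" using ord[of m] by simp
  then have "\<phi> (U [^]\<^bsub>SL2 R\<^esub> m) = ksc \<one>\<^bsub>K\<^esub> \<or> \<phi> (U [^]\<^bsub>SL2 R\<^esub> m) = ksc (\<ominus>\<^bsub>K\<^esub> \<one>\<^bsub>K\<^esub>)"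
    using U by (simp add: SL2_pow K.SL2_pow K.sc_one K.sc_uminus)
  then show "\<exists>r\<in>carrier K. \<phi> (U [^]\<^bsub>SL2 R\<^esub> m) = ksc r" by auto
  show "U [^]\<^bsub>SL2 R\<^esub> m \<in> carrier (SL2 R)" using U1 by simp
  show "U [^]\<^bsub>SL2 R\<^esub> m \<in> S" by (simp add: SL2_pow)
qed

text \<open>
  The contradictions below are all obtained by showing that \<open>\<phi> U\<close> has a scalar square or that
  a nonzero element of \<open>T\<close> vanishes.
\<close>
lemma square_not_scalar: "\<phi> U \<otimes>\<^bsub>N\<^esub> \<phi> U \<notin> range ksc"
proof
  assume "\<phi> U \<otimes>\<^bsub>N\<^esub> \<phi> U \<in> range ksc"
  then have "\<phi> U \<otimes>\<^bsub>N\<^esub> \<phi> U \<in> {\<one>\<^bsub>N\<^esub>, \<ominus>\<^bsub>N\<^esub> \<one>\<^bsub>N\<^esub>}"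
    using K.scalar_det_one[of "\<phi> U \<otimes>\<^bsub>N\<^esub> \<phi> U"] \<phi>U by (simp add: K.dt_mult)
  moreover have "\<phi> U [^]\<^bsub>SL2 K\<^esub> (2::nat) = \<phi> U \<otimes>\<^bsub>N\<^esub> \<phi> U"
    using \<phi>U by (simp add: numeral_2_eq_2 K.SL2_sel)
  ultimately have "m dvd 2" using ord[of 2] by simp
  then show False using m by (auto dest: dvd_imp_le)
qed

lemma res_cancel:
  assumes "x \<in> carrier N" "(\<phi> U \<ominus>\<^bsub>N\<^esub> kadj (\<phi> U)) \<otimes>\<^bsub>N\<^esub> x = \<zero>\<^bsub>N\<^esub>" shows "x = \<zero>\<^bsub>N\<^esub>"
  by (rule K.self_minus_adj_cancel[OF \<phi>U disc_res assms])

text \<open>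
  For \<open>x = r + c u\<close> with \<open>u = \<phi> U\<close>, the difference of \<open>x\<close> and its adjugate is \<open>c (u - adj u)\<close>, and
  \<open>u - adj u\<close> can be cancelled.
\<close>
lemma res_fixed_scalar:
  assumes x: "x \<in> T" and fixd: "kadj x = x"
  shows "\<exists>r\<in>carrier K. x = ksc r"
proof -
  obtain r c where *: "r \<in> carrier K" "c \<in> carrier K" "x = ksc r \<oplus>\<^bsub>N\<^esub> ksc c \<otimes>\<^bsub>N\<^esub> \<phi> U"
    using x by (auto simp: K.gen_alg_def)
  let ?u = "\<phi> U"
  have "kadj x = ksc r \<oplus>\<^bsub>N\<^esub> ksc c \<otimes>\<^bsub>N\<^esub> kadj ?u"
    using * \<phi>U by (simp add: K.adj_add K.adj_mult K.sc_commute)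
  then have "ksc c \<otimes>\<^bsub>N\<^esub> kadj ?u = ksc c \<otimes>\<^bsub>N\<^esub> ?u" 
    using fixd * \<phi>U K.M.add.l_cancel[of "ksc r" "ksc c \<otimes>\<^bsub>N\<^esub> kadj ?u" "ksc c \<otimes>\<^bsub>N\<^esub> ?u"] by simp
  then have "(?u \<ominus>\<^bsub>N\<^esub> kadj ?u) \<otimes>\<^bsub>N\<^esub> ksc c = \<zero>\<^bsub>N\<^esub>"
    using * \<phi>U by (simp add: K.sc_commute[symmetric] K.M.minus_eq K.M.r_distr K.M.r_minus K.M.r_neg)
  then have "ksc c = \<zero>\<^bsub>N\<^esub>" using res_cancel *(2) by simp
  then have "x = ksc r" using * \<phi>U by simp
  then show ?thesis using * by blast
qed

lemma res_scalars:
  "\<exists>e\<in>carrier K. \<one>\<^bsub>N\<^esub> = ksc e" "\<exists>e\<in>carrier K. \<zero>\<^bsub>N\<^esub> = ksc e" "\<exists>e\<in>carrier K. \<ominus>\<^bsub>N\<^esub> \<one>\<^bsub>N\<^esub> = ksc e"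
proof -
  show "\<exists>e\<in>carrier K. \<one>\<^bsub>N\<^esub> = ksc e" by (rule bexI[of _ "\<one>\<^bsub>K\<^esub>"]) (simp_all add: K.sc_one)
  show "\<exists>e\<in>carrier K. \<zero>\<^bsub>N\<^esub> = ksc e" by (rule bexI[of _ "\<zero>\<^bsub>K\<^esub>"]) (simp_all add: K.sc_zero)
  show "\<exists>e\<in>carrier K. \<ominus>\<^bsub>N\<^esub> \<one>\<^bsub>N\<^esub> = ksc e"
    by (rule bexI[of _ "\<ominus>\<^bsub>K\<^esub> \<one>\<^bsub>K\<^esub>"]) (simp_all add: K.sc_one K.sc_uminus)
qed

lemma minus_one_frame: "\<ominus>\<^bsub>M\<^esub> \<one>\<^bsub>M\<^esub> \<in> S" by simp

text \<open>
  The index hypothesis in terms of coordinates; uniqueness of coordinates turns membership in the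
  subgroup into the condition itself.
\<close>
lemma frame_set_power_mem:
  assumes B: "subgroup (frame_set P) (SL2 R)"
    and gens: "P (U [^]\<^bsub>SL2 R\<^esub> m) \<zero>\<^bsub>M\<^esub>" "P a \<one>\<^bsub>M\<^esub>" "P (\<ominus>\<^bsub>M\<^esub> \<one>\<^bsub>M\<^esub>) \<zero>\<^bsub>M\<^esub>"
    and z: "s \<in> S" "t \<in> S" "elt s t \<in> \<Gamma>" and zp: "elt s t [^]\<^bsub>SL2 R\<^esub> p \<in> frame_set P"
  shows "P s t"
proof -
  have "few_cosets (SL2 R) \<Gamma> (frame_set P) p"
    using few[OF B] frame_set_S[OF U_pow_m(1,2)] frame_setI[OF a _ refl V1] frame_set_S[OF minus_one_frame minus_one_SL2]
      gens by simp
  then have "elt s t \<in> frame_set P"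
    using G.few_cosets_prime_power_mem[OF _ \<Gamma>_subgroup B z(3) p(1) zp] by blast
  then obtain s' t' where "s' \<in> S" "t' \<in> S" "elt s t = elt s' t'" "P s' t'" by (rule frame_setE)
  then show ?thesis using elt_inj[OF D.domain_axioms q0 disc_U U_det z(1,2)] by metis
qed

text \<open>
  When elements \<open>s + c t W\<close> with \<open>s\<close> residually one are multiplied, the reductions of the \<open>t\<close> add up, and the
  contribution of \<open>W\<^sup>2 = q\<close> to the first coordinate is residually zero since \<open>q c\<close> is.
  In characteristic \<open>p\<close> this makes the coordinates of their \<open>p\<close>-th powers residually trivial.
\<close>
lemma frame_power:
  assumes c: "c \<in> carrier R" and hc: "h q \<otimes>\<^bsub>K\<^esub> h c = \<zero>\<^bsub>K\<^esub>"
    and st: "s \<in> S" "t \<in> S" and s: "\<phi> s = \<one>\<^bsub>N\<^esub>"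
  shows "\<exists>s'\<in>S. \<exists>t'\<in>S. elt s (sc c \<otimes>\<^bsub>M\<^esub> t) [^]\<^bsub>M\<^esub> (n::nat) = elt s' (sc c \<otimes>\<^bsub>M\<^esub> t') \<and>
    \<phi> s' = \<one>\<^bsub>N\<^esub> \<and> \<phi> t' = ksc ([n] \<cdot>\<^bsub>K\<^esub> \<one>\<^bsub>K\<^esub>) \<otimes>\<^bsub>N\<^esub> \<phi> t"
proof (induction n)
  case 0
  show ?case using st c by (intro bexI[of _ "\<one>\<^bsub>M\<^esub>"] bexI[of _ "\<zero>\<^bsub>M\<^esub>"]) (simp_all add: elt_zero K.sc_zero)
next
  case (Suc n)
  then obtain s' t' where *: "s' \<in> S" "t' \<in> S"
    "elt s (sc c \<otimes>\<^bsub>M\<^esub> t) [^]\<^bsub>M\<^esub> n = elt s' (sc c \<otimes>\<^bsub>M\<^esub> t')"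
    "\<phi> s' = \<one>\<^bsub>N\<^esub>" "\<phi> t' = ksc ([n] \<cdot>\<^bsub>K\<^esub> \<one>\<^bsub>K\<^esub>) \<otimes>\<^bsub>N\<^esub> \<phi> t" by blast
  define s2 where "s2 = s' \<otimes>\<^bsub>M\<^esub> s \<oplus>\<^bsub>M\<^esub> sc q \<otimes>\<^bsub>M\<^esub> (sc c \<otimes>\<^bsub>M\<^esub> t' \<otimes>\<^bsub>M\<^esub> adj (sc c \<otimes>\<^bsub>M\<^esub> t))"
  define t2 where "t2 = s' \<otimes>\<^bsub>M\<^esub> t \<oplus>\<^bsub>M\<^esub> t' \<otimes>\<^bsub>M\<^esub> adj s"
  have S2: "s2 \<in> S" "t2 \<in> S" using * st c by (simp_all add: s2_def t2_def)
  have "s' \<otimes>\<^bsub>M\<^esub> (sc c \<otimes>\<^bsub>M\<^esub> t) = sc c \<otimes>\<^bsub>M\<^esub> (s' \<otimes>\<^bsub>M\<^esub> t)"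
    using * st c sc_commute[of c s'] by (simp add: M.m_assoc[symmetric])
  then have "s' \<otimes>\<^bsub>M\<^esub> (sc c \<otimes>\<^bsub>M\<^esub> t) \<oplus>\<^bsub>M\<^esub> sc c \<otimes>\<^bsub>M\<^esub> t' \<otimes>\<^bsub>M\<^esub> adj s = sc c \<otimes>\<^bsub>M\<^esub> t2"
    using * st c by (simp add: t2_def M.r_distr M.m_assoc)
  then have e: "elt s (sc c \<otimes>\<^bsub>M\<^esub> t) [^]\<^bsub>M\<^esub> Suc n = elt s2 (sc c \<otimes>\<^bsub>M\<^esub> t2)"
    using * st c by (simp add: elt_mult s2_def)
  have "ksc (h q) \<otimes>\<^bsub>N\<^esub> (ksc (h c) \<otimes>\<^bsub>N\<^esub> \<phi> t' \<otimes>\<^bsub>N\<^esub> kadj (\<phi> (sc c \<otimes>\<^bsub>M\<^esub> t))) =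
     (ksc (h q) \<otimes>\<^bsub>N\<^esub> ksc (h c)) \<otimes>\<^bsub>N\<^esub> (\<phi> t' \<otimes>\<^bsub>N\<^esub> kadj (\<phi> (sc c \<otimes>\<^bsub>M\<^esub> t)))"
    using * st c by (simp add: K.M.m_assoc del: H.map_mult)
  also have "\<dots> = \<zero>\<^bsub>N\<^esub>"
    using * st c hc by (simp add: K.sc_mult[symmetric] K.sc_zero del: H.map_mult)
  finally have "\<phi> s2 = \<one>\<^bsub>N\<^esub>"
    using * st c s by (simp add: s2_def del: H.map_mult) (simp add: H.map_mult[of s' s] H.map_mult[of "sc q"] H.map_mult[of "sc c \<otimes>\<^bsub>M\<^esub> t'"] H.map_mult[of "sc c" t'])
  moreover have "\<phi> t2 = ksc ([Suc n] \<cdot>\<^bsub>K\<^esub> \<one>\<^bsub>K\<^esub>) \<otimes>\<^bsub>N\<^esub> \<phi> t"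
    using * st s by (simp add: t2_def K.sc_add K.sc_one K.M.l_distr K.M.a_comm)
  ultimately show ?case using S2 e by blast
qed

lemma frame_power_p:
  assumes "c \<in> carrier R" "h q \<otimes>\<^bsub>K\<^esub> h c = \<zero>\<^bsub>K\<^esub>" "s \<in> S" "t \<in> S" "\<phi> s = \<one>\<^bsub>N\<^esub>"
  shows "\<exists>s'\<in>S. \<exists>t'\<in>S. elt s (sc c \<otimes>\<^bsub>M\<^esub> t) [^]\<^bsub>SL2 R\<^esub> p = elt s' (sc c \<otimes>\<^bsub>M\<^esub> t') \<and>
    \<phi> s' = \<one>\<^bsub>N\<^esub> \<and> \<phi> t' = \<zero>\<^bsub>N\<^esub>"
  using frame_power[OF assms, of p] assms by (simp add: SL2_pow p K.sc_zero)

lemma norm_a: "a \<otimes>\<^bsub>M\<^esub> adj a = \<one>\<^bsub>M\<^esub> \<oplus>\<^bsub>M\<^esub> sc q"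
  using det_first[OF a] V1 by (simp add: SL2_sel)

section \<open>The residually triangular case\<close>

text \<open>
  The commutator \<open>z\<close> of \<open>U\<close> and \<open>V\<close> has first coordinate residually one and second coordinate
  \<open>t0\<close>, residually \<open>(u\<^sup>2 - 1) \<alpha>\<close> with \<open>u\<close>, \<open>\<alpha>\<close> the reductions of \<open>U\<close>, \<open>a\<close>.  Its \<open>p\<close>-th
  power is residually trivial, so \<open>z\<close> satisfies every condition on residual coordinates that is
  closed under multiplication and holds for \<open>U\<^sup>m\<close>, \<open>V\<close> and \<open>-1\<close>.  If \<open>\<alpha>\<close> is a scalar, then
  having scalar residual coordinates is such a condition, and it makes \<open>u\<^sup>2\<close> a scalar.
  Otherwise the condition is to commute residually with \<open>V\<close>; as \<open>z\<close> has residual coordinates \<open>1\<close> and \<open>t0\<close>, this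
  amounts to \<open>t0 \<delta> = 0\<close> with \<open>\<delta> = \<alpha>\<^sup>* - \<alpha>\<close>, which forces \<open>\<delta> = 0\<close>.
\<close>
lemma reducible_contradiction:
  assumes hq: "h q = \<zero>\<^bsub>K\<^esub>" shows False
proof -
  let ?u = "\<phi> U" and ?\<alpha> = "\<phi> a"
  define s0 where "s0 = a \<otimes>\<^bsub>M\<^esub> adj a \<ominus>\<^bsub>M\<^esub> sc q \<otimes>\<^bsub>M\<^esub> (U \<otimes>\<^bsub>M\<^esub> U)"
  define t0 where "t0 = (U \<otimes>\<^bsub>M\<^esub> U \<ominus>\<^bsub>M\<^esub> \<one>\<^bsub>M\<^esub>) \<otimes>\<^bsub>M\<^esub> a"
  have S0: "s0 \<in> S" "t0 \<in> S" using a by (simp_all add: s0_def t0_def M.minus_eq)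
  have "U \<otimes>\<^bsub>SL2 R\<^esub> V \<otimes>\<^bsub>SL2 R\<^esub> inv\<^bsub>SL2 R\<^esub> U \<otimes>\<^bsub>SL2 R\<^esub> inv\<^bsub>SL2 R\<^esub> V \<in> \<Gamma>"
    using gens_\<Gamma> subgroup.m_closed[OF \<Gamma>_subgroup] subgroup.m_inv_closed[OF \<Gamma>_subgroup] by simp
  then have z: "elt s0 t0 \<in> \<Gamma>"
    using commutator_elt[OF a U_det] U1 V1 by (simp add: SL2_inv SL2_sel(2) s0_def t0_def)
  have fs0: "\<phi> s0 = \<one>\<^bsub>N\<^esub>"
    using a U by (simp add: s0_def norm_a hq K.sc_zero K.M.minus_eq)
  have ft0: "\<phi> t0 = (?u \<otimes>\<^bsub>N\<^esub> ?u \<ominus>\<^bsub>N\<^esub> \<one>\<^bsub>N\<^esub>) \<otimes>\<^bsub>N\<^esub> ?\<alpha>"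
    using a U by (simp add: t0_def)
  have t0_one: "sc \<one> \<otimes>\<^bsub>M\<^esub> t = t" if "t \<in> S" for t using that by (simp add: sc_one)
  obtain s' t' where zp: "s' \<in> S" "t' \<in> S" "elt s0 t0 [^]\<^bsub>SL2 R\<^esub> p = elt s' t'" "\<phi> s' = \<one>\<^bsub>N\<^esub>" "\<phi> t' = \<zero>\<^bsub>N\<^esub>"
    using frame_power_p[of \<one> s0 t0] S0 fs0 hq t0_one by auto
  have zpc: "elt s' t' \<in> carrier (SL2 R)"
    using z zp(3) subgroup.mem_carrier[OF \<Gamma>_subgroup] G.nat_pow_closed by metis
  have \<alpha>\<alpha>: "?\<alpha> \<otimes>\<^bsub>N\<^esub> kadj ?\<alpha> = \<one>\<^bsub>N\<^esub>"
  proof -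
    have "\<phi> (a \<otimes>\<^bsub>M\<^esub> adj a) = \<one>\<^bsub>N\<^esub>" unfolding norm_a by (simp add: hq K.sc_zero)
    then show ?thesis using a by simp
  qed
  show False
  proof (cases "kadj ?\<alpha> = ?\<alpha>")
    case True
    obtain r where r: "r \<in> carrier K" "?\<alpha> = ksc r" using res_fixed_scalar[OF _ True] a by auto
    let ?P = "\<lambda>s t. (\<exists>e\<in>carrier K. \<phi> s = ksc e) \<and> (\<exists>d\<in>carrier K. \<phi> t = ksc d)"
    have "subgroup (frame_set ?P) (SL2 R)"
    proof (rule frame_set_subgroup)
      show "?P \<one>\<^bsub>M\<^esub> \<zero>\<^bsub>M\<^esub>"
        using res_scalars by simp
    next
      fix s t s' t' assume st: "s \<in> S" "t \<in> S" "s' \<in> S" "t' \<in> S" and P: "?P s t" "?P s' t'"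
      obtain e d e' d' where *: "e \<in> carrier K" "d \<in> carrier K" "e' \<in> carrier K" "d' \<in> carrier K"
        "\<phi> s = ksc e" "\<phi> t = ksc d" "\<phi> s' = ksc e'" "\<phi> t' = ksc d'"
        using P by blast
      show "?P (s \<otimes>\<^bsub>M\<^esub> s' \<oplus>\<^bsub>M\<^esub> sc q \<otimes>\<^bsub>M\<^esub> (t \<otimes>\<^bsub>M\<^esub> adj t')) (s \<otimes>\<^bsub>M\<^esub> t' \<oplus>\<^bsub>M\<^esub> t \<otimes>\<^bsub>M\<^esub> adj s')"
      proof
        show "\<exists>e\<in>carrier K. \<phi> (s \<otimes>\<^bsub>M\<^esub> s' \<oplus>\<^bsub>M\<^esub> sc q \<otimes>\<^bsub>M\<^esub> (t \<otimes>\<^bsub>M\<^esub> adj t')) = ksc e"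
          using st * by (intro bexI[of _ "e \<otimes>\<^bsub>K\<^esub> e'"]) (simp_all add: hq K.sc_zero K.sc_mult)
        show "\<exists>d\<in>carrier K. \<phi> (s \<otimes>\<^bsub>M\<^esub> t' \<oplus>\<^bsub>M\<^esub> t \<otimes>\<^bsub>M\<^esub> adj s') = ksc d"
          using st * by (intro bexI[of _ "e \<otimes>\<^bsub>K\<^esub> d' \<oplus>\<^bsub>K\<^esub> d \<otimes>\<^bsub>K\<^esub> e'"]) (simp_all add: K.sc_mult K.sc_add)
      qed
    next
      fix s t assume st: "s \<in> S" "t \<in> S" and P: "?P s t"
      obtain e d where *: "e \<in> carrier K" "d \<in> carrier K" "\<phi> s = ksc e" "\<phi> t = ksc d"
        using P by blast
      show "?P (adj s) (\<ominus>\<^bsub>M\<^esub> t)"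
      proof
        show "\<exists>e\<in>carrier K. \<phi> (adj s) = ksc e" using st * by (intro bexI[of _ e]) simp_all
        show "\<exists>d\<in>carrier K. \<phi> (\<ominus>\<^bsub>M\<^esub> t) = ksc d"
          using st * by (intro bexI[of _ "\<ominus>\<^bsub>K\<^esub> d"]) (simp_all add: K.sc_uminus)
      qed
    qed
    moreover have "?P s' t'" using zp res_scalars by simp
    then have "elt s0 t0 [^]\<^bsub>SL2 R\<^esub> p \<in> frame_set ?P"
      using frame_setI[OF zp(1,2) zp(3)] zpc zp(3) by simp
    moreover have "?P (U [^]\<^bsub>SL2 R\<^esub> m) \<zero>\<^bsub>M\<^esub>"
      using U_pow_m(3) res_scalars by simp
    moreover have "?P a \<one>\<^bsub>M\<^esub>" using r res_scalars by auto
    moreover have "?P (\<ominus>\<^bsub>M\<^esub> \<one>\<^bsub>M\<^esub>) \<zero>\<^bsub>M\<^esub>"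
      using res_scalars by simp
    ultimately have "?P s0 t0" using frame_set_power_mem[of ?P s0 t0] S0 z by blast
    then obtain d where d: "d \<in> carrier K" "\<phi> t0 = ksc d" by blast
    have rr: "ksc r \<otimes>\<^bsub>N\<^esub> ksc r = \<one>\<^bsub>N\<^esub>" using \<alpha>\<alpha> r by simp
    have "?u \<otimes>\<^bsub>N\<^esub> ?u \<ominus>\<^bsub>N\<^esub> \<one>\<^bsub>N\<^esub> = (?u \<otimes>\<^bsub>N\<^esub> ?u \<ominus>\<^bsub>N\<^esub> \<one>\<^bsub>N\<^esub>) \<otimes>\<^bsub>N\<^esub> (ksc r \<otimes>\<^bsub>N\<^esub> ksc r)"
      using \<phi>U by (simp add: rr)
    also have "\<dots> = ksc d \<otimes>\<^bsub>N\<^esub> ksc r"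
      using \<phi>U r(1) ft0 d by (simp add: r(2) K.M.m_assoc[symmetric])
    finally have "?u \<otimes>\<^bsub>N\<^esub> ?u = ksc d \<otimes>\<^bsub>N\<^esub> ksc r \<oplus>\<^bsub>N\<^esub> \<one>\<^bsub>N\<^esub>"
      using \<phi>U by (metis K.M.add.inv_solve_right' K.M.m_closed K.M.minus_closed K.M.minus_eq K.M.one_closed)
    also have "\<dots> = ksc (d \<otimes>\<^bsub>K\<^esub> r \<oplus>\<^bsub>K\<^esub> \<one>\<^bsub>K\<^esub>)" using d r by (simp add: K.sc_mult K.sc_add K.sc_one)
    finally show False using square_not_scalar by blast
  next
    case False
    define \<delta> where "\<delta> = kadj ?\<alpha> \<ominus>\<^bsub>N\<^esub> ?\<alpha>"
    have \<delta>T: "\<delta> \<in> T" using a by (simp add: \<delta>_def K.M.minus_eq)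
    \<comment> \<open>The elements that residually commute with \<open>V\<close>: compare the second coordinates of \<open>(s + t W)(\<alpha> + W)\<close>
      and \<open>(\<alpha> + W)(s + t W)\<close>.\<close>
    let ?P = "\<lambda>s t. \<phi> t \<otimes>\<^bsub>N\<^esub> \<delta> = kadj (\<phi> s) \<ominus>\<^bsub>N\<^esub> \<phi> s"
    have scal: "\<phi> s = ksc e \<Longrightarrow> e \<in> carrier K \<Longrightarrow> ?P s \<zero>\<^bsub>M\<^esub>" for s e
      using \<delta>T by (simp add: K.M.minus_eq K.M.r_neg)
    have "subgroup (frame_set ?P) (SL2 R)"
    proof (rule frame_set_subgroup)
      show "?P \<one>\<^bsub>M\<^esub> \<zero>\<^bsub>M\<^esub>" using \<delta>T by (simp add: K.M.minus_eq K.M.r_neg)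
    next
      fix s t s' t' assume st: "s \<in> S" "t \<in> S" "s' \<in> S" "t' \<in> S" and P: "?P s t" "?P s' t'"
      define x y x' y' where "x = \<phi> s" "y = \<phi> t" "x' = \<phi> s'" "y' = \<phi> t'"
      note xy = x_y_x'_y'_def
      have xyT: "x \<in> T" "y \<in> T" "x' \<in> T" "y' \<in> T" using st by (simp_all add: xy)
      have "(x \<otimes>\<^bsub>N\<^esub> y' \<oplus>\<^bsub>N\<^esub> y \<otimes>\<^bsub>N\<^esub> kadj x') \<otimes>\<^bsub>N\<^esub> \<delta> =
          x \<otimes>\<^bsub>N\<^esub> (y' \<otimes>\<^bsub>N\<^esub> \<delta>) \<oplus>\<^bsub>N\<^esub> (y \<otimes>\<^bsub>N\<^esub> \<delta>) \<otimes>\<^bsub>N\<^esub> kadj x'"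
        using xyT \<delta>T T_commute[of "kadj x'" \<delta>] by (simp add: K.M.l_distr K.M.m_assoc)
      also have "\<dots> = x \<otimes>\<^bsub>N\<^esub> (kadj x' \<ominus>\<^bsub>N\<^esub> x') \<oplus>\<^bsub>N\<^esub> (kadj x \<ominus>\<^bsub>N\<^esub> x) \<otimes>\<^bsub>N\<^esub> kadj x'"
        using P by (simp add: xy)
      also have "\<dots> = kadj x \<otimes>\<^bsub>N\<^esub> kadj x' \<ominus>\<^bsub>N\<^esub> x \<otimes>\<^bsub>N\<^esub> x'"
      proof -
        have "A \<in> carrier N \<Longrightarrow> B \<in> carrier N \<Longrightarrow> C \<in> carrier N \<Longrightarrow>
            A \<ominus>\<^bsub>N\<^esub> B \<oplus>\<^bsub>N\<^esub> (C \<ominus>\<^bsub>N\<^esub> A) = C \<ominus>\<^bsub>N\<^esub> B" for A B C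
          by (simp add: K.M.minus_eq K.M.a_ac K.M.r_neg1 K.M.r_neg2)
        from this[of "x \<otimes>\<^bsub>N\<^esub> kadj x'" "x \<otimes>\<^bsub>N\<^esub> x'" "kadj x \<otimes>\<^bsub>N\<^esub> kadj x'"] show ?thesis
          using xyT by (simp add: K.M.minus_eq K.M.l_distr K.M.r_distr K.M.l_minus K.M.r_minus)
      qed
      also have "\<dots> = kadj (x \<otimes>\<^bsub>N\<^esub> x') \<ominus>\<^bsub>N\<^esub> x \<otimes>\<^bsub>N\<^esub> x'"
        using xyT T_commute[of "kadj x" "kadj x'"] by (simp add: K.adj_mult)
      finally show "?P (s \<otimes>\<^bsub>M\<^esub> s' \<oplus>\<^bsub>M\<^esub> sc q \<otimes>\<^bsub>M\<^esub> (t \<otimes>\<^bsub>M\<^esub> adj t')) (s \<otimes>\<^bsub>M\<^esub> t' \<oplus>\<^bsub>M\<^esub> t \<otimes>\<^bsub>M\<^esub> adj s')"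
        using st by (simp add: hq K.sc_zero xy)
    next
      fix s t assume st: "s \<in> S" "t \<in> S" and P: "?P s t"
      have "\<phi> (\<ominus>\<^bsub>M\<^esub> t) \<otimes>\<^bsub>N\<^esub> \<delta> = \<ominus>\<^bsub>N\<^esub> (kadj (\<phi> s) \<ominus>\<^bsub>N\<^esub> \<phi> s)"
        using st \<delta>T P by (simp add: K.M.l_minus)
      also have "\<dots> = \<phi> s \<ominus>\<^bsub>N\<^esub> kadj (\<phi> s)"
        using st by (simp add: K.M.minus_eq K.M.minus_add K.M.a_comm)
      finally show "?P (adj s) (\<ominus>\<^bsub>M\<^esub> t)" using st by simp
    qed
    moreover have "?P s' t'" using zp \<delta>T by (simp add: K.M.minus_eq K.M.r_neg)
    then have "elt s0 t0 [^]\<^bsub>SL2 R\<^esub> p \<in> frame_set ?P"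
      using frame_setI[OF zp(1,2) zp(3)] zpc zp(3) by simp
    moreover have "?P (U [^]\<^bsub>SL2 R\<^esub> m) \<zero>\<^bsub>M\<^esub>" using U_pow_m scal by blast
    moreover have "?P a \<one>\<^bsub>M\<^esub>" using \<delta>T by (simp add: \<delta>_def)
    moreover have "?P (\<ominus>\<^bsub>M\<^esub> \<one>\<^bsub>M\<^esub>) \<zero>\<^bsub>M\<^esub>"
      by (rule scal[of _ "\<ominus>\<^bsub>K\<^esub> \<one>\<^bsub>K\<^esub>"]) (simp_all add: K.sc_uminus K.sc_one)
    ultimately have "?P s0 t0" using frame_set_power_mem[of ?P s0 t0] S0 z by blast
    then have "\<phi> t0 \<otimes>\<^bsub>N\<^esub> \<delta> = \<zero>\<^bsub>N\<^esub>" by (simp add: fs0 K.M.minus_eq K.M.r_neg)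
    \<comment> \<open>Both \<open>\<alpha>\<close> and \<open>u\<close> are invertible with inverse their adjugate, and
      \<open>u\<^sup>* (u\<^sup>2 - 1) = u - u\<^sup>*\<close>.\<close>
    then have "kadj ?\<alpha> \<otimes>\<^bsub>N\<^esub> (kadj ?u \<otimes>\<^bsub>N\<^esub> (\<phi> t0 \<otimes>\<^bsub>N\<^esub> \<delta>)) = \<zero>\<^bsub>N\<^esub>" using a \<phi>U by simp
    moreover have "kadj ?\<alpha> \<otimes>\<^bsub>N\<^esub> (kadj ?u \<otimes>\<^bsub>N\<^esub> (\<phi> t0 \<otimes>\<^bsub>N\<^esub> \<delta>)) = (?u \<ominus>\<^bsub>N\<^esub> kadj ?u) \<otimes>\<^bsub>N\<^esub> \<delta>"
    proof -
      have 1: "kadj ?u \<otimes>\<^bsub>N\<^esub> (?u \<otimes>\<^bsub>N\<^esub> ?u \<ominus>\<^bsub>N\<^esub> \<one>\<^bsub>N\<^esub>) = ?u \<ominus>\<^bsub>N\<^esub> kadj ?u"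
        using \<phi>U by (simp add: K.M.minus_eq K.M.r_distr K.M.r_minus K.M.m_assoc[symmetric] K.adj_times K.sc_one)
      have 2: "kadj ?\<alpha> \<otimes>\<^bsub>N\<^esub> (A \<otimes>\<^bsub>N\<^esub> ?\<alpha> \<otimes>\<^bsub>N\<^esub> \<delta>) = A \<otimes>\<^bsub>N\<^esub> \<delta>" if "A \<in> T" for A
      proof -
        have "kadj ?\<alpha> \<otimes>\<^bsub>N\<^esub> (A \<otimes>\<^bsub>N\<^esub> ?\<alpha> \<otimes>\<^bsub>N\<^esub> \<delta>) = kadj ?\<alpha> \<otimes>\<^bsub>N\<^esub> (?\<alpha> \<otimes>\<^bsub>N\<^esub> A) \<otimes>\<^bsub>N\<^esub> \<delta>"
          using that a \<delta>T T_commute[of A ?\<alpha>] by (simp add: K.M.m_assoc)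
        also have "\<dots> = (kadj ?\<alpha> \<otimes>\<^bsub>N\<^esub> ?\<alpha>) \<otimes>\<^bsub>N\<^esub> A \<otimes>\<^bsub>N\<^esub> \<delta>"
          using that a \<delta>T by (simp add: K.M.m_assoc)
        finally show ?thesis using that a \<delta>T \<alpha>\<alpha> T_commute[of "kadj ?\<alpha>" ?\<alpha>] by simp
      qed
      have "kadj ?u \<otimes>\<^bsub>N\<^esub> (\<phi> t0 \<otimes>\<^bsub>N\<^esub> \<delta>) = (kadj ?u \<otimes>\<^bsub>N\<^esub> (?u \<otimes>\<^bsub>N\<^esub> ?u \<ominus>\<^bsub>N\<^esub> \<one>\<^bsub>N\<^esub>)) \<otimes>\<^bsub>N\<^esub> ?\<alpha> \<otimes>\<^bsub>N\<^esub> \<delta>"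
        using \<phi>U a \<delta>T by (simp add: ft0 K.M.m_assoc)
      then show ?thesis unfolding 1 using 2[of "?u \<ominus>\<^bsub>N\<^esub> kadj ?u"] by (simp add: K.M.minus_eq)
    qed
    ultimately have "\<delta> = \<zero>\<^bsub>N\<^esub>" using res_cancel[of \<delta>] \<delta>T by simp
    then show False using False a K.M.r_right_minus_eq by (simp add: \<delta>_def)
  qed
qed

end

section \<open>The residually dihedral case\<close>

context residue_frame
begin

text \<open>
  The relevant subgroup is graded by the parity of the residual group.  Its even elements have first
  coordinate residually scalar and second coordinate \<open>c t'\<close> with \<open>t'\<close> residually scalar; its odd
  elements have second coordinate residually a scalar \<open>e\<close> and first coordinate \<open>c s'\<close>
  with \<open>s'\<close> congruent to \<open>e a'\<close> modulo scalars.  These conditions hold for \<open>U\<^sup>m\<close>, \<open>V\<close> and \<open>-1\<close>, and they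
  persist under products because \<open>a' + adj a'\<close> is a scalar.  The element
  \<open>z = V U V\<^sup>-\<^sup>1 U\<close> is residually one with second coordinate \<open>c t1\<close>, so
  \<open>z\<close> and its conjugate by \<open>U\<close>, which has second coordinate \<open>c U t1 U\<close>, lie in the subgroup.  Hence
  \<open>t1\<close> and \<open>U t1 U\<close> are residually scalar.  Either \<open>U\<^sup>2\<close> is residually scalar, or \<open>t1\<close> is residually zero, in
  which case so is \<open>a'\<close>.
\<close>
lemma dihedral_contradiction:
  assumes hq: "h q = \<ominus>\<^bsub>K\<^esub> \<one>\<^bsub>K\<^esub>"
    and c: "c \<in> carrier R" "c \<noteq> \<zero>" "h c = \<zero>\<^bsub>K\<^esub>"
    and a': "a' \<in> S" "a = sc c \<otimes>\<^bsub>M\<^esub> a'" "\<phi> a' \<noteq> \<zero>\<^bsub>N\<^esub>"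
  shows False
proof -
  let ?u = "\<phi> U" and ?\<alpha> = "\<phi> a'"
  have \<phi>c: "\<phi> (sc c \<otimes>\<^bsub>M\<^esub> x) = \<zero>\<^bsub>N\<^esub>" if "x \<in> S" for x
    using that c by (simp add: K.sc_zero)
  define ev where "ev = (\<lambda>s t. \<exists>e\<in>carrier K. \<exists>d\<in>carrier K. \<exists>t'\<in>S. t = sc c \<otimes>\<^bsub>M\<^esub> t' \<and> \<phi> s = ksc e \<and> \<phi> t' = ksc d)"
  define od where "od = (\<lambda>s t. \<exists>e\<in>carrier K. \<exists>d\<in>carrier K. \<exists>s'\<in>S. s = sc c \<otimes>\<^bsub>M\<^esub> s' \<and> \<phi> t = ksc e \<and>
     \<phi> s' = ksc e \<otimes>\<^bsub>N\<^esub> ?\<alpha> \<oplus>\<^bsub>N\<^esub> ksc d)"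
  let ?P = "\<lambda>s t. ev s t \<or> od s t"
  have evI: "ev s t" if "e \<in> carrier K" "d \<in> carrier K" "t' \<in> S" "t = sc c \<otimes>\<^bsub>M\<^esub> t'" "\<phi> s = ksc e" "\<phi> t' = ksc d"
    for s t t' e d using that unfolding ev_def by blast
  have odI: "od s t" if "e \<in> carrier K" "d \<in> carrier K" "s' \<in> S" "s = sc c \<otimes>\<^bsub>M\<^esub> s'" "\<phi> t = ksc e"
    "\<phi> s' = ksc e \<otimes>\<^bsub>N\<^esub> ?\<alpha> \<oplus>\<^bsub>N\<^esub> ksc d" for s t s' e d using that unfolding od_def by blast
  have \<alpha>T: "?\<alpha> \<in> T" using a' by simp
  have sc_pull: "x \<otimes>\<^bsub>M\<^esub> (sc c \<otimes>\<^bsub>M\<^esub> y) = sc c \<otimes>\<^bsub>M\<^esub> (x \<otimes>\<^bsub>M\<^esub> y)" if "x \<in> S" "y \<in> S" for x y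
    using that c sc_commute[of c x] by (simp add: M.m_assoc[symmetric])
  have sc_pull2: "sc q \<otimes>\<^bsub>M\<^esub> (sc c \<otimes>\<^bsub>M\<^esub> y) = sc c \<otimes>\<^bsub>M\<^esub> (sc q \<otimes>\<^bsub>M\<^esub> y)" if "y \<in> S" for y
    using that sc_pull[of "sc q" y] by simp
  have adj_pull: "adj (sc c \<otimes>\<^bsub>M\<^esub> y) = sc c \<otimes>\<^bsub>M\<^esub> adj y" if "y \<in> S" for y
    using that c by (simp add: adj_mult sc_commute)
  have one_ne: "\<one>\<^bsub>N\<^esub> \<noteq> \<zero>\<^bsub>N\<^esub>" using K.one_not_zero by (simp add: mat2_sel)

  have B: "subgroup (frame_set ?P) (SL2 R)"
  proof (rule frame_set_subgroup)
    have "ev \<one>\<^bsub>M\<^esub> \<zero>\<^bsub>M\<^esub>"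
      by (rule evI[of "\<one>\<^bsub>K\<^esub>" "\<zero>\<^bsub>K\<^esub>" "\<zero>\<^bsub>M\<^esub>"]) (simp_all add: K.sc_one K.sc_zero c)
    then show "?P \<one>\<^bsub>M\<^esub> \<zero>\<^bsub>M\<^esub>" by simp
  next
    fix s t s' t' assume st: "s \<in> S" "t \<in> S" "s' \<in> S" "t' \<in> S" and P: "?P s t" "?P s' t'"
    let ?s = "s \<otimes>\<^bsub>M\<^esub> s' \<oplus>\<^bsub>M\<^esub> sc q \<otimes>\<^bsub>M\<^esub> (t \<otimes>\<^bsub>M\<^esub> adj t')" and ?t = "s \<otimes>\<^bsub>M\<^esub> t' \<oplus>\<^bsub>M\<^esub> t \<otimes>\<^bsub>M\<^esub> adj s'"
    consider (ee) "ev s t" "ev s' t'" | (eo) "ev s t" "od s' t'" | (oe) "od s t" "ev s' t'" | (oo) "od s t" "od s' t'"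
      using P by blast
    then show "?P ?s ?t"
    proof cases
      case ee
      obtain e d x e' d' x' where *: "e \<in> carrier K" "d \<in> carrier K" "x \<in> S" "t = sc c \<otimes>\<^bsub>M\<^esub> x" "\<phi> s = ksc e" "\<phi> x = ksc d"
        "e' \<in> carrier K" "d' \<in> carrier K" "x' \<in> S" "t' = sc c \<otimes>\<^bsub>M\<^esub> x'" "\<phi> s' = ksc e'" "\<phi> x' = ksc d'"
        using ee unfolding ev_def by blast
      have "ev ?s ?t"
      proof (rule evI[of "e \<otimes>\<^bsub>K\<^esub> e'" "e \<otimes>\<^bsub>K\<^esub> d' \<oplus>\<^bsub>K\<^esub> d \<otimes>\<^bsub>K\<^esub> e'" "s \<otimes>\<^bsub>M\<^esub> x' \<oplus>\<^bsub>M\<^esub> x \<otimes>\<^bsub>M\<^esub> adj s'"])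
        show "?t = sc c \<otimes>\<^bsub>M\<^esub> (s \<otimes>\<^bsub>M\<^esub> x' \<oplus>\<^bsub>M\<^esub> x \<otimes>\<^bsub>M\<^esub> adj s')"
          using st * c sc_pull[of s x'] by (simp add: M.r_distr M.m_assoc)
        have "\<phi> t = \<zero>\<^bsub>N\<^esub>" using \<phi>c *(3,4) by simp
        then show "\<phi> ?s = ksc (e \<otimes>\<^bsub>K\<^esub> e')" using st * by (simp add: K.sc_mult)
      qed (use st * in \<open>simp_all add: K.sc_mult K.sc_add\<close>)
      then show ?thesis by simp
    next
      case eo
      obtain e d x e' d' x' where *: "e \<in> carrier K" "d \<in> carrier K" "x \<in> S" "t = sc c \<otimes>\<^bsub>M\<^esub> x" "\<phi> s = ksc e" "\<phi> x = ksc d"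
        "e' \<in> carrier K" "d' \<in> carrier K" "x' \<in> S" "s' = sc c \<otimes>\<^bsub>M\<^esub> x'" "\<phi> t' = ksc e'"
        "\<phi> x' = ksc e' \<otimes>\<^bsub>N\<^esub> ?\<alpha> \<oplus>\<^bsub>N\<^esub> ksc d'"
        using eo unfolding ev_def od_def by blast
      have "od ?s ?t"
      proof (rule odI[of "e \<otimes>\<^bsub>K\<^esub> e'" "e \<otimes>\<^bsub>K\<^esub> d' \<oplus>\<^bsub>K\<^esub> h q \<otimes>\<^bsub>K\<^esub> (d \<otimes>\<^bsub>K\<^esub> e')"
            "s \<otimes>\<^bsub>M\<^esub> x' \<oplus>\<^bsub>M\<^esub> sc q \<otimes>\<^bsub>M\<^esub> (x \<otimes>\<^bsub>M\<^esub> adj t')"])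
        show "?s = sc c \<otimes>\<^bsub>M\<^esub> (s \<otimes>\<^bsub>M\<^esub> x' \<oplus>\<^bsub>M\<^esub> sc q \<otimes>\<^bsub>M\<^esub> (x \<otimes>\<^bsub>M\<^esub> adj t'))"
          using st * c sc_pull[of s x'] sc_pull2[of "x \<otimes>\<^bsub>M\<^esub> adj t'"] by (simp add: M.r_distr M.m_assoc)
        have "\<phi> t = \<zero>\<^bsub>N\<^esub>" "\<phi> s' = \<zero>\<^bsub>N\<^esub>" using \<phi>c * by simp_all
        then show "\<phi> ?t = ksc (e \<otimes>\<^bsub>K\<^esub> e')" using st * by (simp add: K.sc_mult)
        show "\<phi> (s \<otimes>\<^bsub>M\<^esub> x' \<oplus>\<^bsub>M\<^esub> sc q \<otimes>\<^bsub>M\<^esub> (x \<otimes>\<^bsub>M\<^esub> adj t')) =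
            ksc (e \<otimes>\<^bsub>K\<^esub> e') \<otimes>\<^bsub>N\<^esub> ?\<alpha> \<oplus>\<^bsub>N\<^esub> ksc (e \<otimes>\<^bsub>K\<^esub> d' \<oplus>\<^bsub>K\<^esub> h q \<otimes>\<^bsub>K\<^esub> (d \<otimes>\<^bsub>K\<^esub> e'))"
          using st * \<alpha>T by (simp add: K.sc_mult K.sc_add K.M.r_distr K.M.m_assoc K.M.a_assoc)
      qed (use st * in simp_all)
      then show ?thesis by simp
    next
      case oe
      obtain e d x e' d' x' where *: "e \<in> carrier K" "d \<in> carrier K" "x \<in> S" "s = sc c \<otimes>\<^bsub>M\<^esub> x" "\<phi> t = ksc e"
        "\<phi> x = ksc e \<otimes>\<^bsub>N\<^esub> ?\<alpha> \<oplus>\<^bsub>N\<^esub> ksc d"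
        "e' \<in> carrier K" "d' \<in> carrier K" "x' \<in> S" "t' = sc c \<otimes>\<^bsub>M\<^esub> x'" "\<phi> s' = ksc e'" "\<phi> x' = ksc d'"
        using oe unfolding ev_def od_def by blast
      have "od ?s ?t"
      proof (rule odI[of "e \<otimes>\<^bsub>K\<^esub> e'" "d \<otimes>\<^bsub>K\<^esub> e' \<oplus>\<^bsub>K\<^esub> h q \<otimes>\<^bsub>K\<^esub> (e \<otimes>\<^bsub>K\<^esub> d')"
            "x \<otimes>\<^bsub>M\<^esub> s' \<oplus>\<^bsub>M\<^esub> sc q \<otimes>\<^bsub>M\<^esub> (t \<otimes>\<^bsub>M\<^esub> adj x')"])
        show "?s = sc c \<otimes>\<^bsub>M\<^esub> (x \<otimes>\<^bsub>M\<^esub> s' \<oplus>\<^bsub>M\<^esub> sc q \<otimes>\<^bsub>M\<^esub> (t \<otimes>\<^bsub>M\<^esub> adj x'))"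
          using st * c adj_pull[of x'] sc_pull[of t "adj x'"] sc_pull2[of "t \<otimes>\<^bsub>M\<^esub> adj x'"]
          by (simp add: M.r_distr M.m_assoc)
        have "\<phi> s = \<zero>\<^bsub>N\<^esub>" "\<phi> t' = \<zero>\<^bsub>N\<^esub>" using \<phi>c * by simp_all
        then show "\<phi> ?t = ksc (e \<otimes>\<^bsub>K\<^esub> e')" using st * by (simp add: K.sc_mult)
        have "ksc e \<otimes>\<^bsub>N\<^esub> ?\<alpha> \<otimes>\<^bsub>N\<^esub> ksc e' = ksc e \<otimes>\<^bsub>N\<^esub> ksc e' \<otimes>\<^bsub>N\<^esub> ?\<alpha>"
          using * \<alpha>T by (simp add: K.M.m_assoc K.sc_commute[of e' ?\<alpha>])
        then show "\<phi> (x \<otimes>\<^bsub>M\<^esub> s' \<oplus>\<^bsub>M\<^esub> sc q \<otimes>\<^bsub>M\<^esub> (t \<otimes>\<^bsub>M\<^esub> adj x')) =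
            ksc (e \<otimes>\<^bsub>K\<^esub> e') \<otimes>\<^bsub>N\<^esub> ?\<alpha> \<oplus>\<^bsub>N\<^esub> ksc (d \<otimes>\<^bsub>K\<^esub> e' \<oplus>\<^bsub>K\<^esub> h q \<otimes>\<^bsub>K\<^esub> (e \<otimes>\<^bsub>K\<^esub> d'))"
          using st * \<alpha>T by (simp add: K.sc_mult K.sc_add K.M.l_distr K.M.a_assoc)
      qed (use st * in simp_all)
      then show ?thesis by simp
    next
      case oo
      obtain e d x e' d' x' where *: "e \<in> carrier K" "d \<in> carrier K" "x \<in> S" "s = sc c \<otimes>\<^bsub>M\<^esub> x" "\<phi> t = ksc e"
        "\<phi> x = ksc e \<otimes>\<^bsub>N\<^esub> ?\<alpha> \<oplus>\<^bsub>N\<^esub> ksc d"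
        "e' \<in> carrier K" "d' \<in> carrier K" "x' \<in> S" "s' = sc c \<otimes>\<^bsub>M\<^esub> x'" "\<phi> t' = ksc e'"
        "\<phi> x' = ksc e' \<otimes>\<^bsub>N\<^esub> ?\<alpha> \<oplus>\<^bsub>N\<^esub> ksc d'"
        using oo unfolding od_def by blast
      let ?\<tau> = "mat_trace K ?\<alpha>"
      have \<tau>: "?\<tau> \<in> carrier K" using \<alpha>T by simp
      have "ev ?s ?t"
      proof (rule evI[of "h q \<otimes>\<^bsub>K\<^esub> (e \<otimes>\<^bsub>K\<^esub> e')" "e \<otimes>\<^bsub>K\<^esub> e' \<otimes>\<^bsub>K\<^esub> ?\<tau> \<oplus>\<^bsub>K\<^esub> (d \<otimes>\<^bsub>K\<^esub> e' \<oplus>\<^bsub>K\<^esub> e \<otimes>\<^bsub>K\<^esub> d')"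
            "x \<otimes>\<^bsub>M\<^esub> t' \<oplus>\<^bsub>M\<^esub> t \<otimes>\<^bsub>M\<^esub> adj x'"])
        show "?t = sc c \<otimes>\<^bsub>M\<^esub> (x \<otimes>\<^bsub>M\<^esub> t' \<oplus>\<^bsub>M\<^esub> t \<otimes>\<^bsub>M\<^esub> adj x')"
          using st * c adj_pull[of x'] sc_pull[of t "adj x'"] by (simp add: M.r_distr M.m_assoc)
        have "\<phi> s = \<zero>\<^bsub>N\<^esub>" using \<phi>c * by simp
        then show "\<phi> ?s = ksc (h q \<otimes>\<^bsub>K\<^esub> (e \<otimes>\<^bsub>K\<^esub> e'))" using st * by (simp add: K.sc_mult)
        have 1: "ksc e \<otimes>\<^bsub>N\<^esub> ?\<alpha> \<otimes>\<^bsub>N\<^esub> ksc e' = ksc e \<otimes>\<^bsub>N\<^esub> ksc e' \<otimes>\<^bsub>N\<^esub> ?\<alpha>"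
          using * \<alpha>T by (simp add: K.M.m_assoc K.sc_commute[of e' ?\<alpha>])
        have 2: "kadj (ksc e' \<otimes>\<^bsub>N\<^esub> ?\<alpha> \<oplus>\<^bsub>N\<^esub> ksc d') = ksc e' \<otimes>\<^bsub>N\<^esub> kadj ?\<alpha> \<oplus>\<^bsub>N\<^esub> ksc d'"
          using * \<alpha>T by (simp add: K.adj_add K.adj_mult K.sc_commute)
        have "\<phi> (x \<otimes>\<^bsub>M\<^esub> t' \<oplus>\<^bsub>M\<^esub> t \<otimes>\<^bsub>M\<^esub> adj x') =
            (ksc e \<otimes>\<^bsub>N\<^esub> ?\<alpha> \<oplus>\<^bsub>N\<^esub> ksc d) \<otimes>\<^bsub>N\<^esub> ksc e' \<oplus>\<^bsub>N\<^esub> ksc e \<otimes>\<^bsub>N\<^esub> (ksc e' \<otimes>\<^bsub>N\<^esub> kadj ?\<alpha> \<oplus>\<^bsub>N\<^esub> ksc d')"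
          using st * by (simp add: 2)
        also have "\<dots> = (ksc e \<otimes>\<^bsub>N\<^esub> ksc e' \<otimes>\<^bsub>N\<^esub> ?\<alpha> \<oplus>\<^bsub>N\<^esub> ksc e \<otimes>\<^bsub>N\<^esub> ksc e' \<otimes>\<^bsub>N\<^esub> kadj ?\<alpha>) \<oplus>\<^bsub>N\<^esub>
            (ksc d \<otimes>\<^bsub>N\<^esub> ksc e' \<oplus>\<^bsub>N\<^esub> ksc e \<otimes>\<^bsub>N\<^esub> ksc d')"
          using * \<alpha>T by (simp add: K.M.l_distr K.M.r_distr 1 K.M.m_assoc[symmetric] K.M.a_ac)
        also have "ksc e \<otimes>\<^bsub>N\<^esub> ksc e' \<otimes>\<^bsub>N\<^esub> ?\<alpha> \<oplus>\<^bsub>N\<^esub> ksc e \<otimes>\<^bsub>N\<^esub> ksc e' \<otimes>\<^bsub>N\<^esub> kadj ?\<alpha> =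
            ksc (e \<otimes>\<^bsub>K\<^esub> e' \<otimes>\<^bsub>K\<^esub> ?\<tau>)"
          using * \<alpha>T by (simp add: K.M.r_distr[symmetric] K.add_adj K.sc_mult)
        finally show "\<phi> (x \<otimes>\<^bsub>M\<^esub> t' \<oplus>\<^bsub>M\<^esub> t \<otimes>\<^bsub>M\<^esub> adj x') =
            ksc (e \<otimes>\<^bsub>K\<^esub> e' \<otimes>\<^bsub>K\<^esub> ?\<tau> \<oplus>\<^bsub>K\<^esub> (d \<otimes>\<^bsub>K\<^esub> e' \<oplus>\<^bsub>K\<^esub> e \<otimes>\<^bsub>K\<^esub> d'))"
          using * \<tau> by (simp add: K.sc_add K.sc_mult)
      qed (use st * \<tau> in simp_all)
      then show ?thesis by simp
    qed
  next
    fix s t assume st: "s \<in> S" "t \<in> S" and P: "?P s t"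
    show "?P (adj s) (\<ominus>\<^bsub>M\<^esub> t)"
    proof (cases "ev s t")
      case True
      then obtain e d x where *: "e \<in> carrier K" "d \<in> carrier K" "x \<in> S" "t = sc c \<otimes>\<^bsub>M\<^esub> x" "\<phi> s = ksc e" "\<phi> x = ksc d"
        unfolding ev_def by blast
      have "ev (adj s) (\<ominus>\<^bsub>M\<^esub> t)"
        by (rule evI[of e "\<ominus>\<^bsub>K\<^esub> d" "\<ominus>\<^bsub>M\<^esub> x"]) (use st * c in \<open>simp_all add: K.sc_uminus M.r_minus\<close>)
      then show ?thesis by simp
    next
      case False
      then obtain e d x where *: "e \<in> carrier K" "d \<in> carrier K" "x \<in> S" "s = sc c \<otimes>\<^bsub>M\<^esub> x" "\<phi> t = ksc e"
        "\<phi> x = ksc e \<otimes>\<^bsub>N\<^esub> ?\<alpha> \<oplus>\<^bsub>N\<^esub> ksc d"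
        using P unfolding od_def by blast
      let ?\<tau> = "mat_trace K ?\<alpha>"
      have \<tau>: "?\<tau> \<in> carrier K" using \<alpha>T by simp
      have "od (adj s) (\<ominus>\<^bsub>M\<^esub> t)"
      proof (rule odI[of "\<ominus>\<^bsub>K\<^esub> e" "e \<otimes>\<^bsub>K\<^esub> ?\<tau> \<oplus>\<^bsub>K\<^esub> d" "adj x"])
        have "kadj ?\<alpha> = \<ominus>\<^bsub>N\<^esub> ?\<alpha> \<oplus>\<^bsub>N\<^esub> ksc ?\<tau>"
          using K.add_adj[of ?\<alpha>] \<alpha>T by (metis K.M.r_neg1 K.mat_closed(3) T_carrier)
        moreover have "\<phi> (adj x) = ksc e \<otimes>\<^bsub>N\<^esub> kadj ?\<alpha> \<oplus>\<^bsub>N\<^esub> ksc d"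
          using * \<alpha>T by (simp add: K.adj_add K.adj_mult K.sc_commute)
        ultimately show "\<phi> (adj x) = ksc (\<ominus>\<^bsub>K\<^esub> e) \<otimes>\<^bsub>N\<^esub> ?\<alpha> \<oplus>\<^bsub>N\<^esub> ksc (e \<otimes>\<^bsub>K\<^esub> ?\<tau> \<oplus>\<^bsub>K\<^esub> d)"
          using *(1,2) \<alpha>T \<tau> by (simp add: K.sc_uminus K.sc_add K.sc_mult
              K.M.r_distr K.M.r_minus K.M.l_minus K.M.a_assoc)
      qed (use st * c \<tau> adj_pull in \<open>simp_all add: K.sc_uminus\<close>)
      then show ?thesis by simp
    qed
  qed

  have gens: "?P (U [^]\<^bsub>SL2 R\<^esub> m) \<zero>\<^bsub>M\<^esub>" "?P a \<one>\<^bsub>M\<^esub>" "?P (\<ominus>\<^bsub>M\<^esub> \<one>\<^bsub>M\<^esub>) \<zero>\<^bsub>M\<^esub>"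
  proof -
    obtain r where "r \<in> carrier K" "\<phi> (U [^]\<^bsub>SL2 R\<^esub> m) = ksc r" using U_pow_m(3) by blast
    then have "ev (U [^]\<^bsub>SL2 R\<^esub> m) \<zero>\<^bsub>M\<^esub>"
      by (intro evI[of r "\<zero>\<^bsub>K\<^esub>" "\<zero>\<^bsub>M\<^esub>"]) (simp_all add: K.sc_zero c)
    then show "?P (U [^]\<^bsub>SL2 R\<^esub> m) \<zero>\<^bsub>M\<^esub>" by simp
    have "od a \<one>\<^bsub>M\<^esub>"
      by (rule odI[of "\<one>\<^bsub>K\<^esub>" "\<zero>\<^bsub>K\<^esub>" a']) (use a' \<alpha>T in \<open>simp_all add: K.sc_one K.sc_zero\<close>)
    then show "?P a \<one>\<^bsub>M\<^esub>" by simp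
    have "ev (\<ominus>\<^bsub>M\<^esub> \<one>\<^bsub>M\<^esub>) \<zero>\<^bsub>M\<^esub>"
      by (rule evI[of "\<ominus>\<^bsub>K\<^esub> \<one>\<^bsub>K\<^esub>" "\<zero>\<^bsub>K\<^esub>" "\<zero>\<^bsub>M\<^esub>"]) (simp_all add: K.sc_zero K.sc_one K.sc_uminus c)
    then show "?P (\<ominus>\<^bsub>M\<^esub> \<one>\<^bsub>M\<^esub>) \<zero>\<^bsub>M\<^esub>" by simp
  qed

  \<comment> \<open>An element that is residually one is even, and cancelling \<open>c\<close> recovers the condition on \<open>t\<close>.\<close>
  have scalar: "\<exists>d\<in>carrier K. \<phi> t = ksc d"
    if st: "s \<in> S" "t \<in> S" "\<phi> s = \<one>\<^bsub>N\<^esub>" and z: "elt s (sc c \<otimes>\<^bsub>M\<^esub> t) \<in> \<Gamma>" for s t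
  proof -
    have tc: "sc c \<otimes>\<^bsub>M\<^esub> t \<in> S" using st c by simp
    obtain s' t' where zp: "s' \<in> S" "t' \<in> S" "elt s (sc c \<otimes>\<^bsub>M\<^esub> t) [^]\<^bsub>SL2 R\<^esub> p = elt s' (sc c \<otimes>\<^bsub>M\<^esub> t')"
      "\<phi> s' = \<one>\<^bsub>N\<^esub>" "\<phi> t' = \<zero>\<^bsub>N\<^esub>"
      using frame_power_p[OF c(1) _ st] c hq by auto
    have zpc: "elt s' (sc c \<otimes>\<^bsub>M\<^esub> t') \<in> carrier (SL2 R)"
      using z zp(3) subgroup.mem_carrier[OF \<Gamma>_subgroup] G.nat_pow_closed by metis
    have "ev s' (sc c \<otimes>\<^bsub>M\<^esub> t')"
      by (rule evI[of "\<one>\<^bsub>K\<^esub>" "\<zero>\<^bsub>K\<^esub>" t']) (use zp in \<open>simp_all add: K.sc_one K.sc_zero\<close>)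
    then have "elt s (sc c \<otimes>\<^bsub>M\<^esub> t) [^]\<^bsub>SL2 R\<^esub> p \<in> frame_set ?P"
      using frame_setI[of s' "sc c \<otimes>\<^bsub>M\<^esub> t'" _ ?P] zp zpc c by simp
    then have "?P s (sc c \<otimes>\<^bsub>M\<^esub> t)"
      by (rule frame_set_power_mem[OF B gens st(1) tc z])
    then show ?thesis
    proof
      assume "ev s (sc c \<otimes>\<^bsub>M\<^esub> t)"
      then obtain d x where x: "d \<in> carrier K" "x \<in> S" "sc c \<otimes>\<^bsub>M\<^esub> t = sc c \<otimes>\<^bsub>M\<^esub> x" "\<phi> x = ksc d"
        unfolding ev_def by blast
      have "sc c \<otimes>\<^bsub>M\<^esub> (t \<ominus>\<^bsub>M\<^esub> x) = \<zero>\<^bsub>M\<^esub>"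
        using x st c by (simp add: M.minus_eq M.r_distr M.r_minus M.r_neg)
      then have "t \<ominus>\<^bsub>M\<^esub> x = \<zero>\<^bsub>M\<^esub>" using D.mat_sc_mult_zero[OF c(1,2)] x st by simp
      then have "t = x" using x st M.r_right_minus_eq by simp
      then show ?thesis using x by blast
    next
      assume "od s (sc c \<otimes>\<^bsub>M\<^esub> t)"
      then obtain x where "x \<in> S" "s = sc c \<otimes>\<^bsub>M\<^esub> x" unfolding od_def by blast
      then have "\<phi> s = \<zero>\<^bsub>N\<^esub>" using \<phi>c by simp
      then show ?thesis using st one_ne by simp
    qed
  qed

  define s1 where "s1 = (a \<otimes>\<^bsub>M\<^esub> U \<otimes>\<^bsub>M\<^esub> adj a \<ominus>\<^bsub>M\<^esub> sc q \<otimes>\<^bsub>M\<^esub> adj U) \<otimes>\<^bsub>M\<^esub> U"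
  define t1 where "t1 = (adj U \<otimes>\<^bsub>M\<^esub> a' \<ominus>\<^bsub>M\<^esub> a' \<otimes>\<^bsub>M\<^esub> U) \<otimes>\<^bsub>M\<^esub> adj U"
  have S1: "s1 \<in> S" "t1 \<in> S" using a a' by (simp_all add: s1_def t1_def M.minus_eq)
  have ev1: "V \<otimes>\<^bsub>M\<^esub> U = elt (a \<otimes>\<^bsub>M\<^esub> U) (adj U)"
    using elt_mult[of a "\<one>\<^bsub>M\<^esub>" U "\<zero>\<^bsub>M\<^esub>"] a U by (simp add: elt_zero)
  have ev2: "elt (a \<otimes>\<^bsub>M\<^esub> U) (adj U) \<otimes>\<^bsub>M\<^esub> adj V =
      elt (a \<otimes>\<^bsub>M\<^esub> U \<otimes>\<^bsub>M\<^esub> adj a \<ominus>\<^bsub>M\<^esub> sc q \<otimes>\<^bsub>M\<^esub> adj U) (adj U \<otimes>\<^bsub>M\<^esub> a \<ominus>\<^bsub>M\<^esub> a \<otimes>\<^bsub>M\<^esub> U)"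
    using elt_mult[of "a \<otimes>\<^bsub>M\<^esub> U" "adj U" "adj a" "\<ominus>\<^bsub>M\<^esub> \<one>\<^bsub>M\<^esub>"] a U
    by (simp add: adj_elt adj_uminus M.r_minus M.minus_eq M.a_comm)
  have ev3: "elt (a \<otimes>\<^bsub>M\<^esub> U \<otimes>\<^bsub>M\<^esub> adj a \<ominus>\<^bsub>M\<^esub> sc q \<otimes>\<^bsub>M\<^esub> adj U) (adj U \<otimes>\<^bsub>M\<^esub> a \<ominus>\<^bsub>M\<^esub> a \<otimes>\<^bsub>M\<^esub> U) \<otimes>\<^bsub>M\<^esub> U =
      elt s1 ((adj U \<otimes>\<^bsub>M\<^esub> a \<ominus>\<^bsub>M\<^esub> a \<otimes>\<^bsub>M\<^esub> U) \<otimes>\<^bsub>M\<^esub> adj U)"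
    using elt_mult[of "a \<otimes>\<^bsub>M\<^esub> U \<otimes>\<^bsub>M\<^esub> adj a \<ominus>\<^bsub>M\<^esub> sc q \<otimes>\<^bsub>M\<^esub> adj U" "adj U \<otimes>\<^bsub>M\<^esub> a \<ominus>\<^bsub>M\<^esub> a \<otimes>\<^bsub>M\<^esub> U" U "\<zero>\<^bsub>M\<^esub>"] a U
    by (simp add: elt_zero s1_def M.minus_eq)
  have ct1: "(adj U \<otimes>\<^bsub>M\<^esub> a \<ominus>\<^bsub>M\<^esub> a \<otimes>\<^bsub>M\<^esub> U) \<otimes>\<^bsub>M\<^esub> adj U = sc c \<otimes>\<^bsub>M\<^esub> t1"
  proof -
    have "adj U \<otimes>\<^bsub>M\<^esub> a \<ominus>\<^bsub>M\<^esub> a \<otimes>\<^bsub>M\<^esub> U = sc c \<otimes>\<^bsub>M\<^esub> (adj U \<otimes>\<^bsub>M\<^esub> a' \<ominus>\<^bsub>M\<^esub> a' \<otimes>\<^bsub>M\<^esub> U)"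
      using sc_pull[of "adj U" a'] a' c U by (simp add: M.minus_eq M.r_distr M.r_minus M.m_assoc)
    then show ?thesis using a' c U by (simp add: t1_def M.m_assoc)
  qed
  have zeq: "V \<otimes>\<^bsub>M\<^esub> U \<otimes>\<^bsub>M\<^esub> adj V \<otimes>\<^bsub>M\<^esub> U = elt s1 (sc c \<otimes>\<^bsub>M\<^esub> t1)"
    unfolding ev1 ev2 ev3 ct1 ..
  have "V \<otimes>\<^bsub>SL2 R\<^esub> U \<otimes>\<^bsub>SL2 R\<^esub> inv\<^bsub>SL2 R\<^esub> V \<otimes>\<^bsub>SL2 R\<^esub> U \<in> \<Gamma>"
    using gens_\<Gamma> subgroup.m_closed[OF \<Gamma>_subgroup] subgroup.m_inv_closed[OF \<Gamma>_subgroup] by simp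
  then have z1: "elt s1 (sc c \<otimes>\<^bsub>M\<^esub> t1) \<in> \<Gamma>" using U1 V1 zeq by (simp add: SL2_inv SL2_sel(2))
  have \<phi>a: "\<phi> a = \<zero>\<^bsub>N\<^esub>" using \<phi>c[OF a'(1)] a'(2) by simp
  have \<phi>s1: "\<phi> s1 = \<one>\<^bsub>N\<^esub>"
    using a U \<phi>U by (simp add: s1_def \<phi>a hq K.sc_uminus K.sc_one K.M.minus_eq K.M.l_minus K.adj_times)
  have \<phi>t1: "\<phi> t1 = (kadj ?u \<otimes>\<^bsub>N\<^esub> ?\<alpha> \<ominus>\<^bsub>N\<^esub> ?\<alpha> \<otimes>\<^bsub>N\<^esub> ?u) \<otimes>\<^bsub>N\<^esub> kadj ?u"
    using a' U by (simp add: t1_def)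
  have z2: "elt s1 (sc c \<otimes>\<^bsub>M\<^esub> (U \<otimes>\<^bsub>M\<^esub> t1 \<otimes>\<^bsub>M\<^esub> U)) \<in> \<Gamma>"
  proof -
    have "U \<otimes>\<^bsub>SL2 R\<^esub> elt s1 (sc c \<otimes>\<^bsub>M\<^esub> t1) \<otimes>\<^bsub>SL2 R\<^esub> inv\<^bsub>SL2 R\<^esub> U \<in> \<Gamma>"
      using gens_\<Gamma> z1 subgroup.m_closed[OF \<Gamma>_subgroup] subgroup.m_inv_closed[OF \<Gamma>_subgroup] by simp
    moreover have "U \<otimes>\<^bsub>M\<^esub> elt s1 (sc c \<otimes>\<^bsub>M\<^esub> t1) = elt (U \<otimes>\<^bsub>M\<^esub> s1) (sc c \<otimes>\<^bsub>M\<^esub> (U \<otimes>\<^bsub>M\<^esub> t1))"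
      using elt_mult[of U "\<zero>\<^bsub>M\<^esub>" s1 "sc c \<otimes>\<^bsub>M\<^esub> t1"] S1 c U sc_pull[of U t1] by (simp add: elt_zero)
    moreover have "elt (U \<otimes>\<^bsub>M\<^esub> s1) (sc c \<otimes>\<^bsub>M\<^esub> (U \<otimes>\<^bsub>M\<^esub> t1)) \<otimes>\<^bsub>M\<^esub> adj U =
        elt s1 (sc c \<otimes>\<^bsub>M\<^esub> (U \<otimes>\<^bsub>M\<^esub> t1 \<otimes>\<^bsub>M\<^esub> U))"
    proof -
      have "U \<otimes>\<^bsub>M\<^esub> s1 \<otimes>\<^bsub>M\<^esub> adj U = s1"
        using S1 U S_commute[of U s1] U_adj by (simp add: M.m_assoc)
      then show ?thesis
        using elt_mult[of "U \<otimes>\<^bsub>M\<^esub> s1" "sc c \<otimes>\<^bsub>M\<^esub> (U \<otimes>\<^bsub>M\<^esub> t1)" "adj U" "\<zero>\<^bsub>M\<^esub>"] S1 c U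
        by (simp add: elt_zero M.m_assoc)
    qed
    ultimately show ?thesis using U1 by (simp add: SL2_inv SL2_sel(2))
  qed
  obtain d where d: "d \<in> carrier K" "\<phi> t1 = ksc d" using scalar[OF S1 \<phi>s1 z1] by blast
  obtain d' where d': "d' \<in> carrier K" "?u \<otimes>\<^bsub>N\<^esub> \<phi> t1 \<otimes>\<^bsub>N\<^esub> ?u = ksc d'"
    using scalar[OF S1(1) _ \<phi>s1 z2] S1 U by auto
  show False
  proof (cases "d = \<zero>\<^bsub>K\<^esub>")
    case False
    then have du: "d \<in> Units K" using d K.field_Units by simp
    have "ksc d \<otimes>\<^bsub>N\<^esub> (?u \<otimes>\<^bsub>N\<^esub> ?u) = ksc d'"
    proof -
      have "ksc d \<otimes>\<^bsub>N\<^esub> (?u \<otimes>\<^bsub>N\<^esub> ?u) = (ksc d \<otimes>\<^bsub>N\<^esub> ?u) \<otimes>\<^bsub>N\<^esub> ?u"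
        using d \<phi>U by (simp add: K.M.m_assoc)
      also have "\<dots> = (?u \<otimes>\<^bsub>N\<^esub> ksc d) \<otimes>\<^bsub>N\<^esub> ?u" using d \<phi>U K.sc_commute[of d ?u] by simp
      finally show ?thesis using d' d by simp
    qed
    then have "ksc (inv\<^bsub>K\<^esub> d) \<otimes>\<^bsub>N\<^esub> (ksc d \<otimes>\<^bsub>N\<^esub> (?u \<otimes>\<^bsub>N\<^esub> ?u)) = ksc (inv\<^bsub>K\<^esub> d \<otimes>\<^bsub>K\<^esub> d')"
      using du d' by (simp add: K.sc_mult)
    then have "?u \<otimes>\<^bsub>N\<^esub> ?u = ksc (inv\<^bsub>K\<^esub> d \<otimes>\<^bsub>K\<^esub> d')"
    proof -
      assume e: "ksc (inv\<^bsub>K\<^esub> d) \<otimes>\<^bsub>N\<^esub> (ksc d \<otimes>\<^bsub>N\<^esub> (?u \<otimes>\<^bsub>N\<^esub> ?u)) = ksc (inv\<^bsub>K\<^esub> d \<otimes>\<^bsub>K\<^esub> d')"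
      have "ksc (inv\<^bsub>K\<^esub> d) \<otimes>\<^bsub>N\<^esub> ksc d = \<one>\<^bsub>N\<^esub>"
        using du d(1) K.sc_mult[of "inv\<^bsub>K\<^esub> d" d] by (simp add: K.sc_one)
      then have "ksc (inv\<^bsub>K\<^esub> d) \<otimes>\<^bsub>N\<^esub> (ksc d \<otimes>\<^bsub>N\<^esub> (?u \<otimes>\<^bsub>N\<^esub> ?u)) = ?u \<otimes>\<^bsub>N\<^esub> ?u"
        using du d(1) \<phi>U K.M.m_assoc[of "ksc (inv\<^bsub>K\<^esub> d)" "ksc d" "?u \<otimes>\<^bsub>N\<^esub> ?u"] by simp
      with e show ?thesis by simp
    qed
    then show False using square_not_scalar by blast
  next
    case True
    have t1_0: "(kadj ?u \<otimes>\<^bsub>N\<^esub> ?\<alpha> \<ominus>\<^bsub>N\<^esub> ?\<alpha> \<otimes>\<^bsub>N\<^esub> ?u) \<otimes>\<^bsub>N\<^esub> kadj ?u = \<zero>\<^bsub>N\<^esub>"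
      using d(2) unfolding \<phi>t1 True K.sc_zero .
    have "(kadj ?u \<otimes>\<^bsub>N\<^esub> ?\<alpha> \<ominus>\<^bsub>N\<^esub> ?\<alpha> \<otimes>\<^bsub>N\<^esub> ?u) \<otimes>\<^bsub>N\<^esub> kadj ?u \<otimes>\<^bsub>N\<^esub> ?u = \<zero>\<^bsub>N\<^esub>"
      unfolding t1_0 using \<phi>U by simp
    then have e: "kadj ?u \<otimes>\<^bsub>N\<^esub> ?\<alpha> \<ominus>\<^bsub>N\<^esub> ?\<alpha> \<otimes>\<^bsub>N\<^esub> ?u = \<zero>\<^bsub>N\<^esub>"
      using \<phi>U \<alpha>T by (simp add: K.M.m_assoc K.adj_times K.sc_one)
    have "(?u \<ominus>\<^bsub>N\<^esub> kadj ?u) \<otimes>\<^bsub>N\<^esub> ?\<alpha> = \<ominus>\<^bsub>N\<^esub> (kadj ?u \<otimes>\<^bsub>N\<^esub> ?\<alpha> \<ominus>\<^bsub>N\<^esub> ?\<alpha> \<otimes>\<^bsub>N\<^esub> ?u)"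
      using \<phi>U \<alpha>T T_commute[of ?\<alpha> ?u]
      by (simp add: K.M.minus_eq K.M.l_distr K.M.l_minus K.M.minus_add K.M.a_comm)
    also have "\<dots> = \<zero>\<^bsub>N\<^esub>" unfolding e by simp
    finally show False using res_cancel[of ?\<alpha>] \<alpha>T a'(3) by simp
  qed
qed

end

section \<open>Pairs over a local ring in which divisibility is total\<close>

text \<open>
  The hypotheses \<open>unit\<close> and \<open>chain\<close> hold in a valuation ring.  The first makes the discriminant of \<open>U\<close>
  invertible, so that coordinates exist; the second allows the coordinates of a nonzero \<open>a\<close>
  to be divided by one of the two.
\<close>
theorem solvable_of_small_index:
  fixes R :: "('a, 'b) ring_scheme" (structure) and K :: "('c, 'd) ring_scheme" (structure)
    and h :: "'a \<Rightarrow> 'c" and U V :: "'a mat2" and p m :: nat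
  assumes R: "domain R" and K: "field K" and h: "h \<in> ring_hom R K"
    and unit: "\<And>r. r \<in> carrier R \<Longrightarrow> h r \<noteq> \<zero>\<^bsub>K\<^esub> \<Longrightarrow> r \<in> Units R"
    and chain: "\<And>r s. r \<in> carrier R \<Longrightarrow> s \<in> carrier R \<Longrightarrow>
      (\<exists>t\<in>carrier R. r = s \<otimes>\<^bsub>R\<^esub> t) \<or> (\<exists>t\<in>carrier R. s = r \<otimes>\<^bsub>R\<^esub> t)"
    and two: "\<one>\<^bsub>K\<^esub> \<oplus>\<^bsub>K\<^esub> \<one>\<^bsub>K\<^esub> \<noteq> \<zero>\<^bsub>K\<^esub>"
    and p: "Factorial_Ring.prime p" "[p] \<cdot>\<^bsub>K\<^esub> \<one>\<^bsub>K\<^esub> = \<zero>\<^bsub>K\<^esub>"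
    and m: "odd m" "7 \<le> m" "m < p"
    and U: "U \<in> carrier (SL2 R)" and V: "V \<in> carrier (SL2 R)"
    and ord: "\<And>j::nat. mat2_map h U [^]\<^bsub>SL2 K\<^esub> j \<in> {\<one>\<^bsub>mat2_ring K\<^esub>, \<ominus>\<^bsub>mat2_ring K\<^esub> \<one>\<^bsub>mat2_ring K\<^esub>} \<longleftrightarrow> m dvd j"
    and few: "\<And>B. subgroup B (SL2 R) \<Longrightarrow> U [^]\<^bsub>SL2 R\<^esub> m \<in> B \<Longrightarrow> V \<in> B \<Longrightarrow>
       \<ominus>\<^bsub>mat2_ring R\<^esub> \<one>\<^bsub>mat2_ring R\<^esub> \<in> B \<Longrightarrow>
       few_cosets (SL2 R) (generate (SL2 R) {U, V, \<ominus>\<^bsub>mat2_ring R\<^esub> \<one>\<^bsub>mat2_ring R\<^esub>}) B p"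
  shows "solvable_seq (SL2 R) (generate (SL2 R) {U, V, \<ominus>\<^bsub>mat2_ring R\<^esub> \<one>\<^bsub>mat2_ring R\<^esub>})"
proof -
  interpret R: domain R by fact
  interpret K: field K by fact
  interpret H: ring_hom_cring R K h by unfold_locales (rule h)
  let ?\<phi> = "mat2_map h"
  let ?M = "mat2_ring R" and ?N = "mat2_ring K"
  let ?u = "?\<phi> U" and ?v = "?\<phi> V"
  let ?neg = "\<ominus>\<^bsub>?M\<^esub> \<one>\<^bsub>?M\<^esub>"
  interpret P: group_hom "SL2 R" "SL2 K" ?\<phi> by (rule H.SL2_group_hom)
  have UM: "U \<in> carrier ?M" "R.dt U = \<one>\<^bsub>R\<^esub>" and VM: "V \<in> carrier ?M" "R.dt V = \<one>\<^bsub>R\<^esub>"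
    using U V by (simp_all add: R.SL2_sel)
  have uc: "?u \<in> carrier (SL2 K)" "?v \<in> carrier (SL2 K)" using U V by simp_all
  have uN: "?u \<in> carrier ?N" "K.dt ?u = \<one>\<^bsub>K\<^esub>" and vN: "?v \<in> carrier ?N" "K.dt ?v = \<one>\<^bsub>K\<^esub>"
    using uc by (simp_all add: K.SL2_sel)
  have neg: "?neg \<in> carrier (SL2 R)" by (simp add: R.SL2_sel R.dt_uminus)
  have gens: "{U, V, ?neg} \<subseteq> carrier (SL2 R)" using U V neg by simp

  \<comment> \<open>Otherwise \<open>\<phi> U\<close> would have order dividing \<open>2p\<close> modulo scalars, whereas \<open>m\<close> is odd and \<open>1 < m < p\<close>.\<close>
  have disc_u: "K.disc ?u \<noteq> \<zero>\<^bsub>K\<^esub>"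
  proof
    assume "K.disc ?u = \<zero>\<^bsub>K\<^esub>"
    then have "(?u \<otimes>\<^bsub>?N\<^esub> ?u) [^]\<^bsub>?N\<^esub> p = \<one>\<^bsub>?N\<^esub>" using K.disc_zero_pow[OF uN _ p(2)] by simp
    moreover have "?u [^]\<^bsub>SL2 K\<^esub> (2 * p) = (?u \<otimes>\<^bsub>?N\<^esub> ?u) [^]\<^bsub>?N\<^esub> p"
    proof -
      have "?u [^]\<^bsub>SL2 K\<^esub> (2::nat) = ?u \<otimes>\<^bsub>?N\<^esub> ?u" using uN by (simp add: numeral_2_eq_2 K.SL2_sel)
      then show ?thesis using P.H.nat_pow_pow[OF uc(1), of 2 p] by (simp add: K.SL2_pow)
    qed
    ultimately have "m dvd 2 * p" using ord[of "2 * p"] by simp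
    then have "m dvd p" using m(1) by (simp add: coprime_dvd_mult_right_iff)
    then show False using p(1) m(2,3) by (auto simp: prime_nat_iff)
  qed
  have disc_U: "R.disc U \<in> Units R" using unit[of "R.disc U"] disc_u UM by (simp add: H.map_disc)
  define e where "e = inv\<^bsub>R\<^esub> (R.disc U)"
  have e: "e \<in> carrier R" "R.disc U \<otimes>\<^bsub>R\<^esub> e = \<one>\<^bsub>R\<^esub>" using disc_U by (simp_all add: e_def)
  obtain a0 a1 W where a01: "a0 \<in> carrier R" "a1 \<in> carrier R" and fr: "cyclic_frame R U W"
    and V_eq: "V = (R.sc a0 \<oplus>\<^bsub>?M\<^esub> R.sc a1 \<otimes>\<^bsub>?M\<^esub> U) \<oplus>\<^bsub>?M\<^esub> W"
    and a0: "a0 = (R.tr V \<otimes>\<^bsub>R\<^esub> (R.tr U \<otimes>\<^bsub>R\<^esub> R.tr U \<ominus>\<^bsub>R\<^esub> (\<one>\<^bsub>R\<^esub> \<oplus>\<^bsub>R\<^esub> \<one>\<^bsub>R\<^esub>)) \<ominus>\<^bsub>R\<^esub> R.tr U \<otimes>\<^bsub>R\<^esub> R.tr (U \<otimes>\<^bsub>?M\<^esub> V)) \<otimes>\<^bsub>R\<^esub> e"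
    and a1: "a1 = (R.tr (U \<otimes>\<^bsub>?M\<^esub> V) \<oplus>\<^bsub>R\<^esub> R.tr (U \<otimes>\<^bsub>?M\<^esub> V) \<ominus>\<^bsub>R\<^esub> R.tr U \<otimes>\<^bsub>R\<^esub> R.tr V) \<otimes>\<^bsub>R\<^esub> e"
    using R.frame_exists[OF UM VM(1) e] by blast
  interpret F: cyclic_frame R U W by (rule fr)
  define a where "a = R.sc a0 \<oplus>\<^bsub>?M\<^esub> R.sc a1 \<otimes>\<^bsub>?M\<^esub> U"
  have aS: "a \<in> F.S" unfolding a_def by (rule R.gen_algI[OF a01 refl])
  have Ve: "V = F.elt a \<one>\<^bsub>?M\<^esub>" using V_eq F.W by (simp add: F.elt_def a_def)
  show ?thesis
  proof (cases "F.q = \<zero>\<^bsub>R\<^esub>")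
    case True
    then show ?thesis using F.solvable_triangular[OF True U aS] V unfolding Ve by blast
  next
    case q0: False
    interpret Q: residue_frame R U W K h a p m
      using q0 U aS V two p m ord few disc_u unfolding Ve by unfold_locales auto
    have hq: "h F.q \<noteq> \<zero>\<^bsub>K\<^esub>" using Q.reducible_contradiction by blast
    have comm_tr: "K.tr (?u \<otimes>\<^bsub>?N\<^esub> ?v \<otimes>\<^bsub>?N\<^esub> K.adj ?u \<otimes>\<^bsub>?N\<^esub> K.adj ?v) \<noteq> \<one>\<^bsub>K\<^esub> \<oplus>\<^bsub>K\<^esub> \<one>\<^bsub>K\<^esub>"
    proof
      assume tr2: "K.tr (?u \<otimes>\<^bsub>?N\<^esub> ?v \<otimes>\<^bsub>?N\<^esub> K.adj ?u \<otimes>\<^bsub>?N\<^esub> K.adj ?v) = \<one>\<^bsub>K\<^esub> \<oplus>\<^bsub>K\<^esub> \<one>\<^bsub>K\<^esub>"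
      have "?u \<otimes>\<^bsub>?N\<^esub> ?v \<otimes>\<^bsub>?N\<^esub> K.adj ?u \<otimes>\<^bsub>?N\<^esub> K.adj ?v = ?\<phi> (U \<otimes>\<^bsub>?M\<^esub> V \<otimes>\<^bsub>?M\<^esub> R.adj U \<otimes>\<^bsub>?M\<^esub> R.adj V)"
        using UM VM by simp
      then have "h (R.tr (U \<otimes>\<^bsub>?M\<^esub> V \<otimes>\<^bsub>?M\<^esub> R.adj U \<otimes>\<^bsub>?M\<^esub> R.adj V)) = \<one>\<^bsub>K\<^esub> \<oplus>\<^bsub>K\<^esub> \<one>\<^bsub>K\<^esub>"
        using tr2 UM VM by (simp add: H.map_tr[symmetric])
      moreover have "R.tr (U \<otimes>\<^bsub>?M\<^esub> V \<otimes>\<^bsub>?M\<^esub> R.adj U \<otimes>\<^bsub>?M\<^esub> R.adj V) = \<one>\<^bsub>R\<^esub> \<oplus>\<^bsub>R\<^esub> \<one>\<^bsub>R\<^esub> \<ominus>\<^bsub>R\<^esub> F.q \<otimes>\<^bsub>R\<^esub> R.disc U"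
        using F.tr_commutator[OF aS UM(2)] VM(2) unfolding Ve by blast
      ultimately have "\<one>\<^bsub>K\<^esub> \<oplus>\<^bsub>K\<^esub> \<one>\<^bsub>K\<^esub> \<ominus>\<^bsub>K\<^esub> h F.q \<otimes>\<^bsub>K\<^esub> K.disc ?u = \<one>\<^bsub>K\<^esub> \<oplus>\<^bsub>K\<^esub> \<one>\<^bsub>K\<^esub>"
        using UM by (simp add: R.minus_eq K.minus_eq H.map_disc)
      moreover have "x \<oplus>\<^bsub>K\<^esub> (x \<ominus>\<^bsub>K\<^esub> y) = x \<oplus>\<^bsub>K\<^esub> x \<ominus>\<^bsub>K\<^esub> y" if "x \<in> carrier K" "y \<in> carrier K" for x y
        using that by (simp add: K.minus_eq K.a_assoc)
      ultimately have "\<ominus>\<^bsub>K\<^esub> (h F.q \<otimes>\<^bsub>K\<^esub> K.disc ?u) = \<zero>\<^bsub>K\<^esub>"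
        using K.add.l_cancel_one[of "\<one>\<^bsub>K\<^esub> \<oplus>\<^bsub>K\<^esub> \<one>\<^bsub>K\<^esub>" "\<ominus>\<^bsub>K\<^esub> (h F.q \<otimes>\<^bsub>K\<^esub> K.disc ?u)"] uN
        by (simp add: K.minus_eq)
      then have "h F.q \<otimes>\<^bsub>K\<^esub> K.disc ?u = \<zero>\<^bsub>K\<^esub>" using uN K.a_inv_inj K.minus_minus
        by (metis F.q_closed H.hom_closed K.disc_closed K.m_closed K.minus_zero)
      then show False using K.integral[of "h F.q" "K.disc ?u"] hq disc_u uN by simp
    qed
    let ?\<Gamma> = "generate (SL2 R) {U, V, ?neg}"
    have \<phi>neg: "?\<phi> ?neg = \<ominus>\<^bsub>?N\<^esub> \<one>\<^bsub>?N\<^esub>" by simp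
    have \<Gamma>_img: "generate (SL2 K) {?u, ?v, \<ominus>\<^bsub>?N\<^esub> \<one>\<^bsub>?N\<^esub>} = ?\<phi> ` ?\<Gamma>"
      using P.generate_img[OF gens] by simp
    have dihedral: "?v \<otimes>\<^bsub>?N\<^esub> ?u \<otimes>\<^bsub>?N\<^esub> K.adj ?v = K.adj ?u"
    proof (rule K.residual_dihedral[OF two p uc ord m(2,3) _ comm_tr])
      fix B assume B: "subgroup B (SL2 K)" "?u [^]\<^bsub>SL2 K\<^esub> m \<in> B" "?v \<in> B" "\<ominus>\<^bsub>?N\<^esub> \<one>\<^bsub>?N\<^esub> \<in> B"
      have "few_cosets (SL2 R) ?\<Gamma> {g \<in> carrier (SL2 R). ?\<phi> g \<in> B} p"
        by (rule few[OF P.preimage_subgroup[OF B(1)]]) (use B U V neg in \<open>simp_all add: P.hom_nat_pow\<close>)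
      then show "few_cosets (SL2 K) (generate (SL2 K) {?u, ?v, \<ominus>\<^bsub>?N\<^esub> \<one>\<^bsub>?N\<^esub>}) B p"
        unfolding \<Gamma>_img using few_cosets_image[OF P.group_hom_axioms] P.G.generate_incl[OF gens] by blast
    qed
    \<comment> \<open>The relation \<open>v u v\<^sup>-\<^sup>1 = u\<^sup>-\<^sup>1\<close> implies \<open>2 tr(u v) = tr u tr v\<close> and \<open>tr u tr(u v) = 2 tr v\<close>,
      which annihilate the numerators of \<open>a1\<close> and \<open>a0\<close>.\<close>
    have ha: "h a0 = \<zero>\<^bsub>K\<^esub>" "h a1 = \<zero>\<^bsub>K\<^esub>"
    proof -
      define t x w where "t = K.tr ?u" and "x = K.tr ?v" and "w = K.tr (?u \<otimes>\<^bsub>?N\<^esub> ?v)"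
      have txw: "t \<in> carrier K" "x \<in> carrier K" "w \<in> carrier K" using uN vN by (simp_all add: t_def x_def w_def)
      have "?v \<otimes>\<^bsub>?N\<^esub> ?u \<otimes>\<^bsub>?N\<^esub> K.adj ?v \<otimes>\<^bsub>?N\<^esub> ?v = K.adj ?u \<otimes>\<^bsub>?N\<^esub> ?v" using dihedral by simp
      then have vu: "?v \<otimes>\<^bsub>?N\<^esub> ?u = K.adj ?u \<otimes>\<^bsub>?N\<^esub> ?v"
        using uN vN by (simp add: K.M.m_assoc K.adj_times K.sc_one)
      have "?u \<otimes>\<^bsub>?N\<^esub> ?v \<oplus>\<^bsub>?N\<^esub> K.adj ?u \<otimes>\<^bsub>?N\<^esub> ?v = K.sc t \<otimes>\<^bsub>?N\<^esub> ?v"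
        using uN vN by (simp add: K.M.l_distr[symmetric] K.add_adj t_def)
      then have "K.tr (?u \<otimes>\<^bsub>?N\<^esub> ?v \<oplus>\<^bsub>?N\<^esub> ?v \<otimes>\<^bsub>?N\<^esub> ?u) = t \<otimes>\<^bsub>K\<^esub> x"
        using uN vN txw by (simp add: vu K.tr_sc_mult x_def)
      then have 1: "w \<oplus>\<^bsub>K\<^esub> w = t \<otimes>\<^bsub>K\<^esub> x"
        using uN vN by (simp add: K.tr_add K.tr_mult_commute[of ?v ?u] w_def)
      have "?u \<otimes>\<^bsub>?N\<^esub> (?v \<otimes>\<^bsub>?N\<^esub> ?u) = ?v"
        using uN vN by (simp add: vu K.M.m_assoc[symmetric] K.mult_adj K.sc_one)
      then have "x = K.tr (?u \<otimes>\<^bsub>?N\<^esub> (?v \<otimes>\<^bsub>?N\<^esub> ?u))" by (simp add: x_def)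
      also have "\<dots> = K.tr ((?u \<otimes>\<^bsub>?N\<^esub> ?u) \<otimes>\<^bsub>?N\<^esub> ?v)"
        using uN vN K.tr_mult_commute[of "?u \<otimes>\<^bsub>?N\<^esub> ?v" ?u] by (simp add: K.M.m_assoc)
      also have "\<dots> = t \<otimes>\<^bsub>K\<^esub> w \<ominus>\<^bsub>K\<^esub> x"
        using uN vN txw by (simp add: K.cayley_hamilton[OF uN] K.M.minus_eq K.M.l_distr K.M.l_minus
            K.tr_add K.tr_uminus K.M.m_assoc K.tr_sc_mult t_def w_def x_def K.minus_eq)
      finally have 2: "x = t \<otimes>\<^bsub>K\<^esub> w \<ominus>\<^bsub>K\<^esub> x" .
      have 3: "t \<otimes>\<^bsub>K\<^esub> w = x \<oplus>\<^bsub>K\<^esub> x"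
      proof -
        have "x \<oplus>\<^bsub>K\<^esub> x = (t \<otimes>\<^bsub>K\<^esub> w \<ominus>\<^bsub>K\<^esub> x) \<oplus>\<^bsub>K\<^esub> x" using 2 by simp
        then show ?thesis using txw by (simp add: K.minus_eq K.a_assoc K.l_neg)
      qed
      have num: "x \<otimes>\<^bsub>K\<^esub> (t \<otimes>\<^bsub>K\<^esub> t \<ominus>\<^bsub>K\<^esub> (\<one>\<^bsub>K\<^esub> \<oplus>\<^bsub>K\<^esub> \<one>\<^bsub>K\<^esub>)) \<ominus>\<^bsub>K\<^esub> t \<otimes>\<^bsub>K\<^esub> w = \<zero>\<^bsub>K\<^esub>"
      proof -
        have "x \<otimes>\<^bsub>K\<^esub> (t \<otimes>\<^bsub>K\<^esub> t \<ominus>\<^bsub>K\<^esub> (\<one>\<^bsub>K\<^esub> \<oplus>\<^bsub>K\<^esub> \<one>\<^bsub>K\<^esub>)) \<ominus>\<^bsub>K\<^esub> t \<otimes>\<^bsub>K\<^esub> w =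
            t \<otimes>\<^bsub>K\<^esub> (t \<otimes>\<^bsub>K\<^esub> x) \<ominus>\<^bsub>K\<^esub> (x \<oplus>\<^bsub>K\<^esub> x) \<ominus>\<^bsub>K\<^esub> t \<otimes>\<^bsub>K\<^esub> w"
          using txw by algebra
        also have "\<dots> = t \<otimes>\<^bsub>K\<^esub> (w \<oplus>\<^bsub>K\<^esub> w) \<ominus>\<^bsub>K\<^esub> t \<otimes>\<^bsub>K\<^esub> w \<ominus>\<^bsub>K\<^esub> t \<otimes>\<^bsub>K\<^esub> w"
          unfolding 1[symmetric] 3[symmetric] ..
        also have "\<dots> = \<zero>\<^bsub>K\<^esub>" using txw by algebra
        finally show ?thesis .
      qed
      have tr: "h (R.tr U) = t" "h (R.tr V) = x" "h (R.tr (U \<otimes>\<^bsub>?M\<^esub> V)) = w"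
        using UM VM H.map_tr[of "U \<otimes>\<^bsub>?M\<^esub> V"] by (simp_all add: t_def x_def w_def H.map_tr)
      show "h a0 = \<zero>\<^bsub>K\<^esub>"
        unfolding a0 using UM VM e tr num by (simp add: R.minus_eq K.minus_eq)
      show "h a1 = \<zero>\<^bsub>K\<^esub>"
        unfolding a1 using UM VM e tr 1 txw by (simp add: R.minus_eq K.minus_eq K.r_neg)
    qed
    have hq1: "h F.q = \<ominus>\<^bsub>K\<^esub> \<one>\<^bsub>K\<^esub>"
    proof -
      have "?\<phi> a = \<zero>\<^bsub>?N\<^esub>" using a01 UM ha by (simp add: a_def K.sc_zero)
      then have "\<zero>\<^bsub>?N\<^esub> = ?\<phi> (a \<otimes>\<^bsub>?M\<^esub> R.adj a)" using aS by simp
      also have "\<dots> = K.sc (\<one>\<^bsub>K\<^esub> \<oplus>\<^bsub>K\<^esub> h F.q)" unfolding Q.norm_a by (simp add: K.sc_add K.sc_one)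
      finally have "\<one>\<^bsub>K\<^esub> \<oplus>\<^bsub>K\<^esub> h F.q = \<zero>\<^bsub>K\<^esub>" by (simp add: K.sc_zero[symmetric])
      then have "h F.q \<oplus>\<^bsub>K\<^esub> \<one>\<^bsub>K\<^esub> = \<zero>\<^bsub>K\<^esub>" by (simp add: K.a_comm)
      then show ?thesis using K.minus_equality[of "h F.q" "\<one>\<^bsub>K\<^esub>"] by simp
    qed
    show ?thesis
    proof (cases "a = \<zero>\<^bsub>?M\<^esub>")
      case True
      then show ?thesis using F.solvable_monomial[OF U] V unfolding Ve by simp
    next
      case False
      have a01_ne: "a0 \<noteq> \<zero>\<^bsub>R\<^esub> \<or> a1 \<noteq> \<zero>\<^bsub>R\<^esub>" using False UM by (auto simp: a_def R.sc_zero)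
      \<comment> \<open>Take for \<open>c\<close> the coordinate of \<open>a\<close> that divides the other one; then one coordinate
        of \<open>a'\<close> is one.\<close>
      obtain c a' where "c \<in> carrier R" "c \<noteq> \<zero>\<^bsub>R\<^esub>" "h c = \<zero>\<^bsub>K\<^esub>" "a' \<in> F.S" "a = R.sc c \<otimes>\<^bsub>?M\<^esub> a'" "?\<phi> a' \<noteq> \<zero>\<^bsub>?N\<^esub>"
      proof -
        have nz: "?\<phi> (R.sc x \<oplus>\<^bsub>?M\<^esub> R.sc y \<otimes>\<^bsub>?M\<^esub> U) \<noteq> \<zero>\<^bsub>?N\<^esub>"
          if xy: "x \<in> carrier R" "y \<in> carrier R" "x = \<one>\<^bsub>R\<^esub> \<or> y = \<one>\<^bsub>R\<^esub>" for x y
        proof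
          assume "?\<phi> (R.sc x \<oplus>\<^bsub>?M\<^esub> R.sc y \<otimes>\<^bsub>?M\<^esub> U) = \<zero>\<^bsub>?N\<^esub>"
          then have z: "K.sc (h x) \<oplus>\<^bsub>?N\<^esub> K.sc (h y) \<otimes>\<^bsub>?N\<^esub> ?u = \<zero>\<^bsub>?N\<^esub>" using xy UM by simp
          then have "K.adj (K.sc (h x) \<oplus>\<^bsub>?N\<^esub> K.sc (h y) \<otimes>\<^bsub>?N\<^esub> ?u) = \<zero>\<^bsub>?N\<^esub>" by simp
          then have z': "K.sc (h x) \<oplus>\<^bsub>?N\<^esub> K.sc (h y) \<otimes>\<^bsub>?N\<^esub> K.adj ?u = \<zero>\<^bsub>?N\<^esub>"
            using xy uN by (simp add: K.adj_add K.adj_mult K.sc_commute)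
          have "K.sc (h y) \<otimes>\<^bsub>?N\<^esub> ?u = K.sc (h y) \<otimes>\<^bsub>?N\<^esub> K.adj ?u"
            using z z' xy uN K.M.add.l_cancel[of "K.sc (h x)" "K.sc (h y) \<otimes>\<^bsub>?N\<^esub> ?u" "K.sc (h y) \<otimes>\<^bsub>?N\<^esub> K.adj ?u"]
            by simp
          then have "(?u \<ominus>\<^bsub>?N\<^esub> K.adj ?u) \<otimes>\<^bsub>?N\<^esub> K.sc (h y) = \<zero>\<^bsub>?N\<^esub>"
            using xy uN by (simp add: K.sc_commute[symmetric] K.M.minus_eq K.M.r_distr K.M.r_minus K.M.r_neg)
          then have "K.sc (h y) = \<zero>\<^bsub>?N\<^esub>" using Q.res_cancel xy by simp
          then have "h y = \<zero>\<^bsub>K\<^esub>" by (simp add: K.sc_zero[symmetric])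
          moreover have "h x = \<zero>\<^bsub>K\<^esub>" using z calculation xy uN by (simp add: K.sc_zero) (simp add: K.sc_zero[symmetric])
          ultimately show False using xy(3) K.one_not_zero by auto
        qed
        from chain[OF a01] show thesis
        proof
          assume "\<exists>t\<in>carrier R. a0 = a1 \<otimes>\<^bsub>R\<^esub> t"
          then obtain t where t: "t \<in> carrier R" "a0 = a1 \<otimes>\<^bsub>R\<^esub> t" by blast
          have "a1 \<noteq> \<zero>\<^bsub>R\<^esub>" using a01_ne t by auto
          moreover have "R.sc t \<oplus>\<^bsub>?M\<^esub> R.sc \<one>\<^bsub>R\<^esub> \<otimes>\<^bsub>?M\<^esub> U \<in> F.S" using t by (intro R.gen_algI[of t "\<one>\<^bsub>R\<^esub>"]) simp_all
          moreover have "a = R.sc a1 \<otimes>\<^bsub>?M\<^esub> (R.sc t \<oplus>\<^bsub>?M\<^esub> R.sc \<one>\<^bsub>R\<^esub> \<otimes>\<^bsub>?M\<^esub> U)"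
            using t a01 UM by (simp add: a_def R.M.r_distr R.sc_mult R.sc_one)
          moreover have "?\<phi> (R.sc t \<oplus>\<^bsub>?M\<^esub> R.sc \<one>\<^bsub>R\<^esub> \<otimes>\<^bsub>?M\<^esub> U) \<noteq> \<zero>\<^bsub>?N\<^esub>" using nz[of t "\<one>\<^bsub>R\<^esub>"] t by simp
          ultimately show thesis using that a01 ha by blast
        next
          assume "\<exists>t\<in>carrier R. a1 = a0 \<otimes>\<^bsub>R\<^esub> t"
          then obtain t where t: "t \<in> carrier R" "a1 = a0 \<otimes>\<^bsub>R\<^esub> t" by blast
          have "a0 \<noteq> \<zero>\<^bsub>R\<^esub>" using a01_ne t by auto
          moreover have "R.sc \<one>\<^bsub>R\<^esub> \<oplus>\<^bsub>?M\<^esub> R.sc t \<otimes>\<^bsub>?M\<^esub> U \<in> F.S" using t by (intro R.gen_algI[of "\<one>\<^bsub>R\<^esub>" t]) simp_all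
          moreover have "a = R.sc a0 \<otimes>\<^bsub>?M\<^esub> (R.sc \<one>\<^bsub>R\<^esub> \<oplus>\<^bsub>?M\<^esub> R.sc t \<otimes>\<^bsub>?M\<^esub> U)"
            using t a01 UM by (simp add: a_def R.M.r_distr R.sc_mult R.sc_one R.M.m_assoc)
          moreover have "?\<phi> (R.sc \<one>\<^bsub>R\<^esub> \<oplus>\<^bsub>?M\<^esub> R.sc t \<otimes>\<^bsub>?M\<^esub> U) \<noteq> \<zero>\<^bsub>?N\<^esub>" using nz[of "\<one>\<^bsub>R\<^esub>" t] t by simp
          ultimately show thesis using that a01 ha by blast
        qed
      qed
      then show ?thesis using Q.dihedral_contradiction[OF hq1] by blast
    qed
  qed
qed

section \<open>Valuation rings\<close>

locale valued_field = field E for E (structure) +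
  fixes v :: "'a \<Rightarrow> int"
  assumes val: "discrete_valuation E v"
begin

abbreviation Ov where "Ov \<equiv> valuation_ring E v"
abbreviation mv where "mv \<equiv> valuation_ideal E v"
abbreviation kv where "kv \<equiv> residue_field E v"
abbreviation red where "red \<equiv> (\<lambda>a. mv +>\<^bsub>Ov\<^esub> a)"

lemma v_mult:
  "x \<in> carrier E \<Longrightarrow> y \<in> carrier E \<Longrightarrow> x \<noteq> \<zero> \<Longrightarrow> y \<noteq> \<zero> \<Longrightarrow> v (x \<otimes> y) = v x + v y"
  using val hom_mult[of v "mult_of E" integer_group x y] by (simp add: discrete_valuation_def)

lemma v_add:
  "x \<in> carrier E \<Longrightarrow> y \<in> carrier E \<Longrightarrow> x \<noteq> \<zero> \<Longrightarrow> y \<noteq> \<zero> \<Longrightarrow> x \<oplus> y \<noteq> \<zero> \<Longrightarrow> min (v x) (v y) \<le> v (x \<oplus> y)"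
  using val by (simp add: discrete_valuation_def)

lemma v_one [simp]: "v \<one> = 0"
  using v_mult[of \<one> \<one>] by simp

lemma v_uminus: assumes "x \<in> carrier E" "x \<noteq> \<zero>" shows "v (\<ominus> x) = v x"
proof -
  have ne: "\<ominus> \<one> \<noteq> \<zero>" by (metis minus_minus minus_zero one_closed one_not_zero)
  have "v (\<ominus> \<one>) = 0" using v_mult[of "\<ominus> \<one>" "\<ominus> \<one>"] ne by (simp add: l_minus)
  then show ?thesis using v_mult[of "\<ominus> \<one>" x] assms ne by (simp add: l_minus)
qed

lemma v_inv: assumes "x \<in> carrier E" "x \<noteq> \<zero>"
  shows "inv x \<in> carrier E" "inv x \<noteq> \<zero>" "x \<otimes> inv x = \<one>" "v (inv x) = - v x"
proof -
  have u: "x \<in> Units E" using assms field_Units by simp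
  then show 1: "inv x \<in> carrier E" "x \<otimes> inv x = \<one>" by simp_all
  then show "inv x \<noteq> \<zero>" using assms by auto
  then show "v (inv x) = - v x" using v_mult[of x "inv x"] 1 assms by simp
qed

lemma Ov_sel [simp]:
  "x \<in> carrier Ov \<longleftrightarrow> x \<in> carrier E \<and> (x = \<zero> \<or> 0 \<le> v x)"
  "x \<otimes>\<^bsub>Ov\<^esub> y = x \<otimes> y" "x \<oplus>\<^bsub>Ov\<^esub> y = x \<oplus> y" "\<one>\<^bsub>Ov\<^esub> = \<one>" "\<zero>\<^bsub>Ov\<^esub> = \<zero>"
  by (simp_all add: valuation_ring_def)

lemma Ov_domain: "domain Ov"
  unfolding valuation_ring_def
proof (rule subring_is_domain, rule subringI)
  fix x y assume x: "x \<in> {x \<in> carrier E. x = \<zero> \<or> 0 \<le> v x}" and y: "y \<in> {x \<in> carrier E. x = \<zero> \<or> 0 \<le> v x}"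
  show "x \<otimes> y \<in> {x \<in> carrier E. x = \<zero> \<or> 0 \<le> v x}"
    using x y v_mult[of x y] by (cases "x = \<zero>"; cases "y = \<zero>") auto
  show "x \<oplus> y \<in> {x \<in> carrier E. x = \<zero> \<or> 0 \<le> v x}"
    using x y v_add[of x y] by (cases "x = \<zero>"; cases "y = \<zero>") auto
  show "\<ominus> x \<in> {x \<in> carrier E. x = \<zero> \<or> 0 \<le> v x}"
    using x v_uminus[of x] by (cases "x = \<zero>") auto
qed auto

sublocale O: domain Ov by (rule Ov_domain)

lemma Ov_uminus: "x \<in> carrier Ov \<Longrightarrow> \<ominus>\<^bsub>Ov\<^esub> x = \<ominus> x"
  using O.a_inv_closed[of x] by (intro minus_equality[symmetric]) (use O.l_neg[of x] in auto)

lemma mv_ideal: "ideal mv Ov"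
proof (rule idealI[OF O.ring_axioms])
  show "subgroup mv (add_monoid Ov)"
  proof (rule O.add.subgroupI)
    show "mv \<subseteq> carrier Ov" by (auto simp: valuation_ideal_def)
    show "mv \<noteq> {}" by (auto simp: valuation_ideal_def)
    fix x y assume x: "x \<in> mv" and y: "y \<in> mv"
    have "x \<in> carrier Ov" using x by (auto simp: valuation_ideal_def)
    then show "\<ominus>\<^bsub>Ov\<^esub> x \<in> mv" using x v_uminus[of x]
      by (cases "x = \<zero>") (auto simp: valuation_ideal_def Ov_uminus)
    show "x \<oplus>\<^bsub>Ov\<^esub> y \<in> mv"
      using x y v_add[of x y] by (cases "x = \<zero>"; cases "y = \<zero>"; cases "x \<oplus> y = \<zero>") (auto simp: valuation_ideal_def)
  qed
  fix a x assume ax: "a \<in> mv" "x \<in> carrier Ov"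
  show "x \<otimes>\<^bsub>Ov\<^esub> a \<in> mv"
    using ax v_mult[of x a] by (cases "a = \<zero>"; cases "x = \<zero>") (auto simp: valuation_ideal_def)
  show "a \<otimes>\<^bsub>Ov\<^esub> x \<in> mv"
    using ax v_mult[of a x] by (cases "a = \<zero>"; cases "x = \<zero>") (auto simp: valuation_ideal_def)
qed

lemma Ov_unit: assumes "x \<in> carrier Ov" "x \<notin> mv" shows "x \<in> Units Ov"
proof -
  have x: "x \<in> carrier E" "x \<noteq> \<zero>" "v x = 0" using assms by (auto simp: valuation_ideal_def)
  then have "inv x \<in> carrier Ov" "inv x \<otimes> x = \<one>" "x \<otimes> inv x = \<one>"
    using v_inv[of x] by (auto simp: m_comm)
  then show ?thesis using assms unfolding Units_def by auto
qed

lemma mv_maximal: "maximalideal mv Ov"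
proof (rule maximalidealI[OF mv_ideal])
  have "\<one> \<in> carrier Ov" "\<one> \<notin> mv" by (auto simp: valuation_ideal_def)
  then show "carrier Ov \<noteq> mv" by blast
next
  fix J assume J: "ideal J Ov" "mv \<subseteq> J" "J \<subseteq> carrier Ov"
  show "J = mv \<or> J = carrier Ov"
  proof (cases "J = mv")
    case False
    then obtain x where x: "x \<in> J" "x \<notin> mv" using J by blast
    have u: "x \<in> Units Ov" using Ov_unit x J by blast
    then have "inv\<^bsub>Ov\<^esub> x \<otimes>\<^bsub>Ov\<^esub> x \<in> J" using ideal.I_l_closed[OF J(1) x(1)] O.Units_inv_closed by blast
    then have "\<one>\<^bsub>Ov\<^esub> \<in> J" using O.Units_l_inv[OF u] by metis
    then show ?thesis using ideal.one_imp_carrier[OF J(1)] by blast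
  qed simp
qed

lemma kv_field: "field kv"
  unfolding residue_field_def by (rule maximalideal.quotient_is_field[OF mv_maximal O.is_cring])

lemma red_hom: "red \<in> ring_hom Ov kv"
  unfolding residue_field_def by (rule ideal.rcos_ring_hom[OF mv_ideal])

lemma red_unit: assumes "r \<in> carrier Ov" "red r \<noteq> \<zero>\<^bsub>kv\<^esub>" shows "r \<in> Units Ov"
proof (rule Ov_unit[OF assms(1)])
  have "abelian_subgroup mv Ov"
    using abelian_subgroupI3[OF ideal.axioms(1)[OF mv_ideal] O.is_abelian_group] .
  then show "r \<notin> mv" using assms(2) abelian_subgroup.a_rcos_const[of mv Ov r]
    by (auto simp: residue_field_def FactRing_def)
qed

lemma Ov_chain:
  assumes "r \<in> carrier Ov" "s \<in> carrier Ov"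
  shows "(\<exists>t\<in>carrier Ov. r = s \<otimes>\<^bsub>Ov\<^esub> t) \<or> (\<exists>t\<in>carrier Ov. s = r \<otimes>\<^bsub>Ov\<^esub> t)"
proof -
  have div: "\<exists>t\<in>carrier Ov. r = s \<otimes>\<^bsub>Ov\<^esub> t"
    if "r \<in> carrier E" "s \<in> carrier E" "r \<noteq> \<zero>" "s \<noteq> \<zero>" "v s \<le> v r" for r s
  proof (rule bexI)
    show "r = s \<otimes>\<^bsub>Ov\<^esub> (r \<otimes> inv s)" using v_inv[of s] that by (simp add: m_lcomm)
    show "r \<otimes> inv s \<in> carrier Ov" using v_inv[of s] v_mult[of r "inv s"] that by simp
  qed
  show ?thesis
  proof (cases "r = \<zero> \<or> s = \<zero>")
    case True
    then show ?thesis using assms by (auto intro: bexI[of _ \<zero>])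
  next
    case False
    then show ?thesis using div[of r s] div[of s r] assms by fastforce
  qed
qed

end

text \<open>
  If the additive order of the unit is a product, one of the factors annihilates the unit, as the ring is
  a domain.
\<close>
lemma (in field) characteristic_props:
  assumes p: "p = ring_characteristic R" and "p \<noteq> 0"
  shows "Factorial_Ring.prime p" "[p] \<cdot> \<one> = \<zero>" "\<And>n::nat. [n] \<cdot> \<one> = \<zero> \<longleftrightarrow> p dvd n"
proof -
  have dvd: "[n] \<cdot> \<one> = \<zero> \<longleftrightarrow> p dvd n" for n :: nat
    using group.pow_eq_id[OF a_group, of \<one> n] by (simp add: p ring_characteristic_def add_pow_def)
  then show "[n] \<cdot> \<one> = \<zero> \<longleftrightarrow> p dvd n" for n :: nat .
  show "[p] \<cdot> \<one> = \<zero>" using dvd by simp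
  have "p \<noteq> 1" using dvd[of 1] by auto
  moreover have "n = 1 \<or> n = p" if dv: "n dvd p" for n
  proof -
    obtain l where l: "p = n * l" using dv by (rule dvdE)
    have "([n] \<cdot> \<one>) \<otimes> ([l] \<cdot> \<one>) = [n] \<cdot> ([l] \<cdot> \<one>)" by (simp add: add_pow_ldistr)
    also have "\<dots> = [p] \<cdot> \<one>" by (simp add: add.nat_pow_pow l mult.commute)
    finally have "[n] \<cdot> \<one> = \<zero> \<or> [l] \<cdot> \<one> = \<zero>" using dvd[of p] integral by simp
    then have "p dvd n \<or> p dvd l" by (simp add: dvd)
    then show ?thesis
    proof
      assume "p dvd n" then show ?thesis using dv by (simp add: dvd_antisym)
    next
      assume "p dvd l"
      then have "l = p" using l by (simp add: dvd_antisym)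
      then show ?thesis using l \<open>p \<noteq> 0\<close> by simp
    qed
  qed
  ultimately show "Factorial_Ring.prime p" using \<open>p \<noteq> 0\<close> by (simp add: prime_nat_iff)
qed

section \<open>Projective groups and quotients\<close>

context domain
begin

lemma SL2_scalars_eq: "SL2_scalars R = {\<one>\<^bsub>M\<^esub>, \<ominus>\<^bsub>M\<^esub> \<one>\<^bsub>M\<^esub>}"
proof -
  have scalars: "A \<in> SL2_scalars R \<longleftrightarrow> A \<in> range sc \<and> A \<in> carrier (SL2 R)" for A
    by (auto simp: SL2_scalars_def mat_scal_def)
  show ?thesis
  proof (intro equalityI subsetI)
    fix A assume "A \<in> SL2_scalars R"
    then have "A \<in> range sc" "A \<in> carrier M" "dt A = \<one>" using scalars[of A] by (simp_all add: SL2_sel(1))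
    then show "A \<in> {\<one>\<^bsub>M\<^esub>, \<ominus>\<^bsub>M\<^esub> \<one>\<^bsub>M\<^esub>}" using scalar_det_one[of A] by simp
  next
    have "\<one>\<^bsub>M\<^esub> = sc \<one>" "\<ominus>\<^bsub>M\<^esub> \<one>\<^bsub>M\<^esub> = sc (\<ominus> \<one>)" by (simp_all add: sc_one sc_uminus)
    then have "\<one>\<^bsub>M\<^esub> \<in> range sc" "\<ominus>\<^bsub>M\<^esub> \<one>\<^bsub>M\<^esub> \<in> range sc" by blast+
    moreover have "\<one>\<^bsub>M\<^esub> \<in> carrier (SL2 R)" "\<ominus>\<^bsub>M\<^esub> \<one>\<^bsub>M\<^esub> \<in> carrier (SL2 R)"
      by (simp_all add: SL2_sel(1) dt_uminus)
    ultimately show "A \<in> SL2_scalars R" if "A \<in> {\<one>\<^bsub>M\<^esub>, \<ominus>\<^bsub>M\<^esub> \<one>\<^bsub>M\<^esub>}" for A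
      using that scalars[of A] by auto
  qed
qed

lemma SL2_scalars_normal: "SL2_scalars R \<lhd> SL2 R"
proof -
  interpret G: group "SL2 R" by (rule SL2_group)
  have neg: "\<ominus>\<^bsub>M\<^esub> \<one>\<^bsub>M\<^esub> \<in> carrier (SL2 R)" by (simp add: SL2_sel dt_uminus)
  have sub: "subgroup (SL2_scalars R) (SL2 R)"
    by (rule G.subgroupI) (use neg in \<open>auto simp: SL2_scalars_eq SL2_inv adj_uminus SL2_sel M.l_minus\<close>)
  have central: "z \<otimes>\<^bsub>SL2 R\<^esub> A = A \<otimes>\<^bsub>SL2 R\<^esub> z" if "z \<in> SL2_scalars R" "A \<in> carrier (SL2 R)" for z A
    using that by (auto simp: SL2_scalars_eq SL2_sel M.l_minus M.r_minus)
  show ?thesis unfolding G.normal_inv_iff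
  proof (intro conjI sub ballI)
    fix A z assume A: "A \<in> carrier (SL2 R)" and z: "z \<in> SL2_scalars R"
    have "A \<otimes>\<^bsub>SL2 R\<^esub> z \<otimes>\<^bsub>SL2 R\<^esub> inv\<^bsub>SL2 R\<^esub> A = z"
      using A z central[OF z A, symmetric] subgroup.mem_carrier[OF sub z] by (simp add: G.m_assoc)
    then show "A \<otimes>\<^bsub>SL2 R\<^esub> z \<otimes>\<^bsub>SL2 R\<^esub> inv\<^bsub>SL2 R\<^esub> A \<in> SL2_scalars R" using z by simp
  qed
qed

definition proj :: "'a mat2 \<Rightarrow> 'a mat2 set" where
  "proj A = SL2_scalars R #>\<^bsub>SL2 R\<^esub> A"

lemma PSL2_group: "group (PSL2 R)"
  unfolding PSL2_def by (rule normal.factorgroup_is_group[OF SL2_scalars_normal])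

lemma proj_group_hom: "group_hom (SL2 R) (PSL2 R) proj"
  using normal.r_coset_hom_Mod[OF SL2_scalars_normal]
  by (intro group_hom.intro group_hom_axioms.intro SL2_group PSL2_group) (simp add: PSL2_def proj_def[abs_def])

lemma proj_surj: "carrier (PSL2 R) = proj ` carrier (SL2 R)"
  by (simp add: PSL2_def carrier_FactGroup proj_def[abs_def])

lemma proj_one_iff:
  assumes "A \<in> carrier (SL2 R)"
  shows "proj A = \<one>\<^bsub>PSL2 R\<^esub> \<longleftrightarrow> A \<in> {\<one>\<^bsub>M\<^esub>, \<ominus>\<^bsub>M\<^esub> \<one>\<^bsub>M\<^esub>}"
proof -
  have "proj A = \<one>\<^bsub>PSL2 R\<^esub> \<longleftrightarrow> A \<in> SL2_scalars R"
    using group.coset_join1[OF SL2_group, of "SL2_scalars R" A] assms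
      group.coset_join2[OF SL2_group assms, of "SL2_scalars R"] normal_imp_subgroup[OF SL2_scalars_normal]
    by (auto simp: PSL2_def proj_def)
  then show ?thesis by (simp add: SL2_scalars_eq)
qed

lemma proj_elem: "A \<in> carrier (SL2 R) \<Longrightarrow> proj A = {A, \<ominus>\<^bsub>M\<^esub> A}"
  by (auto simp: proj_def r_coset_def SL2_scalars_eq SL2_sel M.l_minus)

end

text \<open>
  The index of a subgroup in a quotient bounds the number of cosets upstairs of any group that
  contains the kernel and a lift of the subgroup.
\<close>
lemma (in group_hom) few_cosets_of_image:
  assumes \<Gamma>: "\<Gamma> \<subseteq> carrier G" and T: "T \<subseteq> carrier G" and img: "h ` \<Gamma> \<subseteq> \<Delta>" and \<Delta>: "\<Delta> \<subseteq> h ` carrier G"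
    and fin: "finite ((\<lambda>d. h ` T #>\<^bsub>H\<^esub> d) ` \<Delta>)" and card: "card ((\<lambda>d. h ` T #>\<^bsub>H\<^esub> d) ` \<Delta>) < n"
    and sub: "subgroup (h ` T) H"
    and B: "subgroup B G" "T \<subseteq> B" and ker: "\<And>g. g \<in> carrier G \<Longrightarrow> h g = \<one>\<^bsub>H\<^esub> \<Longrightarrow> g \<in> B"
  shows "few_cosets G \<Gamma> B n"
proof -
  define Q where "Q = (\<lambda>d. h ` T #>\<^bsub>H\<^esub> d) ` \<Delta>"
  have "\<forall>C\<in>Q. \<exists>g. g \<in> carrier G \<and> C = h ` T #>\<^bsub>H\<^esub> h g"
    unfolding Q_def using \<Delta> by blast
  then obtain r where r: "\<And>C. C \<in> Q \<Longrightarrow> r C \<in> carrier G \<and> C = h ` T #>\<^bsub>H\<^esub> h (r C)" by metis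
  have "\<exists>f\<in>r ` Q. z \<otimes>\<^bsub>G\<^esub> inv\<^bsub>G\<^esub> f \<in> B" if z: "z \<in> \<Gamma>" for z
  proof -
    have zc: "z \<in> carrier G" using z \<Gamma> by blast
    define C where "C = h ` T #>\<^bsub>H\<^esub> h z"
    have C: "C \<in> Q" unfolding C_def Q_def using z img by blast
    have rc: "r C \<in> carrier G" "C = h ` T #>\<^bsub>H\<^esub> h (r C)" using r[OF C] by auto
    have "h z \<in> C" unfolding C_def using H.rcos_self[OF _ sub] zc by simp
    then obtain b where b: "b \<in> T" "h z = h b \<otimes>\<^bsub>H\<^esub> h (r C)" using rc(2) unfolding r_coset_def by auto
    have bc: "b \<in> carrier G" using b T by blast
    have "h (z \<otimes>\<^bsub>G\<^esub> inv\<^bsub>G\<^esub> (r C) \<otimes>\<^bsub>G\<^esub> inv\<^bsub>G\<^esub> b) = \<one>\<^bsub>H\<^esub>"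
      using b bc zc rc(1) by (simp add: H.m_assoc)
    then have "z \<otimes>\<^bsub>G\<^esub> inv\<^bsub>G\<^esub> (r C) \<otimes>\<^bsub>G\<^esub> inv\<^bsub>G\<^esub> b \<in> B" using ker zc rc(1) bc by simp
    then have "z \<otimes>\<^bsub>G\<^esub> inv\<^bsub>G\<^esub> (r C) \<otimes>\<^bsub>G\<^esub> inv\<^bsub>G\<^esub> b \<otimes>\<^bsub>G\<^esub> b \<in> B"
      by (rule subgroup.m_closed[OF B(1) _ subsetD[OF B(2) b(1)]])
    then have "z \<otimes>\<^bsub>G\<^esub> inv\<^bsub>G\<^esub> (r C) \<in> B" using zc rc(1) bc by (simp add: G.m_assoc)
    then show ?thesis using C by blast
  qed
  moreover have "finite (r ` Q)" "card (r ` Q) < n" "r ` Q \<subseteq> carrier G"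
    using fin card card_image_le[of Q r] r by (auto simp: Q_def)
  ultimately show ?thesis unfolding few_cosets_def by blast
qed

text \<open>
  The derived series may be formed in \<open>G\<close> or in \<open>H\<close>, since the inclusion is an injective
  homomorphism.
\<close>
lemma (in group) solvable_restrict:
  assumes "subgroup H G" "solvable_seq G H"
  shows "solvable (G\<lparr>carrier := H\<rparr>)"
proof -
  let ?H = "G\<lparr>carrier := H\<rparr>"
  have grp: "group ?H" by (rule subgroup_imp_group[OF assms(1)])
  have "(\<lambda>x. x) \<in> hom ?H G" using subgroup.subset[OF assms(1)] by (auto simp: hom_def)
  then interpret I: group_hom ?H G "\<lambda>x. x"
    by (intro group_hom.intro group_hom_axioms.intro grp is_group)
  show ?thesis unfolding solvable_def
    by (rule I.solvable_img_imp_solvable) (use assms(2) group.subgroup_self[OF grp] in \<open>auto simp: inj_on_def\<close>)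
qed

context valued_field
begin

sublocale K: field kv by (rule kv_field)
sublocale red: ring_hom_cring Ov kv red by unfold_locales (rule red_hom)

text \<open>
  The two representatives \<open>A\<close> and \<open>-A\<close> of a class reduce to representatives of the same class, so the
  set of values from which the reduction is extracted is a singleton.
\<close>
lemma PSL2_reduction_proj:
  assumes A: "A \<in> carrier (SL2 Ov)"
  shows "PSL2_reduction E v (O.proj A) = K.proj (mat2_map red A)"
proof -
  let ?f = "\<lambda>A. SL2_scalars kv #>\<^bsub>SL2 kv\<^esub> mat2_map red A"
  have AM: "A \<in> carrier (mat2_ring Ov)" using A by (simp add: O.SL2_sel)
  have neg: "\<ominus>\<^bsub>mat2_ring Ov\<^esub> A \<in> carrier (SL2 Ov)" using A by (simp add: O.SL2_sel O.dt_uminus)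
  have "mat2_map red (\<ominus>\<^bsub>mat2_ring Ov\<^esub> A) = \<ominus>\<^bsub>mat2_ring kv\<^esub> mat2_map red A" using AM by simp
  then have "K.proj (mat2_map red (\<ominus>\<^bsub>mat2_ring Ov\<^esub> A)) = K.proj (mat2_map red A)"
    using K.proj_elem[OF red.map_SL2[OF A]] K.proj_elem[OF red.map_SL2[OF neg]] AM red.map_SL2[OF A]
    by (simp add: K.SL2_sel insert_commute)
  then have "?f ` O.proj A = {K.proj (mat2_map red A)}"
    unfolding O.proj_elem[OF A] K.proj_def by simp
  then show ?thesis by (simp add: PSL2_reduction_def PSL2_map_def)
qed

end

section \<open>Index bound\<close>

theorem corollary6p3:
  fixes E :: "('a, 'b) ring_scheme" and v :: "'a \<Rightarrow> int" and p m :: nat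
    and P \<Gamma> :: "'a mat2 set monoid" and x y :: "'a mat2 set" and \<Theta>\<^sub>1 \<Theta>\<^sub>2 :: "'a mat2 set set"
  assumes "number_field E"
    and "discrete_valuation E v"
    and "p = ring_characteristic (residue_field E v)"
    and "odd p"
    and "odd m" and "7 \<le> m" and "m < p"
    and "P = PSL2 (valuation_ring E v)"
    and "x \<in> carrier P" and "y \<in> carrier P"
    and "\<Gamma> = P\<lparr>carrier := generate P {x, y}\<rparr>"
    and "\<not> solvable \<Gamma>"
    and "group.ord (PSL2 (residue_field E v)) (PSL2_reduction E v x) = m"
    and "\<Theta>\<^sub>1 = generate P {x [^]\<^bsub>P\<^esub> m, y}"
    and "\<Theta>\<^sub>2 = generate P {x, y \<otimes>\<^bsub>P\<^esub> x \<otimes>\<^bsub>P\<^esub> inv\<^bsub>P\<^esub> y \<otimes>\<^bsub>P\<^esub> x \<otimes>\<^bsub>P\<^esub> y \<otimes>\<^bsub>P\<^esub> inv\<^bsub>P\<^esub> x \<otimes>\<^bsub>P\<^esub> inv\<^bsub>P\<^esub> y}"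
  shows "enat p \<le> max (subgroup_index \<Gamma> \<Theta>\<^sub>1) (subgroup_index \<Gamma> \<Theta>\<^sub>2)"
proof (rule ccontr)
  assume "\<not> ?thesis"
  then have small: "subgroup_index \<Gamma> \<Theta>\<^sub>1 < enat p" by (simp add: not_le)
  interpret valued_field E v
    using assms(1,2) by (intro valued_field.intro valued_field_axioms.intro) (simp_all add: number_field_def)
  let ?G = "SL2 Ov" and ?M = "mat2_ring Ov" and ?N = "mat2_ring kv"
  have P: "P = PSL2 Ov" by (rule assms(8))
  interpret \<pi>: group_hom ?G P O.proj unfolding P by (rule O.proj_group_hom)
  interpret \<kappa>: group_hom "SL2 kv" "PSL2 kv" K.proj by (rule K.proj_group_hom)
  have ch: "Factorial_Ring.prime p" "[p] \<cdot>\<^bsub>kv\<^esub> \<one>\<^bsub>kv\<^esub> = \<zero>\<^bsub>kv\<^esub>" "\<And>n::nat. [n] \<cdot>\<^bsub>kv\<^esub> \<one>\<^bsub>kv\<^esub> = \<zero>\<^bsub>kv\<^esub> \<longleftrightarrow> p dvd n"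
    using K.characteristic_props[OF assms(3)] assms(7) by auto
  have "\<not> p dvd 2" using assms(6,7) by (auto dest: dvd_imp_le)
  then have two: "\<one>\<^bsub>kv\<^esub> \<oplus>\<^bsub>kv\<^esub> \<one>\<^bsub>kv\<^esub> \<noteq> \<zero>\<^bsub>kv\<^esub>" using ch(3)[of 2] by (simp add: numeral_2_eq_2)
  obtain U V where U: "U \<in> carrier ?G" "x = O.proj U" and V: "V \<in> carrier ?G" "y = O.proj V"
    using assms(9,10) O.proj_surj unfolding P by auto
  define neg where "neg = \<ominus>\<^bsub>?M\<^esub> \<one>\<^bsub>?M\<^esub>"
  have neg: "neg \<in> carrier ?G" by (simp add: neg_def O.SL2_sel O.dt_uminus)
  have \<pi>neg: "O.proj neg = \<one>\<^bsub>P\<^esub>" using O.proj_one_iff[OF neg] by (simp add: P neg_def)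
  have gens: "{U, V, neg} \<subseteq> carrier ?G" using U V neg by simp
  have xy: "{x, y} \<subseteq> carrier P" using assms(9,10) by simp
  have \<Gamma>_sub: "subgroup (generate P {x, y}) P" by (rule \<pi>.H.generate_is_subgroup[OF xy])
  have img: "O.proj ` generate ?G {U, V, neg} = generate P {x, y}"
  proof -
    have "O.proj ` generate ?G {U, V, neg} = generate P {x, y, \<one>\<^bsub>P\<^esub>}"
      using \<pi>.generate_img[OF gens] by (simp add: U V \<pi>neg)
    also have "\<dots> = generate P {x, y}"
    proof
      show "generate P {x, y, \<one>\<^bsub>P\<^esub>} \<subseteq> generate P {x, y}"
        by (rule \<pi>.H.generate_subgroup_incl[OF _ \<Gamma>_sub]) (auto intro: generate.incl generate.one)
      show "generate P {x, y} \<subseteq> generate P {x, y, \<one>\<^bsub>P\<^esub>}" by (rule \<pi>.H.mono_generate) auto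
    qed
    finally show ?thesis .
  qed
  have ord: "mat2_map red U [^]\<^bsub>SL2 kv\<^esub> j \<in> {\<one>\<^bsub>?N\<^esub>, \<ominus>\<^bsub>?N\<^esub> \<one>\<^bsub>?N\<^esub>} \<longleftrightarrow> m dvd j" for j :: nat
  proof -
    let ?u = "mat2_map red U"
    have u: "?u \<in> carrier (SL2 kv)" by (rule red.map_SL2[OF U(1)])
    have "group.ord (PSL2 kv) (K.proj ?u) = m" using assms(13) PSL2_reduction_proj[OF U(1)] U(2) by simp
    then have "K.proj ?u [^]\<^bsub>PSL2 kv\<^esub> j = \<one>\<^bsub>PSL2 kv\<^esub> \<longleftrightarrow> m dvd j"
      using \<kappa>.H.pow_eq_id[of "K.proj ?u" j] u by simp
    moreover have "K.proj ?u [^]\<^bsub>PSL2 kv\<^esub> j = K.proj (?u [^]\<^bsub>SL2 kv\<^esub> j)"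
      using \<kappa>.hom_nat_pow[OF u] by simp
    ultimately show ?thesis using K.proj_one_iff[of "?u [^]\<^bsub>SL2 kv\<^esub> j"] u by simp
  qed
  let ?T = "generate ?G {U [^]\<^bsub>?G\<^esub> m, V}"
  have T: "{U [^]\<^bsub>?G\<^esub> m, V} \<subseteq> carrier ?G" using U V by simp
  have \<Theta>: "O.proj ` ?T = \<Theta>\<^sub>1"
    using \<pi>.generate_img[OF T] by (simp add: assms(14) U V \<pi>.hom_nat_pow)
  have cosets: "rcosets\<^bsub>\<Gamma>\<^esub> \<Theta>\<^sub>1 = (\<lambda>d. \<Theta>\<^sub>1 #>\<^bsub>P\<^esub> d) ` generate P {x, y}"
    by (auto simp: assms(11) RCOSETS_def r_coset_def)
  have fin: "finite (rcosets\<^bsub>\<Gamma>\<^esub> \<Theta>\<^sub>1)" "card (rcosets\<^bsub>\<Gamma>\<^esub> \<Theta>\<^sub>1) < p"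
    using small by (auto simp: subgroup_index_def split: if_splits)
  \<comment> \<open>A group that contains \<open>U\<^sup>m\<close>, \<open>V\<close> and \<open>-1\<close> contains the preimage of \<open>\<Theta>\<^sub>1\<close>.\<close>
  have few: "few_cosets ?G (generate ?G {U, V, neg}) B p"
    if B: "subgroup B ?G" "U [^]\<^bsub>?G\<^esub> m \<in> B" "V \<in> B" "neg \<in> B" for B
  proof (rule \<pi>.few_cosets_of_image)
    show "generate ?G {U, V, neg} \<subseteq> carrier ?G" by (rule \<pi>.G.generate_incl[OF gens])
    show "?T \<subseteq> carrier ?G" by (rule \<pi>.G.generate_incl[OF T])
    show "O.proj ` generate ?G {U, V, neg} \<subseteq> generate P {x, y}" using img by simp
    show "generate P {x, y} \<subseteq> O.proj ` carrier ?G"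
      using \<pi>.H.generate_incl[OF xy] O.proj_surj by (simp add: P)
    show "finite ((\<lambda>d. O.proj ` ?T #>\<^bsub>P\<^esub> d) ` generate P {x, y})"
      "card ((\<lambda>d. O.proj ` ?T #>\<^bsub>P\<^esub> d) ` generate P {x, y}) < p"
      using fin unfolding \<Theta> cosets by simp_all
    show "subgroup (O.proj ` ?T) P"
      by (rule \<pi>.subgroup_img_is_subgroup[OF \<pi>.G.generate_is_subgroup[OF T]])
    show "subgroup B ?G" by fact
    show "?T \<subseteq> B" by (rule \<pi>.G.generate_subgroup_incl[OF _ B(1)]) (use B in simp)
    fix g assume "g \<in> carrier ?G" "O.proj g = \<one>\<^bsub>P\<^esub>"
    then have "g = \<one>\<^bsub>?M\<^esub> \<or> g = neg" using O.proj_one_iff[of g] by (simp add: P neg_def)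
    then show "g \<in> B" using B subgroup.one_closed[OF B(1)] by (auto simp: O.SL2_sel)
  qed
  have "solvable_seq ?G (generate ?G {U, V, neg})"
    unfolding neg_def
    by (rule solvable_of_small_index[OF Ov_domain kv_field red_hom red_unit Ov_chain two ch(1,2) assms(5-7) U(1) V(1) ord])
      (use few in \<open>auto simp: neg_def\<close>)
  then have "solvable_seq P (generate P {x, y})" using \<pi>.solvable_imp_solvable_img img by metis
  then have "solvable \<Gamma>" unfolding assms(11) by (rule \<pi>.H.solvable_restrict[OF \<Gamma>_sub])
  then show False using assms(12) by simp
qed

end
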